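(* Let $n,k$ be positive integers and let $\lambda\in\Lambda_{\leq n}$ be a partition of $r$. Then the multiplicity of the irreducible representation $V_n^\lambda$ of $\mathbb{C}R_n$ in $(\mathbb{C}^n)^{\otimes k}$ is $S(k,r)f^\lambda$.
   Context: $R_n$ (the rook monoid) is the monoid, under matrix multiplication, of $n\times n$ matrices with entries in $\{0,1\}$ having at most one nonzero entry in each row and each column; $\mathbb{C}R_n$ is its (semisimple) monoid algebra. $R_n$ acts on $\mathbb{C}^n$ by matrix multiplication and on $(\mathbb{C}^n)^{\otimes k}$ diagonally. $\Lambda_{\leq n}$ is the set of all partitions (Young diagrams) of $r$ with $0\le r\le n$. $S(k,r)$ is the Stirling number of the second kind (the number of set partitions of $\{1,\dots,k\}$ into $r$ blocks), and $f^\lambda$ is the number of standard Young tableaux of shape $\lambda$. Irreducible representations $V_n^\lambda$: let $s_i\in R_n$ be the permutation matrix of the transposition $(i,i+1)$ and $P_1\in R_n$ the diagonal matrix with first diagonal entry $0$ and the others $1$; these generate $\mathbb{C}R_n$. An $n$-standard tableau of shape $\lambda\in\Lambda_{\leq n}$ is a filling of the boxes of $\lambda$ with entries from $\{1,\dots,n\}$ strictly increasing along rows (left to right) and columns (top to bottom); $\tau_n^\lambda$ is the set of these. For $i\in L$ ($i$ an entry of $L$), $L(i)$ is the box containing $i$; the content of the box in row $x$, column $y$ is $\mathrm{ct}=y-x$. $s_iL$ is obtained from $L$ by interchanging $i$ and $i+1$ wherever they occur. $V_n^\lambda$ has basis $\{v_L\mid L\in\tau_n^\lambda\}$, with $s_iv_L=v_{s_iL}$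 if exactly one of $i,i+1$ is in $L$; $s_iv_L=v_L$ if neither is; if both are, $s_iv_L=a\,v_L+(1+a)v_{L'}$ with $a=\frac{1}{\mathrm{ct}(L(i+1))-\mathrm{ct}(L(i))}$ and $v_{L'}=v_{s_iL}$ if $s_iL\in\tau_n^\lambda$, $v_{L'}=0$ otherwise; and $P_1v_L=v_L$ if $1\notin L$, $P_1v_L=0$ otherwise. The $V_n^\lambda$, $\lambda\in\Lambda_{\leq n}$, form a complete set of pairwise nonisomorphic irreducible representations of $\mathbb{C}R_n$. *)

theory Defs
  imports
    "HOL-Library.Function_Algebras"
    "HOL-Library.FuncSet"
    "HOL-Algebra.Group"
    "HOL-Combinatorics.Stirling"
    "HOL-Combinatorics.Transposition"
    "Jordan_Normal_Form.Matrix"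
begin

section \<open>Complex representations of monoids\<close>

text \<open>
  A finite-dimensional complex vector space is realised inside the functions on a set of basis
  indices, with the pointwise operations. A module over the monoid algebra of \<open>G\<close> is the same thing
  as a representation of the monoid \<open>G\<close> (the action extends linearly), and submodules, isomorphisms
  and irreducibility agree; everything is therefore phrased for \<open>G\<close>.
\<close>

definition cscale :: "complex \<Rightarrow> ('b \<Rightarrow> complex) \<Rightarrow> 'b \<Rightarrow> complex" where
  "cscale c f = (\<lambda>x. c * f x)"

interpretation fvs: vector_space cscale
  by unfold_locales (auto simp: cscale_def fun_eq_iff algebra_simps)

definition coord_space :: "'b set \<Rightarrow> ('b \<Rightarrow> complex) set" where
  "coord_space B = {f. \<forall>x. x \<notin> B \<longrightarrow> f x = 0}"

definition unit_fun :: "'b \<Rightarrow> 'b \<Rightarrow> complex" where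
  "unit_fun b = (\<lambda>x. if x = b then 1 else 0)"

definition linear_map_on :: "('b \<Rightarrow> complex) set \<Rightarrow> (('b \<Rightarrow> complex) \<Rightarrow> ('c \<Rightarrow> complex)) \<Rightarrow> bool" where
  "linear_map_on V \<phi> \<longleftrightarrow>
     (\<forall>u\<in>V. \<forall>v\<in>V. \<phi> (u + v) = \<phi> u + \<phi> v) \<and> (\<forall>c. \<forall>v\<in>V. \<phi> (cscale c v) = cscale c (\<phi> v))"

record ('g, 'b) rep =
  rep_space :: "('b \<Rightarrow> complex) set"
  rep_act :: "'g \<Rightarrow> ('b \<Rightarrow> complex) \<Rightarrow> ('b \<Rightarrow> complex)"

definition representation :: "'g monoid \<Rightarrow> ('g, 'b) rep \<Rightarrow> bool" where
  "representation G W \<longleftrightarrow>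
     fvs.subspace (rep_space W) \<and>
     (\<forall>g\<in>carrier G. linear_map_on (rep_space W) (rep_act W g) \<and>
        (\<forall>v\<in>rep_space W. rep_act W g v \<in> rep_space W)) \<and>
     (\<forall>v\<in>rep_space W. rep_act W \<one>\<^bsub>G\<^esub> v = v) \<and>
     (\<forall>g\<in>carrier G. \<forall>h\<in>carrier G. \<forall>v\<in>rep_space W.
        rep_act W (g \<otimes>\<^bsub>G\<^esub> h) v = rep_act W g (rep_act W h v))"

definition invariant_subspace :: "'g monoid \<Rightarrow> ('g, 'b) rep \<Rightarrow> ('b \<Rightarrow> complex) set \<Rightarrow> bool" where
  "invariant_subspace G W U \<longleftrightarrow>
     fvs.subspace U \<and> U \<subseteq> rep_space W \<and> (\<forall>g\<in>carrier G. \<forall>u\<in>U. rep_act W g u \<in> U)"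

definition irreducible_rep :: "'g monoid \<Rightarrow> ('g, 'b) rep \<Rightarrow> bool" where
  "irreducible_rep G W \<longleftrightarrow>
     representation G W \<and> rep_space W \<noteq> {0} \<and>
     (\<forall>U. invariant_subspace G W U \<longrightarrow> U = {0} \<or> U = rep_space W)"

definition rep_isomorphic :: "'g monoid \<Rightarrow> ('g, 'b) rep \<Rightarrow> ('g, 'c) rep \<Rightarrow> bool" where
  "rep_isomorphic G V W \<longleftrightarrow>
     (\<exists>\<phi>. linear_map_on (rep_space V) \<phi> \<and> bij_betw \<phi> (rep_space V) (rep_space W) \<and>
        (\<forall>g\<in>carrier G. \<forall>v\<in>rep_space V. \<phi> (rep_act V g v) = rep_act W g (\<phi> v)))"

definition subrep :: "('g, 'b) rep \<Rightarrow> ('b \<Rightarrow> complex) set \<Rightarrow> ('g, 'b) rep" where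
  "subrep W U = \<lparr>rep_space = U, rep_act = rep_act W\<rparr>"

text \<open>
  An internal direct sum of irreducible subrepresentations. The summands form a set rather than
  a family: nonzero summands of a direct sum are pairwise distinct.
\<close>

definition irreducible_decomposition ::
    "'g monoid \<Rightarrow> ('g, 'b) rep \<Rightarrow> ('b \<Rightarrow> complex) set set \<Rightarrow> bool" where
  "irreducible_decomposition G W \<U> \<longleftrightarrow>
     finite \<U> \<and>
     (\<forall>U\<in>\<U>. invariant_subspace G W U \<and> irreducible_rep G (subrep W U)) \<and>
     (\<forall>w\<in>rep_space W. \<exists>!f. f \<in> (\<Pi>\<^sub>E U\<in>\<U>. U) \<and> w = (\<Sum>U\<in>\<U>. f U))"

text \<open>
  The multiplicity of \<open>V\<close> in \<open>W\<close> is \<open>m\<close>: \<open>W\<close> is a direct sum of irreducibles, and in every such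
  decomposition exactly \<open>m\<close> summands are isomorphic to \<open>V\<close>.
\<close>

definition has_multiplicity :: "'g monoid \<Rightarrow> ('g, 'c) rep \<Rightarrow> ('g, 'b) rep \<Rightarrow> nat \<Rightarrow> bool" where
  "has_multiplicity G V W m \<longleftrightarrow>
     (\<exists>\<U>. irreducible_decomposition G W \<U>) \<and>
     (\<forall>\<U>. irreducible_decomposition G W \<U> \<longrightarrow>
        card {U \<in> \<U>. rep_isomorphic G (subrep W U) V} = m)"


section \<open>The rook monoid and the tensor powers of its natural representation\<close>

text \<open>Row and column indices of the matrices start at \<open>0\<close>.\<close>

definition rook_monoid :: "nat \<Rightarrow> complex mat monoid" where
  "rook_monoid n =
     \<lparr>carrier = {A \<in> carrier_mat n n.
         (\<forall>i<n. \<forall>j<n. A $$ (i, j) = 0 \<or> A $$ (i, j) = 1) \<and>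
         (\<forall>i<n. card {j. j < n \<and> A $$ (i, j) \<noteq> 0} \<le> 1) \<and>
         (\<forall>j<n. card {i. i < n \<and> A $$ (i, j) \<noteq> 0} \<le> 1)},
      mult = (*), one = 1\<^sub>m n\<rparr>"

definition rook_s :: "nat \<Rightarrow> nat \<Rightarrow> complex mat" where
  "rook_s n i = mat n n (\<lambda>(a, b). if a = transpose (i - 1) i b then 1 else 0)"

definition rook_P1 :: "nat \<Rightarrow> complex mat" where
  "rook_P1 n = mat n n (\<lambda>(a, b). if a = b \<and> a \<noteq> 0 then 1 else 0)"

text \<open>
  The \<open>k\<close>-th tensor power of the space of column vectors, in coordinates: the index \<open>p\<close> stands for
  the basis tensor \<open>e\<^bsub>p 0\<^esub> \<otimes> \<dots> \<otimes> e\<^bsub>p (k-1)\<^esub>\<close>. That \<open>tensor_act\<close> is the diagonal action is the lemma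
  \<open>tensor_act_pure_tensor\<close>.
\<close>

definition tensor_index :: "nat \<Rightarrow> nat \<Rightarrow> (nat \<Rightarrow> nat) set" where
  "tensor_index n k = {..<k} \<rightarrow>\<^sub>E {..<n}"

definition tensor_act ::
    "nat \<Rightarrow> nat \<Rightarrow> complex mat \<Rightarrow> ((nat \<Rightarrow> nat) \<Rightarrow> complex) \<Rightarrow> (nat \<Rightarrow> nat) \<Rightarrow> complex" where
  "tensor_act n k A t = (\<lambda>p. if p \<in> tensor_index n k
     then (\<Sum>q\<in>tensor_index n k. (\<Prod>m<k. A $$ (p m, q m)) * t q) else 0)"

definition tensor_rep :: "nat \<Rightarrow> nat \<Rightarrow> (complex mat, nat \<Rightarrow> nat) rep" where
  "tensor_rep n k = \<lparr>rep_space = coord_space (tensor_index n k), rep_act = tensor_act n k\<rparr>"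

definition pure_tensor :: "nat \<Rightarrow> nat \<Rightarrow> (nat \<Rightarrow> complex vec) \<Rightarrow> (nat \<Rightarrow> nat) \<Rightarrow> complex" where
  "pure_tensor n k v = (\<lambda>p. if p \<in> tensor_index n k then (\<Prod>m<k. v m $ p m) else 0)"

lemma tensor_act_pure_tensor:
  assumes A: "A \<in> carrier_mat n n" and v: "\<And>m. m < k \<Longrightarrow> v m \<in> carrier_vec n"
  shows "tensor_act n k A (pure_tensor n k v) = pure_tensor n k (\<lambda>m. A *\<^sub>v v m)"
proof
  fix p
  show "tensor_act n k A (pure_tensor n k v) p = pure_tensor n k (\<lambda>m. A *\<^sub>v v m) p"
  proof (cases "p \<in> tensor_index n k")
    case True
    have "(\<Prod>m<k. (A *\<^sub>v v m) $ p m) = (\<Prod>m<k. \<Sum>j<n. A $$ (p m, j) * v m $ j)"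
    proof (rule prod.cong[OF refl])
      fix m assume "m \<in> {..<k}"
      then have "p m < n" and "v m \<in> carrier_vec n"
        using True v by (auto simp: tensor_index_def)
      then show "(A *\<^sub>v v m) $ p m = (\<Sum>j<n. A $$ (p m, j) * v m $ j)"
        using A by (auto simp: scalar_prod_def atLeast0LessThan intro!: sum.cong)
    qed
    also have "\<dots> = (\<Sum>q\<in>tensor_index n k. \<Prod>m<k. A $$ (p m, q m) * v m $ q m)"
      unfolding tensor_index_def by (rule prod_sum_PiE) auto
    finally show ?thesis
      using True by (simp add: tensor_act_def pure_tensor_def prod.distrib)
  qed (simp add: tensor_act_def pure_tensor_def)
qed


section \<open>Tableaux and the representations indexed by partitions\<close>

text \<open>
  A partition is the weakly decreasing list of its positive parts. Boxes are pairs
  (row, column), both counted from \<open>0\<close>, which does not change contents.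
\<close>

definition is_partition :: "nat list \<Rightarrow> bool" where
  "is_partition \<mu> \<longleftrightarrow> sorted_wrt (\<ge>) \<mu> \<and> 0 \<notin> set \<mu>"

definition partitions_upto :: "nat \<Rightarrow> nat list set" where
  "partitions_upto n = {\<mu>. is_partition \<mu> \<and> sum_list \<mu> \<le> n}"

definition boxes :: "nat list \<Rightarrow> (nat \<times> nat) set" where
  "boxes \<mu> = {(x, y). x < length \<mu> \<and> y < \<mu> ! x}"

definition content :: "nat \<times> nat \<Rightarrow> int" where
  "content b = int (snd b) - int (fst b)"

definition increasing_filling :: "nat list \<Rightarrow> (nat \<times> nat \<Rightarrow> nat) \<Rightarrow> bool" where
  "increasing_filling \<mu> L \<longleftrightarrow>
     (\<forall>x y y'. y < y' \<longrightarrow> (x, y') \<in> boxes \<mu> \<longrightarrow> L (x, y) < L (x, y')) \<and>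
     (\<forall>x x' y. x < x' \<longrightarrow> (x', y) \<in> boxes \<mu> \<longrightarrow> L (x, y) < L (x', y))"

text \<open>
  Each number occurs at most once in an \<open>n\<close>-standard tableau; only then is there
  a single box containing a given entry.
\<close>

definition n_standard_tableaux :: "nat \<Rightarrow> nat list \<Rightarrow> (nat \<times> nat \<Rightarrow> nat) set" where
  "n_standard_tableaux n \<mu> =
     {L \<in> boxes \<mu> \<rightarrow>\<^sub>E {1..n}. inj_on L (boxes \<mu>) \<and> increasing_filling \<mu> L}"

definition standard_young_tableaux :: "nat list \<Rightarrow> (nat \<times> nat \<Rightarrow> nat) set" where
  "standard_young_tableaux \<mu> =
     {L \<in> boxes \<mu> \<rightarrow>\<^sub>E {1..sum_list \<mu>}.
        bij_betw L (boxes \<mu>) {1..sum_list \<mu>} \<and> increasing_filling \<mu> L}"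

definition num_SYT :: "nat list \<Rightarrow> nat" where
  "num_SYT \<mu> = card (standard_young_tableaux \<mu>)"

definition entries :: "nat list \<Rightarrow> (nat \<times> nat \<Rightarrow> nat) \<Rightarrow> nat set" where
  "entries \<mu> L = L ` boxes \<mu>"

definition box_of :: "nat list \<Rightarrow> (nat \<times> nat \<Rightarrow> nat) \<Rightarrow> nat \<Rightarrow> nat \<times> nat" where
  "box_of \<mu> L i = the_inv_into (boxes \<mu>) L i"

definition swap_entries :: "nat list \<Rightarrow> nat \<Rightarrow> (nat \<times> nat \<Rightarrow> nat) \<Rightarrow> nat \<times> nat \<Rightarrow> nat" where
  "swap_entries \<mu> i L = restrict (\<lambda>b. transpose i (i + 1) (L b)) (boxes \<mu>)"

definition s_on_basis ::
    "nat \<Rightarrow> nat list \<Rightarrow> nat \<Rightarrow> (nat \<times> nat \<Rightarrow> nat) \<Rightarrow> (nat \<times> nat \<Rightarrow> nat) \<Rightarrow> complex" where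
  "s_on_basis n \<mu> i L =
     (if i \<in> entries \<mu> L \<and> i + 1 \<in> entries \<mu> L then
        let a = 1 / of_int (content (box_of \<mu> L (i + 1)) - content (box_of \<mu> L i));
            L' = swap_entries \<mu> i L
        in cscale a (unit_fun L) +
           cscale (1 + a) (if L' \<in> n_standard_tableaux n \<mu> then unit_fun L' else 0)
      else if i \<in> entries \<mu> L \<or> i + 1 \<in> entries \<mu> L then unit_fun (swap_entries \<mu> i L)
      else unit_fun L)"

definition P1_on_basis :: "nat list \<Rightarrow> (nat \<times> nat \<Rightarrow> nat) \<Rightarrow> (nat \<times> nat \<Rightarrow> nat) \<Rightarrow> complex" where
  "P1_on_basis \<mu> L = (if 1 \<in> entries \<mu> L then 0 else unit_fun L)"

text \<open>
  The matrices \<open>rook_s n i\<close> (\<open>1 \<le> i < n\<close>) and \<open>rook_P1 n\<close> generate the rook monoid, so these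
  conditions determine the action of every rook matrix on the space.
\<close>

definition is_seminormal_rep ::
    "nat \<Rightarrow> nat list \<Rightarrow> (complex mat, nat \<times> nat \<Rightarrow> nat) rep \<Rightarrow> bool" where
  "is_seminormal_rep n \<mu> V \<longleftrightarrow>
     representation (rook_monoid n) V \<and>
     rep_space V = coord_space (n_standard_tableaux n \<mu>) \<and>
     (\<forall>i\<in>{1..<n}. \<forall>L\<in>n_standard_tableaux n \<mu>.
        rep_act V (rook_s n i) (unit_fun L) = s_on_basis n \<mu> i L) \<and>
     (\<forall>L\<in>n_standard_tableaux n \<mu>. rep_act V (rook_P1 n) (unit_fun L) = P1_on_basis \<mu> L)"

definition seminormal_rep :: "nat \<Rightarrow> nat list \<Rightarrow> (complex mat, nat \<times> nat \<Rightarrow> nat) rep" where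
  "seminormal_rep n \<mu> = (SOME V. is_seminormal_rep n \<mu> V)"

end

theory Submission
  imports Defs
begin

text \<open>
  Let \<open>W\<close> be the tensor power, \<open>V\<close> the seminormal representation of the partition \<open>\<mu>\<close> of \<open>r\<close>, and
  \<open>v\<^sub>0\<close> the basis vector of one standard Young tableau, with entries \<open>1, \<dots>, r\<close>. The proof computes the
  multiplicity as the dimension of the space of all \<open>\<phi> v\<^sub>0\<close>, where \<open>\<phi>\<close> runs through the intertwiners
  \<open>V \<rightarrow> W\<close>. This dimension is the multiplicity in every decomposition into irreducibles
  (\<open>multiplicity_eq_dim\<close>), provided that \<open>V\<close> is irreducible and its endomorphisms map \<open>v\<^sub>0\<close> to multiples
  of \<open>v\<^sub>0\<close>. Decompositions exist because the set of rook matrices is closed under transposition, so that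
  orthogonal complements of invariant subspaces of \<open>W\<close> are invariant (\<open>tensor_completely_reducible\<close>).

  The intertwiners are counted as follows. The idempotent of a set \<open>D\<close> of columns keeps the tensors
  \<open>e\<^sub>q\<close> whose indices \<open>q\<close> have all values in \<open>D\<close>, and the tableaux with all entries in \<open>D\<close>. Since all
  tableaux have \<open>r\<close> entries, \<open>\<phi> v\<^sub>0\<close> is supported on the \<open>q\<close> with exactly \<open>r\<close> values. Up to renaming the
  values these are the surjections of \<open>{..<k}\<close> onto \<open>{..<r}\<close>, on which the symmetric group of \<open>{..<r}\<close>
  acts freely with \<open>Stirling k r\<close> orbits (\<open>orbit_transversal\<close>). At a representative \<open>p\<close> of an orbit the
  coefficient of \<open>e\<^sub>p\<close> in \<open>\<phi> v\<close> is a linear form in \<open>v\<close> that only sees the standard Young tableaux; it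
  determines \<open>\<phi>\<close> on the orbit, and conversely every such form extends to an intertwiner. So each orbit
  contributes as many dimensions as there are standard Young tableaux (\<open>dim_intertwiners\<close>).

  Two facts about \<open>V\<close> are needed. First, it exists, that is, Young's formulas define a representation
  (\<open>seminormal_rep_exists\<close>). They satisfy the relations of the Coxeter presentation, where the braid
  relation comes down to one identity between inverse differences of contents; the presentation is
  proved by induction along the chain of symmetric groups (\<open>presentation\<close>). The action extends from
  permutations to rook matrices because a rook matrix is a permutation restricted to a set of columns.
  Second, \<open>V\<close> is irreducible with scalar endomorphisms (\<open>irreducible\<close>, \<open>endomorphism_scalar\<close>): the
  Jucys-Murphy elements act diagonally on the standard Young tableaux, with contents as eigenvalues,
  and these separate the tableaux, while exchanges of consecutive entries connect all of them.
\<close>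

section \<open>Complete reducibility from an invariant Hermitian form\<close>

lemma sum_fun_apply: "(\<Sum>i\<in>I. f i) x = (\<Sum>i\<in>I. f i x)"
  by (induction I rule: infinite_finite_induct) auto

lemma cscale_apply [simp]: "cscale c f x = c * f x"
  by (simp add: cscale_def)

lemma subspace_coord_space: "fvs.subspace (coord_space B)"
  by (auto simp: fvs.subspace_def coord_space_def)

lemma unit_fun_in_coord_space: "b \<in> B \<Longrightarrow> unit_fun b \<in> coord_space B"
  by (auto simp: coord_space_def unit_fun_def)

lemma unit_fun_expansion:
  assumes "finite B" "f \<in> coord_space B"
  shows "f = (\<Sum>b\<in>B. cscale (f b) (unit_fun b))"
proof
  fix x
  have "(\<Sum>b\<in>B. cscale (f b) (unit_fun b)) x = (\<Sum>b\<in>B. if x = b then f b else 0)"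
    by (auto simp: sum_fun_apply unit_fun_def intro!: sum.cong)
  then show "f x = (\<Sum>b\<in>B. cscale (f b) (unit_fun b)) x"
    using assms by (auto simp: coord_space_def)
qed

lemma coord_space_in_span:
  assumes "finite B"
  shows "coord_space B \<subseteq> fvs.span (unit_fun ` B)"
proof
  fix f :: "'a \<Rightarrow> complex" assume f: "f \<in> coord_space B"
  show "f \<in> fvs.span (unit_fun ` B)"
    by (subst unit_fun_expansion[OF assms f]) (intro fvs.span_sum fvs.span_scale fvs.span_base imageI)
qed

lemma linear_map_on_sum:
  assumes "linear_map_on V \<phi>" "fvs.subspace V" "\<And>i. i \<in> I \<Longrightarrow> f i \<in> V"
  shows "\<phi> (\<Sum>i\<in>I. f i) = (\<Sum>i\<in>I. \<phi> (f i))"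
proof -
  have "\<phi> (cscale 0 0) = cscale 0 (\<phi> 0)"
    using assms(1) fvs.subspace_0[OF assms(2)] unfolding linear_map_on_def by blast
  then have zero: "\<phi> 0 = 0" by (simp add: cscale_def zero_fun_def)
  show ?thesis
    using assms(3)
  proof (induction I rule: infinite_finite_induct)
    case (insert i I)
    have "(\<Sum>i\<in>I. f i) \<in> V" using insert by (intro fvs.subspace_sum[OF assms(2)]) auto
    then have "\<phi> (f i + (\<Sum>i\<in>I. f i)) = \<phi> (f i) + \<phi> (\<Sum>i\<in>I. f i)"
      using assms(1) insert.prems unfolding linear_map_on_def by blast
    then show ?case using insert by (simp only: sum.insert insert_iff simp_thms)
  qed (simp_all add: zero)
qed

lemma linear_map_on_0: "linear_map_on V \<phi> \<Longrightarrow> fvs.subspace V \<Longrightarrow> \<phi> 0 = 0"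
  using linear_map_on_sum[of V \<phi> "{}"] by simp

lemma linear_map_on_scale: "linear_map_on V \<phi> \<Longrightarrow> v \<in> V \<Longrightarrow> \<phi> (cscale c v) = cscale c (\<phi> v)"
  by (simp add: linear_map_on_def)

lemma linear_map_on_add:
  "linear_map_on V \<phi> \<Longrightarrow> u \<in> V \<Longrightarrow> v \<in> V \<Longrightarrow> \<phi> (u + v) = \<phi> u + \<phi> v"
  by (simp add: linear_map_on_def)

lemma linear_map_on_diff:
  assumes "linear_map_on V \<phi>" "fvs.subspace V" "u \<in> V" "v \<in> V"
  shows "\<phi> (u - v) = \<phi> u - \<phi> v"
proof -
  have "\<phi> (u + cscale (-1) v) = \<phi> u + cscale (-1) (\<phi> v)"
    using assms by (metis linear_map_on_add linear_map_on_scale fvs.subspace_scale)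
  then show ?thesis by (simp add: fun_eq_iff fun_diff_def plus_fun_def cscale_def)
qed

lemma linear_map_on_expansion:
  assumes "finite B" "linear_map_on (coord_space B) \<phi>" "f \<in> coord_space B"
  shows "\<phi> f = (\<Sum>b\<in>B. cscale (f b) (\<phi> (unit_fun b)))"
proof -
  have "\<phi> f = \<phi> (\<Sum>b\<in>B. cscale (f b) (unit_fun b))"
    using unit_fun_expansion[OF assms(1,3)] by simp
  also have "\<dots> = (\<Sum>b\<in>B. \<phi> (cscale (f b) (unit_fun b)))"
    by (rule linear_map_on_sum[OF assms(2) subspace_coord_space])
      (auto intro!: fvs.subspace_scale[OF subspace_coord_space] unit_fun_in_coord_space)
  also have "\<dots> = (\<Sum>b\<in>B. cscale (f b) (\<phi> (unit_fun b)))"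
    by (intro sum.cong refl linear_map_on_scale[OF assms(2)] unit_fun_in_coord_space)
  finally show ?thesis .
qed

definition hermitian_form :: "'b set \<Rightarrow> ('b \<Rightarrow> complex) \<Rightarrow> ('b \<Rightarrow> complex) \<Rightarrow> complex" where
  "hermitian_form B f g = (\<Sum>x\<in>B. cnj (f x) * g x)"

lemma hermitian_form_add_left:
    "hermitian_form B (f + f') g = hermitian_form B f g + hermitian_form B f' g"
  and hermitian_form_add_right:
    "hermitian_form B f (g + g') = hermitian_form B f g + hermitian_form B f g'"
  and hermitian_form_diff_right:
    "hermitian_form B f (g - g') = hermitian_form B f g - hermitian_form B f g'"
  and hermitian_form_scale_left: "hermitian_form B (cscale c f) g = cnj c * hermitian_form B f g"
  and hermitian_form_scale_right: "hermitian_form B f (cscale c g) = c * hermitian_form B f g"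
  by (simp_all add: hermitian_form_def algebra_simps sum.distrib sum_subtractf sum_distrib_left)

lemma hermitian_form_zero [simp]:
  "hermitian_form B 0 g = 0" "hermitian_form B f 0 = 0"
  by (simp_all add: hermitian_form_def)

lemma hermitian_form_definite:
  assumes "finite B" "f \<in> coord_space B" "hermitian_form B f f = 0"
  shows "f = 0"
proof -
  have "hermitian_form B f f = complex_of_real (\<Sum>x\<in>B. (cmod (f x))\<^sup>2)"
    unfolding hermitian_form_def of_real_sum
    by (intro sum.cong refl) (metis complex_norm_square mult.commute)
  then have "(\<Sum>x\<in>B. (cmod (f x))\<^sup>2) = 0"
    using assms(3) by (metis of_real_eq_0_iff)
  then have "\<forall>x\<in>B. f x = 0" using assms(1) by (subst (asm) sum_nonneg_eq_0_iff) auto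
  then show ?thesis using assms(2) by (auto simp: coord_space_def fun_eq_iff)
qed

text \<open>
  The Gram-Schmidt step: a new vector \<open>b\<close> is replaced by its part \<open>b1\<close> orthogonal to the span of \<open>S\<close>,
  and the projection to \<open>S\<close> is corrected by a multiple of \<open>b1\<close>.
\<close>

lemma orthogonal_projection_exists:
  assumes "finite B" "finite S" "S \<subseteq> coord_space B" "w \<in> coord_space B"
  shows "\<exists>u\<in>fvs.span S. \<forall>s\<in>S. hermitian_form B s (w - u) = 0"
  using assms(2,3,4)
proof (induction S arbitrary: w rule: finite_induct)
  case empty
  then show ?case using fvs.span_zero by blast
next
  case (insert b S)
  obtain b0 where b0: "b0 \<in> fvs.span S" "\<forall>s\<in>S. hermitian_form B s (b - b0) = 0"
    using insert.IH[of b] insert.prems by blast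
  obtain u where u: "u \<in> fvs.span S" "\<forall>s\<in>S. hermitian_form B s (w - u) = 0"
    using insert.IH[of w] insert.prems by blast
  have span_coord: "fvs.span S \<subseteq> coord_space B"
    using insert.prems fvs.span_minimal[OF _ subspace_coord_space] by blast
  have orth_span: "hermitian_form B v x = 0"
    if "v \<in> fvs.span S" "\<forall>s\<in>S. hermitian_form B s x = 0" for v x
    by (rule fvs.span_induct_alt[OF that(1), where h = "\<lambda>v. hermitian_form B v x = 0"])
      (simp_all add: that(2) hermitian_form_add_left hermitian_form_scale_left)
  define b1 where "b1 = b - b0"
  have b1: "b1 \<in> coord_space B"
    using insert.prems b0(1) span_coord
    unfolding b1_def by (auto intro!: fvs.subspace_diff[OF subspace_coord_space])
  have mono: "fvs.span S \<subseteq> fvs.span (insert b S)" by (rule fvs.span_mono) auto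
  have b1_span: "b1 \<in> fvs.span (insert b S)"
    unfolding b1_def using b0(1) mono
    by (intro fvs.span_diff fvs.span_base[of b]) (auto intro: subsetD)
  \<comment> \<open>If \<open>b1 = 0\<close>, this is a division by zero and \<open>c = 0\<close>, which is then a correct choice.\<close>
  define c where "c = hermitian_form B b1 (w - u) / hermitian_form B b1 b1"
  define u' where "u' = u + cscale c b1"
  have u'_span: "u' \<in> fvs.span (insert b S)"
    unfolding u'_def using u(1) mono b1_span
    by (intro fvs.span_add fvs.span_scale) (auto intro: subsetD)
  have diff: "w - u' = (w - u) - cscale c b1" by (simp add: u'_def)
  have S: "hermitian_form B s (w - u') = 0" if "s \<in> S" for s
    using that u(2) b0(2)
    by (simp add: diff hermitian_form_diff_right hermitian_form_scale_right b1_def[symmetric])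
  have b1_orth: "hermitian_form B b1 (w - u') = 0"
  proof (cases "hermitian_form B b1 b1 = 0")
    case True
    then show ?thesis using hermitian_form_definite[OF assms(1) b1] by simp
  qed (simp add: diff hermitian_form_diff_right hermitian_form_scale_right c_def)
  have "hermitian_form B b (w - u') = hermitian_form B b1 (w - u') + hermitian_form B b0 (w - u')"
    by (simp add: b1_def hermitian_form_add_left[symmetric])
  then have "hermitian_form B b (w - u') = 0"
    using b1_orth orth_span[OF b0(1)] S by simp
  then show ?case using u'_span S by blast
qed

lemma finite_basis_of_subspace:
  assumes "U \<subseteq> fvs.span F" "finite F"
  obtains S where "finite S" "S \<subseteq> U" "fvs.independent S" "U \<subseteq> fvs.span S" "card S = fvs.dim U"
proof -
  obtain S where S: "S \<subseteq> U" "fvs.independent S" "U \<subseteq> fvs.span S" "card S = fvs.dim U"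
    by (rule fvs.basis_exists)
  then have "finite S" using fvs.independent_span_bound[OF assms(2) S(2)] assms(1) by auto
  with S that show thesis by blast
qed

lemma dim_psubspace_less:
  assumes "fvs.subspace U'" "U' \<subset> U" "U \<subseteq> fvs.span F" "finite F"
  shows "fvs.dim U' < fvs.dim U"
proof -
  obtain S where S: "finite S" "S \<subseteq> U" "fvs.independent S" "U \<subseteq> fvs.span S" "card S = fvs.dim U"
    using finite_basis_of_subspace[OF assms(3,4)] .
  obtain S' where S': "finite S'" "S' \<subseteq> U'" "fvs.independent S'" "U' \<subseteq> fvs.span S'"
      "card S' = fvs.dim U'"
    using finite_basis_of_subspace[of U' F] assms by blast
  obtain x where x: "x \<in> U" "x \<notin> U'" using assms(2) by blast
  have "fvs.span S' \<subseteq> U'" by (rule fvs.span_minimal[OF S'(2) assms(1)])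
  then have "x \<notin> fvs.span S'" using x by blast
  then have ind: "fvs.independent (insert x S')" using S'(3) by (rule fvs.independent_insertI)
  have "insert x S' \<subseteq> fvs.span S" using x S'(2) assms(2) S(4) by auto
  then have "card (insert x S') \<le> card S" using fvs.independent_span_bound[OF S(1) ind] by auto
  moreover have "x \<notin> S'" using x S'(2) by blast
  ultimately show ?thesis using S(5) S'(1,5) by simp
qed

lemma invariant_subspace_irreducible:
  assumes "representation G W" "invariant_subspace G W U" "U \<noteq> {0}"
    and "\<And>X. invariant_subspace G W X \<Longrightarrow> X \<subseteq> U \<Longrightarrow> X = {0} \<or> X = U"
  shows "irreducible_rep G (subrep W U)"
proof -
  have "representation G (subrep W U)"
    using assms(1,2)
    unfolding representation_def invariant_subspace_def subrep_def linear_map_on_def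
    by (auto simp: subset_iff)
  moreover have "invariant_subspace G W X \<and> X \<subseteq> U" if "invariant_subspace G (subrep W U) X" for X
    using that assms(2) unfolding invariant_subspace_def subrep_def by auto
  ultimately show ?thesis
    using assms(3,4) unfolding irreducible_rep_def by (auto simp: subrep_def)
qed

text \<open>
  Splitting off an invariant subspace of least positive dimension leaves its orthogonal complement,
  which is again invariant because the adjoint of every monoid element acts; induction on the
  dimension does the rest.
\<close>

lemma complete_reducibility:
  fixes W :: "('g, 'b) rep"
  assumes rep: "representation G W" and space: "rep_space W = coord_space B" and "finite B"
    and adj: "\<And>g. g \<in> carrier G \<Longrightarrow> \<exists>h\<in>carrier G. \<forall>u\<in>coord_space B. \<forall>w\<in>coord_space B.
       hermitian_form B u (rep_act W g w) = hermitian_form B (rep_act W h u) w"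
  shows "\<exists>\<U>. irreducible_decomposition G W \<U>"
proof -
  have span: "U \<subseteq> fvs.span (unit_fun ` B)" if "invariant_subspace G W U" for U
    using that coord_space_in_span[OF \<open>finite B\<close>] unfolding invariant_subspace_def space by blast
  have fin: "finite (unit_fun ` B :: ('b \<Rightarrow> complex) set)" using \<open>finite B\<close> by simp
  have main: "\<exists>\<U>. finite \<U> \<and>
     (\<forall>X\<in>\<U>. X \<subseteq> U \<and> invariant_subspace G W X \<and> irreducible_rep G (subrep W X)) \<and>
     (\<forall>w\<in>U. \<exists>!f. f \<in> (\<Pi>\<^sub>E X\<in>\<U>. X) \<and> w = (\<Sum>X\<in>\<U>. f X))"
    if "invariant_subspace G W U" for U
    using that
  proof (induction "fvs.dim U" arbitrary: U rule: less_induct)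
    case less
    have sub: "fvs.subspace U" using less.prems by (simp add: invariant_subspace_def)
    show ?case
    proof (cases "U = {0}")
      case True
      then show ?thesis by (intro exI[of _ "{}"]) auto
    next
      case False
      let ?P = "\<lambda>X. invariant_subspace G W X \<and> X \<subseteq> U \<and> X \<noteq> {0}"
      define U1 where "U1 = (ARG_MIN fvs.dim X. invariant_subspace G W X \<and> X \<subseteq> U \<and> X \<noteq> {0})"
      have "?P U" using less.prems False by blast
      from arg_min_natI[of ?P U, OF this, where m = fvs.dim]
        arg_min_nat_le[of ?P, where m = fvs.dim]
      have U1: "?P U1" and least: "\<And>X. ?P X \<Longrightarrow> fvs.dim U1 \<le> fvs.dim X"
        unfolding U1_def by blast+
      have "X = {0} \<or> X = U1" if "invariant_subspace G W X" "X \<subseteq> U1" for X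
      proof (rule ccontr)
        assume "\<not> (X = {0} \<or> X = U1)"
        then have "fvs.dim X < fvs.dim U1"
          using that U1 span fin by (intro dim_psubspace_less[of X U1 "unit_fun ` B"])
            (auto simp: invariant_subspace_def)
        moreover have "?P X"
          using that U1 \<open>\<not> (X = {0} \<or> X = U1)\<close> by blast
        ultimately show False using least by fastforce
      qed
      then have irr: "irreducible_rep G (subrep W U1)"
        using U1 by (intro invariant_subspace_irreducible[OF rep]) auto
      have sub1: "fvs.subspace U1" using U1 by (simp add: invariant_subspace_def)
      define U2 where "U2 = {w \<in> U. \<forall>u\<in>U1. hermitian_form B u w = 0}"
      have sub2: "fvs.subspace U2"
        using sub unfolding U2_def fvs.subspace_def
        by (auto simp: hermitian_form_add_right hermitian_form_scale_right)
      have inv2: "invariant_subspace G W U2"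
      proof -
        have "rep_act W g w \<in> U2" if g: "g \<in> carrier G" and w: "w \<in> U2" for g w
        proof -
          obtain h where h: "h \<in> carrier G" "\<forall>u\<in>coord_space B. \<forall>w\<in>coord_space B.
              hermitian_form B u (rep_act W g w) = hermitian_form B (rep_act W h u) w"
            using adj[OF g] by blast
          have "hermitian_form B u (rep_act W g w) = 0" if "u \<in> U1" for u
          proof -
            have "u \<in> coord_space B" "w \<in> coord_space B" "rep_act W h u \<in> U1"
              using that w U1 h(1) less.prems unfolding invariant_subspace_def U2_def space by auto
            then show ?thesis using h(2) w by (simp add: U2_def)
          qed
          then show ?thesis using w g less.prems unfolding U2_def invariant_subspace_def by auto
        qed
        then show ?thesis using sub2 less.prems unfolding invariant_subspace_def U2_def by auto
      qed
      have disj: "u = 0" if "u \<in> U1" "u \<in> U2" for u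
      proof -
        have "u \<in> coord_space B" using that(1) U1 unfolding invariant_subspace_def space by auto
        moreover have "hermitian_form B u u = 0" using that unfolding U2_def by auto
        ultimately show ?thesis using hermitian_form_definite[OF \<open>finite B\<close>] by blast
      qed
      have split: "\<exists>u1\<in>U1. \<exists>u2\<in>U2. w = u1 + u2" if w: "w \<in> U" for w
      proof -
        have inv1: "invariant_subspace G W U1" using U1 by blast
        obtain S where S: "finite S" "S \<subseteq> U1" "U1 \<subseteq> fvs.span S"
          by (rule finite_basis_of_subspace[OF span[OF inv1] fin])
        have SB: "S \<subseteq> coord_space B" and wB: "w \<in> coord_space B"
          using S(2) U1 w less.prems unfolding invariant_subspace_def space by auto
        obtain u where u: "u \<in> fvs.span S" "\<forall>s\<in>S. hermitian_form B s (w - u) = 0"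
          using orthogonal_projection_exists[OF \<open>finite B\<close> S(1) SB wB] by blast
        have "u \<in> U1" using u(1) fvs.span_minimal[OF S(2) sub1] by blast
        moreover have "hermitian_form B v (w - u) = 0" if "v \<in> U1" for v
        proof -
          have "v \<in> fvs.span S" using that S(3) by blast
          then show ?thesis
            by (rule fvs.span_induct_alt[where h = "\<lambda>v. hermitian_form B v (w - u) = 0"])
              (simp_all add: u(2) hermitian_form_add_left hermitian_form_scale_left)
        qed
        then have "w - u \<in> U2"
          using w \<open>u \<in> U1\<close> U1 sub unfolding U2_def by (auto intro: fvs.subspace_diff)
        ultimately show ?thesis by (metis add.commute diff_add_cancel)
      qed
      have "U2 \<subset> U"
        using disj U1 fvs.subspace_0[OF sub1] unfolding U2_def by blast
      then have "fvs.dim U2 < fvs.dim U"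
        using dim_psubspace_less[OF sub2 _ span[OF less.prems] fin] by blast
      from less.hyps[OF this inv2] obtain \<U> where \<U>: "finite \<U>"
        "\<forall>X\<in>\<U>. X \<subseteq> U2 \<and> invariant_subspace G W X \<and> irreducible_rep G (subrep W X)"
        "\<forall>w\<in>U2. \<exists>!f. f \<in> (\<Pi>\<^sub>E X\<in>\<U>. X) \<and> w = (\<Sum>X\<in>\<U>. f X)" by blast
      have notin: "U1 \<notin> \<U>"
      proof
        assume "U1 \<in> \<U>"
        then have "U1 \<subseteq> U2" using \<U>(2) by blast
        then have "U1 = {0}" using disj fvs.subspace_0[OF sub1] by blast
        then show False using U1 by blast
      qed
      have "\<exists>!f. f \<in> (\<Pi>\<^sub>E X\<in>insert U1 \<U>. X) \<and> w = (\<Sum>X\<in>insert U1 \<U>. f X)" if w: "w \<in> U" for w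
      proof -
        obtain u1 u2 where u: "u1 \<in> U1" "u2 \<in> U2" "w = u1 + u2" using split[OF w] by blast
        from \<U>(3) u(2) obtain f where f: "f \<in> (\<Pi>\<^sub>E X\<in>\<U>. X)" "u2 = (\<Sum>X\<in>\<U>. f X)"
          and uniq: "\<And>f'. f' \<in> (\<Pi>\<^sub>E X\<in>\<U>. X) \<Longrightarrow> u2 = (\<Sum>X\<in>\<U>. f' X) \<Longrightarrow> f' = f" by metis
        show ?thesis
        proof (rule ex1I[of _ "f(U1 := u1)"])
          have "(\<Sum>X\<in>\<U>. (f(U1 := u1)) X) = (\<Sum>X\<in>\<U>. f X)"
            using notin by (intro sum.cong) auto
          then have "w = (\<Sum>X\<in>insert U1 \<U>. (f(U1 := u1)) X)"
            using \<U>(1) notin u(3) f(2) by simp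
          then show "f(U1 := u1) \<in> (\<Pi>\<^sub>E X\<in>insert U1 \<U>. X) \<and> w = (\<Sum>X\<in>insert U1 \<U>. (f(U1 := u1)) X)"
            using f(1) u(1) by (auto simp: PiE_iff extensional_def)
        next
          fix f' assume f': "f' \<in> (\<Pi>\<^sub>E X\<in>insert U1 \<U>. X) \<and> w = (\<Sum>X\<in>insert U1 \<U>. f' X)"
          define s where "s = (\<Sum>X\<in>\<U>. f' X)"
          have s: "s \<in> U2" unfolding s_def
            using f' \<U>(2) by (intro fvs.subspace_sum[OF sub2]) auto
          have w': "w = f' U1 + s" using f' \<U>(1) notin unfolding s_def by simp
          have m: "f' U1 \<in> U1" using f' by auto
          have "f' U1 - u1 = u2 - s" using w' u(3) by (simp add: algebra_simps)
          then have "f' U1 - u1 \<in> U2" using u(2) s fvs.subspace_diff[OF sub2] by simp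
          moreover have "f' U1 - u1 \<in> U1" using m u(1) fvs.subspace_diff[OF sub1] by blast
          ultimately have "f' U1 - u1 = 0" using disj by blast
          then have 1: "f' U1 = u1" by simp
          then have "s = u2" using w' u(3) by simp
          have "(\<Sum>X\<in>\<U>. (f'(U1 := undefined)) X) = s"
            unfolding s_def using notin by (intro sum.cong) auto
          moreover have "f'(U1 := undefined) \<in> (\<Pi>\<^sub>E X\<in>\<U>. X)"
            using f' notin by (auto simp: PiE_iff extensional_def)
          ultimately have "f'(U1 := undefined) = f" using uniq \<open>s = u2\<close> by blast
          then show "f' = f(U1 := u1)" using 1 by (metis fun_upd_triv fun_upd_upd)
        qed
      qed
      moreover have "X \<subseteq> U \<and> invariant_subspace G W X \<and> irreducible_rep G (subrep W X)"
        if "X \<in> insert U1 \<U>" for X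
        using that U1 irr \<U>(2) unfolding U2_def by blast
      ultimately show ?thesis using \<U>(1) by (intro exI[of _ "insert U1 \<U>"]) auto
    qed
  qed
  have "invariant_subspace G W (rep_space W)"
    using rep unfolding invariant_subspace_def representation_def by auto
  from main[OF this] show ?thesis unfolding irreducible_decomposition_def by meson
qed

section \<open>Multiplicities as dimensions of spaces of intertwiners\<close>

definition intertwiners ::
    "'g monoid \<Rightarrow> ('g, 'b) rep \<Rightarrow> ('g, 'c) rep \<Rightarrow> (('b \<Rightarrow> complex) \<Rightarrow> ('c \<Rightarrow> complex)) set" where
  "intertwiners G V W = {\<phi>. linear_map_on (rep_space V) \<phi> \<and>
     (\<forall>v\<in>rep_space V. \<phi> v \<in> rep_space W) \<and>
     (\<forall>g\<in>carrier G. \<forall>v\<in>rep_space V. \<phi> (rep_act V g v) = rep_act W g (\<phi> v))}"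

lemma intertwinersI:
  assumes "linear_map_on (rep_space V) \<phi>" "\<And>v. v \<in> rep_space V \<Longrightarrow> \<phi> v \<in> rep_space W"
    and "\<And>g v. g \<in> carrier G \<Longrightarrow> v \<in> rep_space V \<Longrightarrow> \<phi> (rep_act V g v) = rep_act W g (\<phi> v)"
  shows "\<phi> \<in> intertwiners G V W"
  using assms by (simp add: intertwiners_def)

lemma intertwinersD:
  assumes "\<phi> \<in> intertwiners G V W"
  shows "linear_map_on (rep_space V) \<phi>" "v \<in> rep_space V \<Longrightarrow> \<phi> v \<in> rep_space W"
    and "g \<in> carrier G \<Longrightarrow> v \<in> rep_space V \<Longrightarrow> \<phi> (rep_act V g v) = rep_act W g (\<phi> v)"
  using assms by (simp_all add: intertwiners_def)

lemma representationD:
  assumes "representation G W"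
  shows "fvs.subspace (rep_space W)"
    and "g \<in> carrier G \<Longrightarrow> linear_map_on (rep_space W) (rep_act W g)"
    and "g \<in> carrier G \<Longrightarrow> v \<in> rep_space W \<Longrightarrow> rep_act W g v \<in> rep_space W"
    and "v \<in> rep_space W \<Longrightarrow> rep_act W \<one>\<^bsub>G\<^esub> v = v"
    and "g \<in> carrier G \<Longrightarrow> h \<in> carrier G \<Longrightarrow> v \<in> rep_space W \<Longrightarrow>
      rep_act W (g \<otimes>\<^bsub>G\<^esub> h) v = rep_act W g (rep_act W h v)"
  using assms by (simp_all add: representation_def)

lemma intertwiner_kernel_invariant:
  assumes V: "representation G V" and W: "representation G W" and \<phi>: "\<phi> \<in> intertwiners G V W"
  shows "invariant_subspace G V {v \<in> rep_space V. \<phi> v = 0}"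
proof -
  note VD = representationD[OF V] and WD = representationD[OF W] and D = intertwinersD[OF \<phi>]
  have "fvs.subspace {v \<in> rep_space V. \<phi> v = 0}"
    unfolding fvs.subspace_def
  proof (intro conjI ballI allI)
    show "0 \<in> {v \<in> rep_space V. \<phi> v = 0}"
      using linear_map_on_0[OF D(1) VD(1)] fvs.subspace_0[OF VD(1)] by blast
  next
    fix x y assume "x \<in> {v \<in> rep_space V. \<phi> v = 0}" "y \<in> {v \<in> rep_space V. \<phi> v = 0}"
    then show "x + y \<in> {v \<in> rep_space V. \<phi> v = 0}"
      using linear_map_on_add[OF D(1), of x y] fvs.subspace_add[OF VD(1), of x y] by simp
  next
    fix c x assume "x \<in> {v \<in> rep_space V. \<phi> v = 0}"
    then show "cscale c x \<in> {v \<in> rep_space V. \<phi> v = 0}"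
      using linear_map_on_scale[OF D(1), of x c] fvs.subspace_scale[OF VD(1), of x c] by simp
  qed
  moreover have "\<phi> (rep_act V g v) = 0" if "g \<in> carrier G" "v \<in> rep_space V" "\<phi> v = 0" for g v
    using D(3)[OF that(1,2)] linear_map_on_0[OF WD(2)[OF that(1)] WD(1)] that(3) by simp
  ultimately show ?thesis
    using VD(3) unfolding invariant_subspace_def by blast
qed

lemma intertwiner_image_invariant:
  assumes V: "representation G V" and W: "representation G W" and \<phi>: "\<phi> \<in> intertwiners G V W"
  shows "invariant_subspace G W (\<phi> ` rep_space V)"
proof -
  note VD = representationD[OF V] and D = intertwinersD[OF \<phi>]
  have "fvs.subspace (\<phi> ` rep_space V)"
    unfolding fvs.subspace_def
  proof (intro conjI ballI allI)
    show "0 \<in> \<phi> ` rep_space V"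
      using linear_map_on_0[OF D(1) VD(1)] fvs.subspace_0[OF VD(1)] by (metis imageI)
  next
    fix x y assume "x \<in> \<phi> ` rep_space V" "y \<in> \<phi> ` rep_space V"
    then obtain u v where "u \<in> rep_space V" "v \<in> rep_space V" "x = \<phi> u" "y = \<phi> v" by blast
    then show "x + y \<in> \<phi> ` rep_space V"
      using linear_map_on_add[OF D(1), of u v] fvs.subspace_add[OF VD(1), of u v]
      by (metis imageI)
  next
    fix c x assume "x \<in> \<phi> ` rep_space V"
    then obtain u where "u \<in> rep_space V" "x = \<phi> u" by blast
    then show "cscale c x \<in> \<phi> ` rep_space V"
      using linear_map_on_scale[OF D(1), of u c] fvs.subspace_scale[OF VD(1), of u c]
      by (metis imageI)
  qed
  moreover have "rep_act W g w \<in> \<phi> ` rep_space V" if g: "g \<in> carrier G" and w: "w \<in> \<phi> ` rep_space V" for g w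
  proof -
    obtain u where "u \<in> rep_space V" "w = \<phi> u" using w by blast
    then show ?thesis using D(3)[OF g, of u] VD(3)[OF g, of u] by (metis imageI)
  qed
  ultimately show ?thesis
    using D(2) unfolding invariant_subspace_def by blast
qed

text \<open>
  Kernel and image are invariant; a nonzero value rules out that the kernel is everything or the
  image is zero.
\<close>

lemma schur:
  assumes V: "irreducible_rep G V" and W: "irreducible_rep G W" and \<phi>: "\<phi> \<in> intertwiners G V W"
    and nonzero: "v \<in> rep_space V" "\<phi> v \<noteq> 0"
  shows "bij_betw \<phi> (rep_space V) (rep_space W)"
proof -
  have rep: "representation G V" "representation G W"
    using V W by (simp_all add: irreducible_rep_def)
  note VD = representationD[OF rep(1)] and D = intertwinersD[OF \<phi>]
  have ker: "{v \<in> rep_space V. \<phi> v = 0} = {0}"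
    using V intertwiner_kernel_invariant[OF rep \<phi>] nonzero unfolding irreducible_rep_def by blast
  have "inj_on \<phi> (rep_space V)"
  proof (rule inj_onI)
    fix x y assume xy: "x \<in> rep_space V" "y \<in> rep_space V" "\<phi> x = \<phi> y"
    then have "\<phi> (x - y) = 0" using linear_map_on_diff[OF D(1) VD(1) xy(1,2)] by simp
    moreover have "x - y \<in> rep_space V" by (rule fvs.subspace_diff[OF VD(1) xy(1,2)])
    ultimately have "x - y = 0" using ker by blast
    then show "x = y" by simp
  qed
  moreover have "\<phi> ` rep_space V = rep_space W"
    using W intertwiner_image_invariant[OF rep \<phi>] nonzero unfolding irreducible_rep_def by blast
  ultimately show ?thesis by (simp add: bij_betw_def)
qed

lemma inverse_intertwiner:
  assumes V: "representation G V" and W: "representation G W" and \<phi>: "\<phi> \<in> intertwiners G V W"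
    and bij: "bij_betw \<phi> (rep_space V) (rep_space W)"
  shows "inv_into (rep_space V) \<phi> \<in> intertwiners G W V"
proof -
  note VD = representationD[OF V] and D = intertwinersD[OF \<phi>]
  define \<psi> where "\<psi> = inv_into (rep_space V) \<phi>"
  have \<psi>: "\<psi> w \<in> rep_space V" "\<phi> (\<psi> w) = w" if "w \<in> rep_space W" for w
    using that bij unfolding \<psi>_def bij_betw_def
    by (auto intro: inv_into_into simp: f_inv_into_f[of w \<phi> "rep_space V"])
  have \<psi>\<phi>: "\<psi> (\<phi> v) = v" if "v \<in> rep_space V" for v
    using that bij unfolding \<psi>_def bij_betw_def by (auto intro: inv_into_f_f)
  have "\<psi> (u + w) = \<psi> u + \<psi> w" if "u \<in> rep_space W" "w \<in> rep_space W" for u w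
    using \<psi>\<phi>[OF fvs.subspace_add[OF VD(1) \<psi>(1)[OF that(1)] \<psi>(1)[OF that(2)]]]
      linear_map_on_add[OF D(1) \<psi>(1)[OF that(1)] \<psi>(1)[OF that(2)]] \<psi>(2) that by simp
  moreover have "\<psi> (cscale c w) = cscale c (\<psi> w)" if "w \<in> rep_space W" for c w
    using \<psi>\<phi>[OF fvs.subspace_scale[OF VD(1) \<psi>(1)[OF that]], of c]
      linear_map_on_scale[OF D(1) \<psi>(1)[OF that], of c] \<psi>(2) that by simp
  moreover have "\<psi> (rep_act W g w) = rep_act V g (\<psi> w)" if "g \<in> carrier G" "w \<in> rep_space W" for g w
    using \<psi>\<phi>[OF VD(3)[OF that(1) \<psi>(1)[OF that(2)]]] D(3)[OF that(1) \<psi>(1)[OF that(2)]]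
      \<psi>(2)[OF that(2)] by simp
  ultimately show ?thesis
    unfolding \<psi>_def[symmetric] using \<psi>(1) by (intro intertwinersI) (auto simp: linear_map_on_def)
qed

lemma compose_intertwiners:
  assumes "\<phi> \<in> intertwiners G U V" "\<psi> \<in> intertwiners G V W"
  shows "(\<lambda>u. \<psi> (\<phi> u)) \<in> intertwiners G U W"
  using assms unfolding intertwiners_def linear_map_on_def by simp

text \<open>
  Bases appear below as families indexed by orbits and tableaux, or by summands, rather than as sets;
  independence of the family includes that its members are distinct.
\<close>

lemma dim_eq_card_family:
  assumes "finite X"
    and indep: "\<And>c. (\<Sum>x\<in>X. cscale (c x) (w x)) = 0 \<Longrightarrow> \<forall>x\<in>X. c x = 0"
    and "w ` X \<subseteq> M" "M \<subseteq> fvs.span (w ` X)"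
  shows "fvs.dim M = card X"
proof -
  have inj: "inj_on w X"
  proof (rule inj_onI, rule ccontr)
    fix x y assume xy: "x \<in> X" "y \<in> X" "w x = w y" "x \<noteq> y"
    define c :: "'a \<Rightarrow> complex" where "c = (\<lambda>z. if z = x then 1 else if z = y then -1 else 0)"
    have "(\<Sum>z\<in>X. cscale (c z) (w z)) = (\<Sum>z\<in>{x, y}. cscale (c z) (w z))"
      using xy \<open>finite X\<close> by (intro sum.mono_neutral_right) (auto simp: c_def)
    also have "\<dots> = 0" using xy(3,4) by (simp add: c_def)
    finally show False using indep[of c] xy(1) by (auto simp: c_def)
  qed
  have "fvs.independent (w ` X)"
  proof
    assume "fvs.dependent (w ` X)"
    then obtain u where u: "\<exists>v\<in>w ` X. u v \<noteq> 0" "(\<Sum>v\<in>w ` X. cscale (u v) v) = 0"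
      using fvs.dependent_finite[of "w ` X"] \<open>finite X\<close> by auto
    have "(\<Sum>x\<in>X. cscale (u (w x)) (w x)) = 0"
      using u(2) by (simp only: sum.reindex[OF inj] comp_def)
    then show False using indep[of "\<lambda>x. u (w x)"] u(1) by blast
  qed
  then have "card (w ` X) = fvs.dim M" by (rule fvs.basis_card_eq_dim[OF assms(3,4)])
  then show ?thesis using card_image[OF inj] by simp
qed

definition component ::
    "('b \<Rightarrow> complex) set set \<Rightarrow> ('b \<Rightarrow> complex) set \<Rightarrow> ('b \<Rightarrow> complex) \<Rightarrow> 'b \<Rightarrow> complex" where
  "component \<U> U w = (THE f. f \<in> (\<Pi>\<^sub>E X\<in>\<U>. X) \<and> w = (\<Sum>X\<in>\<U>. f X)) U"

lemma component:
  assumes dec: "irreducible_decomposition G W \<U>" and w: "w \<in> rep_space W"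
  shows "U \<in> \<U> \<Longrightarrow> component \<U> U w \<in> U" "w = (\<Sum>U\<in>\<U>. component \<U> U w)"
    and "\<lbrakk>\<And>X. X \<in> \<U> \<Longrightarrow> f X \<in> X; w = (\<Sum>X\<in>\<U>. f X); U \<in> \<U>\<rbrakk> \<Longrightarrow> component \<U> U w = f U"
proof -
  let ?P = "\<lambda>f. f \<in> (\<Pi>\<^sub>E X\<in>\<U>. X) \<and> w = (\<Sum>X\<in>\<U>. f X)"
  have ex1: "\<exists>!f. ?P f" using dec w unfolding irreducible_decomposition_def by blast
  have the: "?P (\<lambda>U. component \<U> U w)"
    using theI'[OF ex1] unfolding component_def .
  show "U \<in> \<U> \<Longrightarrow> component \<U> U w \<in> U" using the by (auto dest: PiE_mem)
  show "w = (\<Sum>U\<in>\<U>. component \<U> U w)" using the by blast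
  assume f: "\<And>X. X \<in> \<U> \<Longrightarrow> f X \<in> X" "w = (\<Sum>X\<in>\<U>. f X)" and "U \<in> \<U>"
  have "(\<Sum>X\<in>\<U>. restrict f \<U> X) = (\<Sum>X\<in>\<U>. f X)" by (intro sum.cong) auto
  then have "?P (restrict f \<U>)" using f by auto
  then have "restrict f \<U> = (\<lambda>U. component \<U> U w)" using ex1 the by blast
  then have "component \<U> U w = restrict f \<U> U" by (rule fun_cong[OF sym])
  then show "component \<U> U w = f U" using \<open>U \<in> \<U>\<close> by simp
qed

lemma component_intertwiner:
  assumes W: "representation G W" and dec: "irreducible_decomposition G W \<U>" and U: "U \<in> \<U>"
  shows "component \<U> U \<in> intertwiners G W (subrep W U)"
proof -
  note WD = representationD[OF W] and comp = component[OF dec]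
  have mem: "invariant_subspace G W X" if "X \<in> \<U>" for X
    using dec that by (simp add: irreducible_decomposition_def)
  have "component \<U> U (u + w) = component \<U> U u + component \<U> U w"
    if u: "u \<in> rep_space W" and w: "w \<in> rep_space W" for u w
  proof (rule comp(3)[OF fvs.subspace_add[OF WD(1) u w] _ _ U])
    show "component \<U> X u + component \<U> X w \<in> X" if "X \<in> \<U>" for X
      using comp(1)[OF u that] comp(1)[OF w that] mem[OF that]
      by (auto simp: invariant_subspace_def intro: fvs.subspace_add)
    show "u + w = (\<Sum>X\<in>\<U>. component \<U> X u + component \<U> X w)"
      by (simp only: sum.distrib comp(2)[OF u, symmetric] comp(2)[OF w, symmetric])
  qed
  moreover have "component \<U> U (cscale c w) = cscale c (component \<U> U w)"
    if w: "w \<in> rep_space W" for c w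
  proof (rule comp(3)[OF fvs.subspace_scale[OF WD(1) w] _ _ U])
    show "cscale c (component \<U> X w) \<in> X" if "X \<in> \<U>" for X
      using comp(1)[OF w that] mem[OF that]
      by (auto simp: invariant_subspace_def intro: fvs.subspace_scale)
    show "cscale c w = (\<Sum>X\<in>\<U>. cscale c (component \<U> X w))"
      by (simp only: fvs.scale_sum_right[symmetric] comp(2)[OF w, symmetric])
  qed
  moreover have "component \<U> U (rep_act W g w) = rep_act W g (component \<U> U w)"
    if g: "g \<in> carrier G" and w: "w \<in> rep_space W" for g w
  proof (rule comp(3)[OF WD(3)[OF g w] _ _ U])
    show "rep_act W g (component \<U> X w) \<in> X" if "X \<in> \<U>" for X
      using comp(1)[OF w that] mem[OF that] g by (auto simp: invariant_subspace_def)
    have "rep_act W g (\<Sum>X\<in>\<U>. component \<U> X w) = (\<Sum>X\<in>\<U>. rep_act W g (component \<U> X w))"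
      using comp(1)[OF w] mem
      by (intro linear_map_on_sum[OF WD(2)[OF g] WD(1)]) (auto simp: invariant_subspace_def)
    then show "rep_act W g w = (\<Sum>X\<in>\<U>. rep_act W g (component \<U> X w))"
      by (simp only: comp(2)[OF w, symmetric])
  qed
  ultimately show ?thesis
    using comp(1)[OF _ U] by (intro intertwinersI) (auto simp: subrep_def linear_map_on_def)
qed

text \<open>
  Choose an isomorphism \<open>V \<rightarrow> U\<close> for every summand \<open>U\<close> isomorphic to \<open>V\<close>. The images of \<open>v0\<close> under these are
  independent, as they lie in different summands. They span: for an intertwiner from \<open>V\<close> to the whole
  space, the component in a summand vanishes on \<open>v0\<close> or is itself an isomorphism, which then differs
  from the chosen one by an endomorphism of \<open>V\<close>, hence by a scalar on \<open>v0\<close>.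
\<close>

theorem multiplicity_eq_dim:
  assumes W: "representation G W" and V: "irreducible_rep G V"
    and v0: "v0 \<in> rep_space V" "v0 \<noteq> 0"
    and endo: "\<And>\<phi>. \<phi> \<in> intertwiners G V V \<Longrightarrow> \<exists>c. \<phi> v0 = cscale c v0"
    and dec: "irreducible_decomposition G W \<U>"
  shows "card {U \<in> \<U>. rep_isomorphic G (subrep W U) V} =
    fvs.dim ((\<lambda>\<phi>. \<phi> v0) ` intertwiners G V W)"
proof -
  define J where "J = {U \<in> \<U>. rep_isomorphic G (subrep W U) V}"
  have repV: "representation G V" using V by (simp add: irreducible_rep_def)
  note WD = representationD[OF W] and comp = component[OF dec]
  have fin: "finite \<U>" using dec by (simp add: irreducible_decomposition_def)
  have mem: "invariant_subspace G W U" "irreducible_rep G (subrep W U)" if "U \<in> \<U>" for U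
    using dec that by (simp_all add: irreducible_decomposition_def)
  have space: "rep_space (subrep W U) = U" for U by (simp add: subrep_def)
  have into_W: "\<phi> \<in> intertwiners G V W" if "\<phi> \<in> intertwiners G V (subrep W U)" "U \<in> \<U>" for \<phi> U
    using that(1) mem(1)[OF that(2)] unfolding intertwiners_def invariant_subspace_def
    by (auto simp: subrep_def)
  have "\<exists>\<phi>. \<phi> \<in> intertwiners G V (subrep W U) \<and> bij_betw \<phi> (rep_space V) U" if U: "U \<in> J" for U
  proof -
    obtain \<psi> where \<psi>: "linear_map_on U \<psi>" "bij_betw \<psi> U (rep_space V)"
      "\<forall>g\<in>carrier G. \<forall>v\<in>U. \<psi> (rep_act W g v) = rep_act V g (\<psi> v)"
      using U unfolding J_def rep_isomorphic_def by (auto simp: subrep_def)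
    have "\<psi> \<in> intertwiners G (subrep W U) V"
      using \<psi> by (intro intertwinersI) (auto simp: subrep_def bij_betw_def)
    moreover have "representation G (subrep W U)"
      using U mem(2) by (auto simp: J_def irreducible_rep_def)
    ultimately have "inv_into U \<psi> \<in> intertwiners G V (subrep W U)"
      using inverse_intertwiner[of G "subrep W U" V \<psi>] repV \<psi>(2) by (simp add: space)
    then show ?thesis using bij_betw_inv_into[OF \<psi>(2)] by blast
  qed
  then obtain \<phi> where \<phi>: "\<And>U. U \<in> J \<Longrightarrow> \<phi> U \<in> intertwiners G V (subrep W U)"
    "\<And>U. U \<in> J \<Longrightarrow> bij_betw (\<phi> U) (rep_space V) U" by metis
  have \<phi>v0: "\<phi> U v0 \<in> U" "\<phi> U v0 \<noteq> 0" if "U \<in> J" for U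
  proof -
    show "\<phi> U v0 \<in> U" using \<phi>(2)[OF that] v0(1) by (auto simp: bij_betw_def)
    have "\<phi> U 0 = 0"
      by (rule linear_map_on_0[OF intertwinersD(1)[OF \<phi>(1)[OF that]] representationD(1)[OF repV]])
    then show "\<phi> U v0 \<noteq> 0"
      using \<phi>(2)[OF that] v0 fvs.subspace_0[OF representationD(1)[OF repV]]
      unfolding bij_betw_def inj_on_def by metis
  qed
  have JU: "J \<subseteq> \<U>" by (auto simp: J_def)
  have "fvs.dim ((\<lambda>\<phi>. \<phi> v0) ` intertwiners G V W) = card J"
  proof (rule dim_eq_card_family[where w = "\<lambda>U. \<phi> U v0"])
    show "finite J" using fin JU finite_subset by blast
  next
    fix c assume c: "(\<Sum>U\<in>J. cscale (c U) (\<phi> U v0)) = 0"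
    define f where "f = (\<lambda>U. if U \<in> J then cscale (c U) (\<phi> U v0) else 0)"
    have sub: "fvs.subspace U" if "U \<in> \<U>" for U using mem(1)[OF that] by (simp add: invariant_subspace_def)
    have fU: "f X \<in> X" if "X \<in> \<U>" for X
      using that \<phi>v0(1) fvs.subspace_scale[OF sub[OF that]] fvs.subspace_0[OF sub[OF that]]
      by (auto simp: f_def)
    have "(\<Sum>X\<in>\<U>. f X) = (\<Sum>U\<in>J. cscale (c U) (\<phi> U v0))"
      unfolding f_def using fin JU by (simp add: sum.If_cases Int_absorb1)
    then have sum0: "0 = (\<Sum>X\<in>\<U>. f X)" using c by simp
    show "\<forall>U\<in>J. c U = 0"
    proof
      fix U assume U: "U \<in> J"
      then have "component \<U> U 0 = f U"
        using comp(3)[OF fvs.subspace_0[OF WD(1)] fU sum0] JU by blast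
      moreover have "component \<U> U 0 = 0"
        using comp(3)[OF fvs.subspace_0[OF WD(1)], of "\<lambda>_. 0" U] JU U fvs.subspace_0[OF sub]
        by (auto simp: subset_iff)
      ultimately have "cscale (c U) (\<phi> U v0) = 0" using U by (simp add: f_def)
      then show "c U = 0" using \<phi>v0(2)[OF U] by (simp add: fvs.scale_eq_0_iff)
    qed
  next
    show "(\<lambda>U. \<phi> U v0) ` J \<subseteq> (\<lambda>\<phi>. \<phi> v0) ` intertwiners G V W"
      using \<phi>(1) into_W JU by blast
  next
    show "(\<lambda>\<phi>. \<phi> v0) ` intertwiners G V W \<subseteq> fvs.span ((\<lambda>U. \<phi> U v0) ` J)"
    proof (rule image_subsetI)
      fix \<psi> assume \<psi>: "\<psi> \<in> intertwiners G V W"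
      have w: "\<psi> v0 \<in> rep_space W" using intertwinersD(2)[OF \<psi> v0(1)] .
      have "component \<U> U (\<psi> v0) \<in> fvs.span ((\<lambda>U. \<phi> U v0) ` J)" if U: "U \<in> \<U>" for U
      proof (cases "component \<U> U (\<psi> v0) = 0")
        case True
        then show ?thesis by (simp only: fvs.span_zero)
      next
        case False
        \<comment> \<open>The component is an isomorphism \<open>V \<rightarrow> U\<close>; comparing it with the chosen one gives an endomorphism of \<open>V\<close>.\<close>
        define \<theta> where "\<theta> = (\<lambda>v. component \<U> U (\<psi> v))"
        have \<theta>: "\<theta> \<in> intertwiners G V (subrep W U)"
          unfolding \<theta>_def using compose_intertwiners[OF \<psi> component_intertwiner[OF W dec U]] .
        have irrU: "irreducible_rep G (subrep W U)" by (rule mem(2)[OF U])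
        have repU: "representation G (subrep W U)" using irrU by (simp add: irreducible_rep_def)
        have bij: "bij_betw \<theta> (rep_space V) (rep_space (subrep W U))"
          using schur[OF V irrU \<theta> v0(1)] False by (simp add: \<theta>_def)
        note inv = inverse_intertwiner[OF repV repU \<theta> bij]
        have "rep_isomorphic G (subrep W U) V"
          unfolding rep_isomorphic_def
          using intertwinersD[OF inv] bij_betw_inv_into[OF bij] by blast
        then have UJ: "U \<in> J" using U by (simp add: J_def)
        have bij': "bij_betw (\<phi> U) (rep_space V) (rep_space (subrep W U))"
          using \<phi>(2)[OF UJ] by (simp add: space)
        note inv' = inverse_intertwiner[OF repV repU \<phi>(1)[OF UJ] bij']
        obtain c where c: "inv_into (rep_space V) (\<phi> U) (\<theta> v0) = cscale c v0"
          using endo[OF compose_intertwiners[OF \<theta> inv']] by blast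
        have "\<theta> v0 \<in> \<phi> U ` rep_space V"
          using intertwinersD(2)[OF \<theta> v0(1)] bij' by (simp add: bij_betw_def)
        then have "\<theta> v0 = \<phi> U (cscale c v0)" using f_inv_into_f[of "\<theta> v0" "\<phi> U"] c by metis
        also have "\<dots> = cscale c (\<phi> U v0)"
          by (rule linear_map_on_scale[OF intertwinersD(1)[OF \<phi>(1)[OF UJ]] v0(1)])
        finally have "component \<U> U (\<psi> v0) = cscale c (\<phi> U v0)" by (simp only: \<theta>_def)
        then show ?thesis using UJ by (simp only:) (intro fvs.span_scale fvs.span_base imageI)
      qed
      then have "(\<Sum>U\<in>\<U>. component \<U> U (\<psi> v0)) \<in> fvs.span ((\<lambda>U. \<phi> U v0) ` J)"
        by (rule fvs.span_sum)
      then show "\<psi> v0 \<in> fvs.span ((\<lambda>U. \<phi> U v0) ` J)" by (simp only: comp(2)[OF w, symmetric])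
    qed
  qed
  then show ?thesis by (simp only: J_def)
qed

section \<open>The Coxeter presentation of the symmetric group\<close>

definition adj_transp :: "nat \<Rightarrow> nat \<Rightarrow> nat" where
  "adj_transp i = transpose i (Suc i)"

lemma adj_transp_permutes: "Suc i < n \<Longrightarrow> adj_transp i permutes {..<n}"
  unfolding adj_transp_def by (intro permutes_swap_id) auto

lemma adj_transp_invol [simp]: "adj_transp i (adj_transp i x) = x"
  by (simp add: adj_transp_def)

text \<open>
  The relations on the generators \<open>s\<^sub>0, \<dots>, s\<^bsub>n-2\<^esub>\<close> of the symmetric group of \<open>{..<n}\<close>,
  for operators on an arbitrary type.
\<close>

locale coxeter_operators =
  fixes n :: nat and T :: "nat \<Rightarrow> 'a \<Rightarrow> 'a"
  assumes invol: "Suc i < n \<Longrightarrow> T i (T i x) = x"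
    and braid: "Suc (Suc i) < n \<Longrightarrow> T i (T (Suc i) (T i x)) = T (Suc i) (T i (T (Suc i) x))"
    and comm: "Suc j < n \<Longrightarrow> Suc i < j \<Longrightarrow> T i (T j x) = T j (T i x)"
begin

text \<open>The operator \<open>descend m j\<close> is \<open>s\<^sub>j s\<^bsub>j+1\<^esub> \<dots> s\<^bsub>m-1\<^esub>\<close>, the cycle that carries \<open>m\<close> to \<open>j\<close>.\<close>

definition descend :: "nat \<Rightarrow> nat \<Rightarrow> 'a \<Rightarrow> 'a" where
  "descend m j x = foldr T [j..<m] x"

lemma descend_self [simp]: "descend m m x = x"
  by (simp add: descend_def)

lemma descend_Suc: "j < m \<Longrightarrow> T j (descend m (Suc j) x) = descend m j x"
  by (simp add: descend_def upt_conv_Cons)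

lemma descend_cancel: "j < m \<Longrightarrow> m < n \<Longrightarrow> T j (descend m j x) = descend m (Suc j) x"
  by (simp add: descend_Suc[symmetric] invol)

lemma descend_below: 
  assumes "Suc i < j" "j \<le> m" "m < n"
  shows "T i (descend m j x) = descend m j (T i x)"
  using assms(2,1)
proof (induction j rule: inc_induct)
  case (step j)
  have "T i (descend m j x) = T i (T j (descend m (Suc j) x))" using step by (simp add: descend_Suc)
  also have "\<dots> = T j (T i (descend m (Suc j) x))" using step assms by (intro comm) auto
  also have "\<dots> = T j (descend m (Suc j) (T i x))" using step by simp
  finally show ?case using step by (simp add: descend_Suc)
qed simp

lemma descend_above:
  assumes "j \<le> i" "Suc i < m" "m < n"
  shows "T (Suc i) (descend m j x) = descend m j (T i x)"
  using assms(1)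
proof (induction j rule: inc_induct)
  case base
  have "T (Suc i) (descend m i x) = T (Suc i) (T i (T (Suc i) (descend m (Suc (Suc i)) x)))"
    using assms by (simp add: descend_Suc)
  also have "\<dots> = T i (T (Suc i) (T i (descend m (Suc (Suc i)) x)))"
    using assms by (subst braid) auto
  also have "\<dots> = T i (T (Suc i) (descend m (Suc (Suc i)) (T i x)))"
    using assms by (subst descend_below) auto
  finally show ?case using assms by (simp add: descend_Suc)
next
  case (step j)
  have "T (Suc i) (descend m j x) = T (Suc i) (T j (descend m (Suc j) x))"
    using step assms by (simp add: descend_Suc)
  also have "\<dots> = T j (T (Suc i) (descend m (Suc j) x))"
    using step assms by (intro comm[symmetric]) auto
  also have "\<dots> = T j (descend m (Suc j) (T i x))" using step by simp
  finally show ?case using step assms by (simp add: descend_Suc)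
qed

end

text \<open>
  Left multiplication on permutations satisfies the relations, so what follows from the relations
  for \<open>descend\<close> holds both for given operators and for the permutations that they should represent.
\<close>

interpretation perm: coxeter_operators n "\<lambda>i (\<sigma> :: nat \<Rightarrow> nat). adj_transp i \<circ> \<sigma>"
  by unfold_locales (auto simp: adj_transp_def fun_eq_iff transpose_def)

lemma perm_descend_comp: "perm.descend m j (\<sigma> \<circ> \<tau>) = perm.descend m j \<sigma> \<circ> \<tau>"
proof -
  have "foldr (\<lambda>i \<sigma>. adj_transp i \<circ> \<sigma>) is (\<sigma> \<circ> \<tau>) = foldr (\<lambda>i \<sigma>. adj_transp i \<circ> \<sigma>) is \<sigma> \<circ> \<tau>" for "is"
    by (induction "is") (auto simp: comp_assoc)
  then show ?thesis by (simp add: perm.descend_def)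
qed

lemma perm_descend_eq: "perm.descend m j \<sigma> = perm.descend m j id \<circ> \<sigma>"
  using perm_descend_comp[of m j id \<sigma>] by simp

lemma perm_descend_permutes: 
  assumes "j \<le> m"
  shows "perm.descend m j id permutes {..<Suc m}"
  using assms
proof (induction j rule: inc_induct)
  case base
  show ?case unfolding perm.descend_self by (rule permutes_id)
next
  case (step j)
  have "perm.descend m (Suc j) id permutes {..<Suc m}" by (rule step)
  then have "adj_transp j \<circ> perm.descend m (Suc j) id permutes {..<Suc m}"
    using step(2) by (intro permutes_compose adj_transp_permutes) auto
  then show ?case unfolding perm.descend_Suc[OF step(2), symmetric] .
qed

lemma perm_descend_top: "j \<le> m \<Longrightarrow> perm.descend m j id m = j"
proof (induction j rule: inc_induct)
  case base
  show ?case unfolding perm.descend_self by simp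
next
  case (step j)
  have "perm.descend m (Suc j) id m = Suc j" by (rule step)
  then have "(adj_transp j \<circ> perm.descend m (Suc j) id) m = j"
    by (simp only: comp_apply) (simp add: adj_transp_def)
  then show ?case unfolding perm.descend_Suc[OF step(2), symmetric] .
qed

text \<open>
  The stabiliser of \<open>m\<close> among the permutations of \<open>{..<Suc m}\<close> consists of the permutations of
  \<open>{..<m}\<close>, and its cosets are distinguished by the image of \<open>m\<close>, with the cycles \<open>descend m j\<close> as
  representatives.
\<close>

lemma coset_decomposition:
  assumes "\<sigma> permutes {..<Suc m}"
  obtains \<sigma>' where "\<sigma>' permutes {..<m}" "\<sigma> = perm.descend m (\<sigma> m) \<sigma>'"
proof -
  have le: "\<sigma> m \<le> m" using permutes_in_image[OF assms, of m] by simp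
  let ?c = "perm.descend m (\<sigma> m) id"
  note c = perm_descend_permutes[OF le]
  have 1: "inv_into UNIV ?c \<circ> \<sigma> permutes {..<Suc m}"
    by (intro permutes_compose assms permutes_inv c)
  have "(inv_into UNIV ?c \<circ> \<sigma>) m = m"
    using perm_descend_top[OF le] permutes_inverses(2)[OF c, of m] by simp
  then have "inv_into UNIV ?c \<circ> \<sigma> permutes {..<m}"
    using permutes_superset[OF 1, of "{..<m}"] by (auto simp: less_Suc_eq)
  moreover have "\<sigma> = perm.descend m (\<sigma> m) (inv_into UNIV ?c \<circ> \<sigma>)"
    using permutes_inverses(1)[OF c] by (subst perm_descend_eq) (simp add: fun_eq_iff)
  ultimately show thesis using that by blast
qed

lemma coset_unique:
  assumes "\<sigma>' permutes {..<m}" "j \<le> m" "\<sigma> = perm.descend m j \<sigma>'"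
  shows "\<sigma> m = j" "inv_into UNIV (perm.descend m j id) \<circ> \<sigma> = \<sigma>'"
proof -
  have "\<sigma>' m = m" using assms(1) by (simp add: permutes_def)
  then show "\<sigma> m = j"
    using perm_descend_top[OF assms(2)] by (simp add: assms(3) perm_descend_eq[of m j \<sigma>'])
  show "inv_into UNIV (perm.descend m j id) \<circ> \<sigma> = \<sigma>'"
    using permutes_inverses(2)[OF perm_descend_permutes[OF assms(2)]]
    by (simp add: assms(3) perm_descend_eq[of m j \<sigma>'] fun_eq_iff)
qed

lemma permutes_adjacent_induct [consumes 1, case_names id adj]:
  assumes "\<sigma> permutes {..<n}"
    and "P id" and adj: "\<And>i \<sigma>. Suc i < n \<Longrightarrow> \<sigma> permutes {..<n} \<Longrightarrow> P \<sigma> \<Longrightarrow> P (adj_transp i \<circ> \<sigma>)"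
  shows "P \<sigma>"
proof -
  have "P \<sigma>" if "m \<le> n" "\<sigma> permutes {..<m}" for m \<sigma>
    using that
  proof (induction m arbitrary: \<sigma>)
    case 0
    then have "\<sigma> = id" by simp
    then show ?case using \<open>P id\<close> by blast
  next
    case (Suc m)
    obtain \<sigma>' where \<sigma>': "\<sigma>' permutes {..<m}" "\<sigma> = perm.descend m (\<sigma> m) \<sigma>'"
      using coset_decomposition[OF Suc.prems(2)] by metis
    have "P (perm.descend m j \<sigma>')" if "j \<le> m" for j
      using that
    proof (induction j rule: inc_induct)
      case base
      then show ?case using Suc.IH[OF _ \<sigma>'(1)] Suc.prems(1) unfolding perm.descend_self by simp
    next
      case (step j)
      have "perm.descend m (Suc j) \<sigma>' permutes {..<n}"
        unfolding perm_descend_eq[of m "Suc j" \<sigma>']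
        using step(2) Suc.prems(1) \<sigma>'(1)
        by (intro permutes_compose permutes_subset[OF perm_descend_permutes]
            permutes_subset[OF \<sigma>'(1)]) auto
      moreover have "P (perm.descend m (Suc j) \<sigma>')" by (rule step)
      ultimately have "P (adj_transp j \<circ> perm.descend m (Suc j) \<sigma>')"
        using step(2) Suc.prems(1) by (intro adj) auto
      then show ?case unfolding perm.descend_Suc[OF step(2), symmetric] .
    qed
    moreover have "\<sigma> m \<le> m" using permutes_in_image[OF Suc.prems(2), of m] by simp
    ultimately show ?case using \<sigma>'(2) by metis
  qed
  then show ?thesis using assms(1) by blast
qed

context coxeter_operators
begin

text \<open>
  The action of the stabiliser extends to all cosets by \<open>descend\<close>. Multiplied with a representative, a
  generator either moves it to the next one or passes through it and becomes a generator of the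
  stabiliser; the relations give the same outcome for the operators as for the permutations.
\<close>

lemma presentation_step:
  assumes "m < n" and id: "\<rho> id = id"
    and \<rho>: "\<And>i \<sigma>. Suc i < m \<Longrightarrow> \<sigma> permutes {..<m} \<Longrightarrow> \<rho> (adj_transp i \<circ> \<sigma>) = T i \<circ> \<rho> \<sigma>"
  shows "\<exists>\<rho>'. \<rho>' id = id \<and> (\<forall>i \<sigma>. Suc i < Suc m \<longrightarrow> \<sigma> permutes {..<Suc m} \<longrightarrow>
    \<rho>' (adj_transp i \<circ> \<sigma>) = T i \<circ> \<rho>' \<sigma>)"
proof -
  define \<rho>' where "\<rho>' = (\<lambda>\<sigma> x. descend m (\<sigma> m) (\<rho> (inv_into UNIV (perm.descend m (\<sigma> m) id) \<circ> \<sigma>) x))"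
  have \<rho>'_eq: "\<rho>' (perm.descend m j \<sigma>') x = descend m j (\<rho> \<sigma>' x)"
    if "\<sigma>' permutes {..<m}" "j \<le> m" for j \<sigma>' x
    unfolding \<rho>'_def using coset_unique[OF that refl] by simp
  have "\<rho>' id = id"
    using \<rho>'_eq[of id m] by (auto simp: permutes_id id fun_eq_iff)
  moreover have "\<rho>' (adj_transp i \<circ> \<sigma>) x = T i (\<rho>' \<sigma> x)"
    if i: "Suc i < Suc m" and \<sigma>: "\<sigma> permutes {..<Suc m}" for i \<sigma> x
  proof -
    obtain \<sigma>' where \<sigma>': "\<sigma>' permutes {..<m}" "\<sigma> = perm.descend m (\<sigma> m) \<sigma>'"
      using coset_decomposition[OF \<sigma>] by metis
    define j where "j = \<sigma> m"
    have j: "j \<le> m" using permutes_in_image[OF \<sigma>, of m] by (simp add: j_def)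
    have \<sigma>_eq: "\<sigma> = perm.descend m j \<sigma>'" using \<sigma>'(2) by (simp add: j_def)
    consider "Suc i < j" | "j = Suc i" | "j = i" | "j < i" by linarith
    then show ?thesis
    proof cases
      case 1
      have "\<rho>' (adj_transp i \<circ> \<sigma>) x = \<rho>' (perm.descend m j (adj_transp i \<circ> \<sigma>')) x"
        unfolding \<sigma>_eq using perm.descend_below[OF 1 j lessI] by simp
      also have "\<dots> = descend m j (\<rho> (adj_transp i \<circ> \<sigma>') x)"
        using 1 j by (intro \<rho>'_eq permutes_compose \<sigma>'(1) adj_transp_permutes) auto
      also have "\<dots> = descend m j (T i (\<rho> \<sigma>' x))" using 1 j \<rho>[OF _ \<sigma>'(1), of i] by simp
      also have "\<dots> = T i (descend m j (\<rho> \<sigma>' x))" by (rule descend_below[OF 1 j \<open>m < n\<close>, symmetric])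
      finally show ?thesis unfolding \<sigma>_eq \<rho>'_eq[OF \<sigma>'(1) j] .
    next
      case 2
      have "\<rho>' (adj_transp i \<circ> \<sigma>) x = \<rho>' (perm.descend m i \<sigma>') x"
        unfolding \<sigma>_eq 2 using perm.descend_Suc[of i m] i by simp
      also have "\<dots> = T i (descend m j (\<rho> \<sigma>' x))"
        using i 2 by (subst \<rho>'_eq[OF \<sigma>'(1)]) (auto simp: descend_Suc)
      finally show ?thesis unfolding \<sigma>_eq \<rho>'_eq[OF \<sigma>'(1) j] .
    next
      case 3
      have "\<rho>' (adj_transp i \<circ> \<sigma>) x = \<rho>' (perm.descend m (Suc i) \<sigma>') x"
        unfolding \<sigma>_eq 3 using perm.descend_cancel[OF _ lessI, of i m] i by simp
      also have "\<dots> = T i (descend m j (\<rho> \<sigma>' x))"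
        using i 3 \<open>m < n\<close> by (subst \<rho>'_eq[OF \<sigma>'(1)]) (auto simp: descend_cancel)
      finally show ?thesis unfolding \<sigma>_eq \<rho>'_eq[OF \<sigma>'(1) j] .
    next
      case 4
      then obtain i' where i': "i = Suc i'" "j \<le> i'" by (cases i) auto
      have "\<rho>' (adj_transp i \<circ> \<sigma>) x = \<rho>' (perm.descend m j (adj_transp i' \<circ> \<sigma>')) x"
        unfolding \<sigma>_eq i'(1) using perm.descend_above[OF i'(2) _ lessI] i i' by simp
      also have "\<dots> = descend m j (\<rho> (adj_transp i' \<circ> \<sigma>') x)"
        using i i' j by (intro \<rho>'_eq permutes_compose \<sigma>'(1) adj_transp_permutes) auto
      also have "\<dots> = descend m j (T i' (\<rho> \<sigma>' x))" using i i' \<rho>[OF _ \<sigma>'(1), of i'] by simp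
      also have "\<dots> = T i (descend m j (\<rho> \<sigma>' x))"
        using descend_above[OF i'(2), of m] i i' \<open>m < n\<close> by simp
      finally show ?thesis unfolding \<sigma>_eq \<rho>'_eq[OF \<sigma>'(1) j] .
    qed
  qed
  ultimately show ?thesis by (intro exI[of _ \<rho>'] conjI allI impI ext) auto
qed

text \<open>
  Starting from the trivial group, the number of moved points grows by one in each step. As adjacent
  transpositions generate, compatibility with these makes the map multiplicative.
\<close>

theorem presentation:
  obtains \<rho> where "\<rho> id = id"
    "\<And>i \<sigma>. Suc i < n \<Longrightarrow> \<sigma> permutes {..<n} \<Longrightarrow> \<rho> (adj_transp i \<circ> \<sigma>) = T i \<circ> \<rho> \<sigma>"
    "\<And>\<sigma> \<tau>. \<sigma> permutes {..<n} \<Longrightarrow> \<tau> permutes {..<n} \<Longrightarrow> \<rho> (\<sigma> \<circ> \<tau>) = \<rho> \<sigma> \<circ> \<rho> \<tau>"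
proof -
  have "\<exists>\<rho>. \<rho> id = id \<and> (\<forall>i \<sigma>. Suc i < m \<longrightarrow> \<sigma> permutes {..<m} \<longrightarrow>
    \<rho> (adj_transp i \<circ> \<sigma>) = T i \<circ> \<rho> \<sigma>)" if "m \<le> n" for m
    using that
  proof (induction m)
    case 0
    show ?case by (intro exI[of _ "\<lambda>_. id"]) simp
  next
    case (Suc m)
    from Suc.prems have "m \<le> n" by simp
    from Suc.IH[OF this] obtain \<rho> where "\<rho> id = id" "\<forall>i \<sigma>. Suc i < m \<longrightarrow> \<sigma> permutes {..<m} \<longrightarrow>
      \<rho> (adj_transp i \<circ> \<sigma>) = T i \<circ> \<rho> \<sigma>" by blast
    then show ?case using Suc.prems by (intro presentation_step[of m \<rho>]) auto
  qed
  then obtain \<rho> where id: "\<rho> id = id" and adj: "\<And>i \<sigma>. Suc i < n \<Longrightarrow> \<sigma> permutes {..<n} \<Longrightarrow>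
    \<rho> (adj_transp i \<circ> \<sigma>) = T i \<circ> \<rho> \<sigma>" by blast
  have "\<rho> (\<sigma> \<circ> \<tau>) = \<rho> \<sigma> \<circ> \<rho> \<tau>" if "\<sigma> permutes {..<n}" "\<tau> permutes {..<n}" for \<sigma> \<tau>
    using that(1)
  proof (induction rule: permutes_adjacent_induct)
    case id
    have "\<rho> (id \<circ> \<tau>) = \<rho> id \<circ> \<rho> \<tau>" by (simp only: \<open>\<rho> id = id\<close> id_comp)
    then show ?case .
  next
    case (adj i \<sigma>)
    note gen = \<open>\<And>i \<sigma>. Suc i < n \<Longrightarrow> \<sigma> permutes {..<n} \<Longrightarrow> \<rho> (adj_transp i \<circ> \<sigma>) = T i \<circ> \<rho> \<sigma>\<close>
    have IH: "\<rho> (\<sigma> \<circ> \<tau>) = \<rho> \<sigma> \<circ> \<rho> \<tau>" by (rule adj)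
    have "\<rho> (adj_transp i \<circ> (\<sigma> \<circ> \<tau>)) = T i \<circ> \<rho> (\<sigma> \<circ> \<tau>)"
      using adj(1) permutes_compose[OF that(2) adj(2)] by (rule gen)
    also have "\<dots> = \<rho> (adj_transp i \<circ> \<sigma>) \<circ> \<rho> \<tau>"
      by (simp only: IH gen[OF adj(1,2)] comp_assoc)
    finally show ?case unfolding comp_assoc .
  qed
  with id adj that show thesis by blast
qed

end

section \<open>Rook matrices as restricted permutations\<close>

text \<open>
  The partial injection that sends the column \<open>b \<in> D\<close> to the row \<open>\<sigma> b\<close>. With a permutation \<open>\<sigma>\<close> of all
  indices, instead of an injection on \<open>D\<close>, a rook matrix is the product of an idempotent and a
  permutation matrix.
\<close>

definition rook_mat :: "nat \<Rightarrow> (nat \<Rightarrow> nat) \<Rightarrow> nat set \<Rightarrow> complex mat" where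
  "rook_mat n \<sigma> D = mat n n (\<lambda>(a, b). if b \<in> D \<and> a = \<sigma> b then 1 else 0)"

lemma rook_mat_dim [simp]: "dim_row (rook_mat n \<sigma> D) = n" "dim_col (rook_mat n \<sigma> D) = n"
  by (simp_all add: rook_mat_def)

lemma rook_mat_index:
  "a < n \<Longrightarrow> b < n \<Longrightarrow> rook_mat n \<sigma> D $$ (a, b) = (if b \<in> D \<and> a = \<sigma> b then 1 else 0)"
  by (simp add: rook_mat_def)

lemma rook_mat_cong:
  assumes "D \<inter> {..<n} = D' \<inter> {..<n}" "\<And>b. b \<in> D \<Longrightarrow> b < n \<Longrightarrow> \<sigma> b = \<sigma>' b"
  shows "rook_mat n \<sigma> D = rook_mat n \<sigma>' D'"
proof (rule eq_matI)
  fix a b assume "a < dim_row (rook_mat n \<sigma>' D')" "b < dim_col (rook_mat n \<sigma>' D')"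
  then have ab: "a < n" "b < n" by simp_all
  then have "b \<in> D \<longleftrightarrow> b \<in> D'" using assms(1) by blast
  then show "rook_mat n \<sigma> D $$ (a, b) = rook_mat n \<sigma>' D' $$ (a, b)"
    using ab assms(2)[of b] by (cases "b \<in> D") (simp_all add: rook_mat_index)
qed simp_all

lemma rook_mat_eqD:
  assumes "rook_mat n \<sigma> D = rook_mat n \<sigma>' D'" and "\<sigma> permutes {..<n}" "\<sigma>' permutes {..<n}"
    and "D \<subseteq> {..<n}" "D' \<subseteq> {..<n}"
  shows "D = D'" "b \<in> D \<Longrightarrow> \<sigma> b = \<sigma>' b"
proof -
  have eq: "(b \<in> D \<and> a = \<sigma> b) = (b \<in> D' \<and> a = \<sigma>' b)" if "a < n" "b < n" for a b
    using arg_cong[OF assms(1), of "\<lambda>A. A $$ (a, b)"] that by (auto simp: rook_mat_index split: if_splits)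
  have lt: "\<sigma> b < n" "\<sigma>' b < n" if "b < n" for b
    using that permutes_in_image[OF assms(2), of b] permutes_in_image[OF assms(3), of b] by auto
  show "D = D'"
  proof (rule Set.set_eqI)
    fix b
    show "b \<in> D \<longleftrightarrow> b \<in> D'"
    proof (cases "b < n")
      case True
      then show ?thesis using eq[OF lt(1), of b b] eq[OF lt(2), of b b] by auto
    next
      case False
      then show ?thesis using assms(4,5) by auto
    qed
  qed
  show "b \<in> D \<Longrightarrow> \<sigma> b = \<sigma>' b" using eq[of "\<sigma> b" b] lt assms(4) by auto
qed

lemma extend_to_permutation:
  assumes "finite N" "inj_on h D" "D \<subseteq> N" "h ` D \<subseteq> N"
  obtains \<sigma> where "\<sigma> permutes N" "\<And>b. b \<in> D \<Longrightarrow> \<sigma> b = h b"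
proof -
  have fin: "finite D" using assms(1,3) finite_subset by blast
  have "card (N - D) = card (N - h ` D)"
    using assms fin by (simp add: card_Diff_subset card_image)
  then obtain \<beta> where \<beta>: "bij_betw \<beta> (N - D) (N - h ` D)"
    using finite_same_card_bij[of "N - D" "N - h ` D"] assms(1) by auto
  define \<sigma> where "\<sigma> = (\<lambda>x. if x \<in> D then h x else if x \<in> N then \<beta> x else x)"
  have "bij_betw \<sigma> D (h ` D)"
    using assms(2) by (simp add: bij_betw_def \<sigma>_def cong: inj_on_cong)
  moreover have "bij_betw \<sigma> (N - D) (N - h ` D)"
    using \<beta> by (rule bij_betw_cong[THEN iffD1, rotated]) (auto simp: \<sigma>_def)
  ultimately have "bij_betw \<sigma> (D \<union> (N - D)) (h ` D \<union> (N - h ` D))"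
    by (rule bij_betw_combine) auto
  then have "bij_betw \<sigma> N N" using assms(3,4) by (simp add: Un_absorb1)
  then have "\<sigma> permutes N" by (rule bij_imp_permutes) (use assms(3) in \<open>auto simp: \<sigma>_def\<close>)
  then show thesis using that by (simp add: \<sigma>_def)
qed

lemma rook_mat_in_carrier:
  assumes "\<sigma> permutes {..<n}"
  shows "rook_mat n \<sigma> D \<in> carrier (rook_monoid n)"
proof -
  have "card {j. j < n \<and> rook_mat n \<sigma> D $$ (i, j) \<noteq> 0} \<le> 1" if "i < n" for i
  proof -
    have "{j. j < n \<and> rook_mat n \<sigma> D $$ (i, j) \<noteq> 0} \<subseteq> {inv_into UNIV \<sigma> i}"
      using that permutes_inverses(2)[OF assms] by (auto simp: rook_mat_index split: if_splits)
    then show ?thesis using card_mono[of "{inv_into UNIV \<sigma> i}"] by fastforce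
  qed
  moreover have "card {i. i < n \<and> rook_mat n \<sigma> D $$ (i, j) \<noteq> 0} \<le> 1" if "j < n" for j
  proof -
    have "{i. i < n \<and> rook_mat n \<sigma> D $$ (i, j) \<noteq> 0} \<subseteq> {\<sigma> j}"
      using that by (auto simp: rook_mat_index split: if_splits)
    then show ?thesis using card_mono[of "{\<sigma> j}"] by fastforce
  qed
  moreover have "rook_mat n \<sigma> D \<in> carrier_mat n n" by (rule carrier_matI) simp_all
  moreover have "rook_mat n \<sigma> D $$ (i, j) = 0 \<or> rook_mat n \<sigma> D $$ (i, j) = 1"
    if "i < n" "j < n" for i j using that by (simp add: rook_mat_index)
  ultimately show ?thesis unfolding rook_monoid_def by simp
qed

lemma rook_monoid_elementE:
  assumes "A \<in> carrier (rook_monoid n)"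
  obtains \<sigma> D where "\<sigma> permutes {..<n}" "D \<subseteq> {..<n}" "A = rook_mat n \<sigma> D"
proof -
  have A: "A \<in> carrier_mat n n" and entry: "\<And>i j. i < n \<Longrightarrow> j < n \<Longrightarrow> A $$ (i, j) = 0 \<or> A $$ (i, j) = 1"
    and row: "\<And>i. i < n \<Longrightarrow> card {j. j < n \<and> A $$ (i, j) \<noteq> 0} \<le> 1"
    and col: "\<And>j. j < n \<Longrightarrow> card {i. i < n \<and> A $$ (i, j) \<noteq> 0} \<le> 1"
    using assms by (auto simp: rook_monoid_def)
  have row1: "j = j'" if "i < n" "j < n" "j' < n" "A $$ (i, j) \<noteq> 0" "A $$ (i, j') \<noteq> 0" for i j j'
    using row[OF that(1)] that card_le_Suc0_iff_eq[of "{j. j < n \<and> A $$ (i, j) \<noteq> 0}"] by auto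
  have col1: "i = i'" if "j < n" "i < n" "i' < n" "A $$ (i, j) \<noteq> 0" "A $$ (i', j) \<noteq> 0" for i i' j
    using col[OF that(1)] that card_le_Suc0_iff_eq[of "{i. i < n \<and> A $$ (i, j) \<noteq> 0}"] by auto
  define D where "D = {b. b < n \<and> (\<exists>a<n. A $$ (a, b) \<noteq> 0)}"
  have "\<forall>b\<in>D. \<exists>a. a < n \<and> A $$ (a, b) \<noteq> 0" by (auto simp: D_def)
  then obtain h where h: "\<And>b. b \<in> D \<Longrightarrow> h b < n \<and> A $$ (h b, b) \<noteq> 0" by metis
  have Dn: "D \<subseteq> {..<n}" by (auto simp: D_def)
  have "inj_on h D"
    by (rule inj_onI) (metis Dn h lessThan_iff row1 subsetD)
  then obtain \<sigma> where \<sigma>: "\<sigma> permutes {..<n}" "\<And>b. b \<in> D \<Longrightarrow> \<sigma> b = h b"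
    using extend_to_permutation[of "{..<n}" h D] Dn h by auto
  have "A = rook_mat n \<sigma> D"
  proof (rule eq_matI)
    fix a b assume "a < dim_row (rook_mat n \<sigma> D)" "b < dim_col (rook_mat n \<sigma> D)"
    then have ab: "a < n" "b < n" by auto
    show "A $$ (a, b) = rook_mat n \<sigma> D $$ (a, b)"
    proof (cases "A $$ (a, b) = 0")
      case True
      then show ?thesis using h[of b] \<sigma>(2)[of b] ab by (auto simp: rook_mat_index)
    next
      case False
      then have "b \<in> D" using ab by (auto simp: D_def)
      moreover from this have "a = h b" using col1[OF ab(2,1)] h[of b] False by blast
      ultimately show ?thesis using entry[OF ab] False \<sigma>(2) ab by (simp add: rook_mat_index)
    qed
  qed (use A in auto)
  with \<sigma>(1) Dn that show thesis by blast
qed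

lemma rook_mat_mult:
  assumes "\<tau> permutes {..<n}"
  shows "rook_mat n \<sigma> D * rook_mat n \<tau> E = rook_mat n (\<sigma> \<circ> \<tau>) {b \<in> E. \<tau> b \<in> D}"
proof (rule eq_matI)
  fix a b assume "a < dim_row (rook_mat n (\<sigma> \<circ> \<tau>) {b \<in> E. \<tau> b \<in> D})"
    "b < dim_col (rook_mat n (\<sigma> \<circ> \<tau>) {b \<in> E. \<tau> b \<in> D})"
  then have ab: "a < n" "b < n" by auto
  have lt: "\<tau> b < n" using ab permutes_in_image[OF assms, of b] by auto
  have "(rook_mat n \<sigma> D * rook_mat n \<tau> E) $$ (a, b) =
    (\<Sum>c<n. rook_mat n \<sigma> D $$ (a, c) * rook_mat n \<tau> E $$ (c, b))"
    using ab by (simp add: scalar_prod_def atLeast0LessThan)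
  also have "\<dots> = (\<Sum>c<n. if c = \<tau> b then (if b \<in> E \<and> \<tau> b \<in> D \<and> a = \<sigma> (\<tau> b) then 1 else 0) else 0)"
    using ab by (intro sum.cong) (auto simp: rook_mat_index)
  also have "\<dots> = (if b \<in> E \<and> \<tau> b \<in> D \<and> a = \<sigma> (\<tau> b) then 1 else 0)" using lt by simp
  finally show "(rook_mat n \<sigma> D * rook_mat n \<tau> E) $$ (a, b) =
    rook_mat n (\<sigma> \<circ> \<tau>) {b \<in> E. \<tau> b \<in> D} $$ (a, b)" using ab by (auto simp: rook_mat_index)
qed simp_all

lemma rook_monoid_mult [simp]: "A \<otimes>\<^bsub>rook_monoid n\<^esub> B = A * B"
  by (simp add: rook_monoid_def)

lemma rook_monoid_one: "\<one>\<^bsub>rook_monoid n\<^esub> = rook_mat n id {..<n}"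
  by (auto simp: rook_monoid_def rook_mat_index)

lemma rook_s_eq: "Suc i < n \<Longrightarrow> rook_s n (Suc i) = rook_mat n (adj_transp i) {..<n}"
  by (rule eq_matI) (auto simp: rook_s_def rook_mat_index adj_transp_def)

lemma rook_P1_eq: "rook_P1 n = rook_mat n id ({..<n} - {0})"
  by (rule eq_matI) (auto simp: rook_P1_def rook_mat_index)

section \<open>Standard tableaux and exchanging consecutive entries\<close>

lemma entries_swap: "entries \<mu> (swap_entries \<mu> i L) = transpose i (Suc i) ` entries \<mu> L"
  by (auto simp: entries_def swap_entries_def image_image)

lemma swap_swap: "L \<in> extensional (boxes \<mu>) \<Longrightarrow> swap_entries \<mu> i (swap_entries \<mu> i L) = L"
  by (rule extensionalityI[of _ "boxes \<mu>"]) (auto simp: swap_entries_def)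

lemma swap_braid:
  "swap_entries \<mu> i (swap_entries \<mu> (Suc i) (swap_entries \<mu> i L)) =
   swap_entries \<mu> (Suc i) (swap_entries \<mu> i (swap_entries \<mu> (Suc i) L))"
  by (auto simp: swap_entries_def transpose_def fun_eq_iff restrict_def)

lemma swap_comm:
  "Suc i < j \<Longrightarrow> swap_entries \<mu> i (swap_entries \<mu> j L) = swap_entries \<mu> j (swap_entries \<mu> i L)"
  by (auto simp: swap_entries_def transpose_def fun_eq_iff restrict_def)

definition injective_filling :: "nat list \<Rightarrow> (nat \<times> nat \<Rightarrow> nat) \<Rightarrow> bool" where
  "injective_filling \<mu> L \<longleftrightarrow> L \<in> extensional (boxes \<mu>) \<and> inj_on L (boxes \<mu>)"

lemma injective_filling_swap: "injective_filling \<mu> L \<Longrightarrow> injective_filling \<mu> (swap_entries \<mu> i L)"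
  unfolding injective_filling_def swap_entries_def inj_on_def
  by (metis (lifting) restrict_apply' restrict_extensional transpose_involutory)

lemma box_of_eq: "injective_filling \<mu> L \<Longrightarrow> b \<in> boxes \<mu> \<Longrightarrow> box_of \<mu> L (L b) = b"
  by (simp add: injective_filling_def box_of_def the_inv_into_f_f)

lemma box_of_in_boxes:
  assumes "injective_filling \<mu> L" "p \<in> entries \<mu> L"
  shows "box_of \<mu> L p \<in> boxes \<mu>" "L (box_of \<mu> L p) = p"
  using assms box_of_eq by (auto simp: entries_def)

lemma box_of_swap:
  assumes "injective_filling \<mu> L" "transpose i (Suc i) p \<in> entries \<mu> L"
  shows "box_of \<mu> (swap_entries \<mu> i L) p = box_of \<mu> L (transpose i (Suc i) p)"
proof -
  let ?b = "box_of \<mu> L (transpose i (Suc i) p)"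
  have b: "?b \<in> boxes \<mu>" "swap_entries \<mu> i L ?b = p"
    using box_of_in_boxes[OF assms] by (simp_all add: swap_entries_def)
  show ?thesis using box_of_eq[OF injective_filling_swap[OF assms(1), of i] b(1)] unfolding b(2) .
qed

lemma in_transpose_image: "p \<in> transpose a b ` E \<longleftrightarrow> transpose a b p \<in> E"
  by (metis image_iff transpose_involutory)

text \<open>
  Absent entries count as infinitely far away, so that the formulas of the action need no distinction
  between present and absent entries.
\<close>

definition inverse_axial_distance :: "nat list \<Rightarrow> (nat \<times> nat \<Rightarrow> nat) \<Rightarrow> nat \<Rightarrow> nat \<Rightarrow> complex" where
  "inverse_axial_distance \<mu> L p q = (if p \<in> entries \<mu> L \<and> q \<in> entries \<mu> L
     then 1 / of_int (content (box_of \<mu> L q) - content (box_of \<mu> L p)) else 0)"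

lemma inverse_axial_distance_skew:
  "inverse_axial_distance \<mu> L q p = - inverse_axial_distance \<mu> L p q"
proof -
  have "1 / (x - y) = - (1 / (y - x))" for x y :: complex by (metis minus_diff_eq divide_minus_right)
  from this[of "of_int (content (box_of \<mu> L p))" "of_int (content (box_of \<mu> L q))"]
  show ?thesis by (simp add: inverse_axial_distance_def)
qed

lemma inverse_axial_distance_swap:
  assumes "injective_filling \<mu> L"
  shows "inverse_axial_distance \<mu> (swap_entries \<mu> i L) p q =
    inverse_axial_distance \<mu> L (transpose i (Suc i) p) (transpose i (Suc i) q)"
  using assms by (auto simp: inverse_axial_distance_def entries_swap in_transpose_image box_of_swap)

lemma boxes_down_closed:
  assumes "is_partition \<mu>" "(x', y') \<in> boxes \<mu>" "x \<le> x'" "y \<le> y'"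
  shows "(x, y) \<in> boxes \<mu>"
proof -
  have "\<mu> ! x' \<le> \<mu> ! x"
    using assms unfolding is_partition_def boxes_def sorted_wrt_iff_nth_less
    by (cases "x = x'") auto
  then show ?thesis using assms by (auto simp: boxes_def)
qed

lemma finite_boxes: "finite (boxes \<mu>)"
proof (rule finite_subset)
  show "boxes \<mu> \<subseteq> Sigma {..<length \<mu>} (\<lambda>x. {..<\<mu> ! x})" by (auto simp: boxes_def)
qed simp

lemma card_boxes: "card (boxes \<mu>) = sum_list \<mu>"
proof -
  have "boxes \<mu> = Sigma {..<length \<mu>} (\<lambda>x. {..<\<mu> ! x})" by (auto simp: boxes_def)
  then show ?thesis by (simp add: sum_list_sum_nth atLeast0LessThan)
qed

lemma finite_n_standard_tableaux: "finite (n_standard_tableaux n \<mu>)"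
  by (rule finite_subset[of _ "boxes \<mu> \<rightarrow>\<^sub>E {1..n}"])
    (auto simp: n_standard_tableaux_def finite_boxes intro: finite_PiE)

locale tableau =
  fixes n :: nat and \<mu> :: "nat list" and L :: "nat \<times> nat \<Rightarrow> nat"
  assumes partition: "is_partition \<mu>" and standard: "L \<in> n_standard_tableaux n \<mu>"
begin

lemma filling: "injective_filling \<mu> L"
  using standard by (auto simp: n_standard_tableaux_def injective_filling_def PiE_def)

lemma row_less: "y < y' \<Longrightarrow> (x, y') \<in> boxes \<mu> \<Longrightarrow> L (x, y) < L (x, y')"
  using standard unfolding n_standard_tableaux_def increasing_filling_def by blast

lemma column_less: "x < x' \<Longrightarrow> (x', y) \<in> boxes \<mu> \<Longrightarrow> L (x, y) < L (x', y)"
  using standard unfolding n_standard_tableaux_def increasing_filling_def by blast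

lemma box_mono:
  assumes "(x', y') \<in> boxes \<mu>" "x \<le> x'" "y \<le> y'"
  shows "L (x, y) \<le> L (x', y')"
proof -
  have "(x, y') \<in> boxes \<mu>" by (rule boxes_down_closed[OF partition assms(1,2)]) simp
  then have "L (x, y) \<le> L (x, y')" using assms(3) row_less[of y y' x] by (cases "y = y'") auto
  also have "\<dots> \<le> L (x', y')" using assms(1,2) column_less[of x x' y'] by (cases "x = x'") auto
  finally show ?thesis .
qed

lemma box_strict_mono:
  assumes "(x', y') \<in> boxes \<mu>" "x \<le> x'" "y \<le> y'" "(x, y) \<noteq> (x', y')"
  shows "L (x, y) < L (x', y')"
proof -
  have "(x, y) \<in> boxes \<mu>" by (rule boxes_down_closed[OF partition assms(1-3)])
  then have "L (x, y) \<noteq> L (x', y')"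
    using filling assms(1,4) by (auto simp: injective_filling_def inj_on_def)
  then show ?thesis using box_mono[OF assms(1-3)] by simp
qed

lemma entriesE:
  assumes "p \<in> entries \<mu> L"
  obtains x y where "(x, y) \<in> boxes \<mu>" "L (x, y) = p" "box_of \<mu> L p = (x, y)"
  using box_of_in_boxes[OF filling assms] by (metis surj_pair)

lemma entry_bounds: "p \<in> entries \<mu> L \<Longrightarrow> 1 \<le> p \<and> p \<le> n"
  using standard by (auto simp: entries_def n_standard_tableaux_def PiE_iff)

text \<open>
  Two boxes of one diagonal enclose a box to the right of and a box below the smaller one, so two
  further entries lie between their entries.
\<close>

lemma equal_content_far_apart:
  assumes "p \<in> entries \<mu> L" "q \<in> entries \<mu> L" "p < q"
    and "content (box_of \<mu> L p) = content (box_of \<mu> L q)"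
  shows "p + 3 \<le> q"
proof -
  obtain x y where p: "(x, y) \<in> boxes \<mu>" "L (x, y) = p" "box_of \<mu> L p = (x, y)"
    using entriesE[OF assms(1)] .
  obtain x' y' where q: "(x', y') \<in> boxes \<mu>" "L (x', y') = q" "box_of \<mu> L q = (x', y')"
    using entriesE[OF assms(2)] .
  have diag: "int y - int x = int y' - int x'" using assms(4) p(3) q(3) by (simp add: content_def)
  have "x < x'"
  proof (rule ccontr)
    assume "\<not> x < x'"
    then have "L (x', y') \<le> L (x, y)" using diag by (intro box_mono[OF p(1)]) auto
    then show False using p q assms(3) by simp
  qed
  then have "y < y'" using diag by simp
  have right: "(x, Suc y) \<in> boxes \<mu>" "L (x, y) < L (x, Suc y)" "L (x, Suc y) < L (x', y')"
    using \<open>x < x'\<close> \<open>y < y'\<close> boxes_down_closed[OF partition q(1), of x "Suc y"]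
    by (auto intro!: row_less box_strict_mono[OF q(1)])
  have below: "(Suc x, y) \<in> boxes \<mu>" "L (x, y) < L (Suc x, y)" "L (Suc x, y) < L (x', y')"
    using \<open>x < x'\<close> \<open>y < y'\<close> boxes_down_closed[OF partition q(1), of "Suc x" y]
    by (auto intro!: column_less box_strict_mono[OF q(1)])
  have "L (x, Suc y) \<noteq> L (Suc x, y)"
    using filling right(1) below(1) unfolding injective_filling_def inj_on_def
    by (metis n_not_Suc_n prod.inject)
  then show ?thesis using right below p(2) q(2) by linarith
qed

text \<open>
  The identity \<open>a b = e (a + b)\<close> satisfied by \<open>a = 1/(y-x)\<close>, \<open>b = 1/(z-y)\<close> and \<open>e = 1/(z-x)\<close>
  survives when some of the three contents are infinite, that is, some of the entries absent.
\<close>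

lemma inverse_axial_distance_additive:
  "inverse_axial_distance \<mu> L i (Suc i) * inverse_axial_distance \<mu> L (Suc i) (Suc (Suc i)) =
   inverse_axial_distance \<mu> L i (Suc (Suc i)) *
   (inverse_axial_distance \<mu> L i (Suc i) + inverse_axial_distance \<mu> L (Suc i) (Suc (Suc i)))"
proof (cases "i \<in> entries \<mu> L \<and> Suc i \<in> entries \<mu> L \<and> Suc (Suc i) \<in> entries \<mu> L")
  case True
  define x y z where "x = content (box_of \<mu> L i)" and "y = content (box_of \<mu> L (Suc i))"
    and "z = content (box_of \<mu> L (Suc (Suc i)))"
  have "x \<noteq> y" "y \<noteq> z" "x \<noteq> z"
    using True equal_content_far_apart[of i "Suc i"] equal_content_far_apart[of "Suc i" "Suc (Suc i)"]
      equal_content_far_apart[of i "Suc (Suc i)"] unfolding x_def y_def z_def by auto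
  then have "(of_int (y - x) :: complex) \<noteq> 0" "(of_int (z - y) :: complex) \<noteq> 0"
    "(of_int (z - x) :: complex) \<noteq> 0" by simp_all
  then have "1 / of_int (y - x) * (1 / of_int (z - y)) =
    1 / of_int (z - x) * (1 / of_int (y - x) + 1 / (of_int (z - y) :: complex))"
    by (simp add: field_simps)
  then show ?thesis using True by (simp add: inverse_axial_distance_def x_def y_def z_def)
qed (auto simp: inverse_axial_distance_def)

text \<open>
  An exchange of \<open>i\<close> and \<open>i + 1\<close> can only violate the increase along a row or column if both lie in it,
  and then they are neighbours there, because nothing fits between them.
\<close>

lemma swap_standard:
  assumes i: "1 \<le> i" "Suc i \<le> n" and a: "(inverse_axial_distance \<mu> L i (Suc i))\<^sup>2 \<noteq> 1"
  shows "swap_entries \<mu> i L \<in> n_standard_tableaux n \<mu>"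
proof -
  have less: "transpose i (Suc i) u < transpose i (Suc i) v" if "u < v" "\<not> (u = i \<and> v = Suc i)" for u v
    using that by (auto simp: transpose_def)
  have a_eq: "(inverse_axial_distance \<mu> L i (Suc i)) =
      1 / of_int (content b' - content b)" if "b \<in> boxes \<mu>" "b' \<in> boxes \<mu>" "L b = i" "L b' = Suc i" for b b'
  proof -
    have "box_of \<mu> L i = b" "box_of \<mu> L (Suc i) = b'"
      using box_of_eq[OF filling that(1)] box_of_eq[OF filling that(2)] that(3,4) by simp_all
    moreover have "i \<in> entries \<mu> L" "Suc i \<in> entries \<mu> L"
      using that unfolding entries_def by (metis imageI)+
    ultimately show ?thesis by (simp add: inverse_axial_distance_def)
  qed
  have row: "transpose i (Suc i) (L (x, y)) < transpose i (Suc i) (L (x, y'))"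
    if "y < y'" "(x, y') \<in> boxes \<mu>" for x y y'
  proof (rule less)
    show "L (x, y) < L (x, y')" by (rule row_less[OF that])
    show "\<not> (L (x, y) = i \<and> L (x, y') = Suc i)"
    proof
      assume ii: "L (x, y) = i \<and> L (x, y') = Suc i"
      have xy: "(x, y) \<in> boxes \<mu>" using boxes_down_closed[OF partition that(2)] that(1) by simp
      have "y' = Suc y"
      proof (rule ccontr)
        assume "y' \<noteq> Suc y"
        then have "L (x, y) < L (x, Suc y)" "L (x, Suc y) < L (x, y')"
          using that boxes_down_closed[OF partition that(2), of x "Suc y"] by (auto intro!: row_less)
        then show False using ii by simp
      qed
      then show False using a a_eq[OF xy that(2)] ii by (simp add: content_def)
    qed
  qed
  have column: "transpose i (Suc i) (L (x, y)) < transpose i (Suc i) (L (x', y))"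
    if "x < x'" "(x', y) \<in> boxes \<mu>" for x x' y
  proof (rule less)
    show "L (x, y) < L (x', y)" by (rule column_less[OF that])
    show "\<not> (L (x, y) = i \<and> L (x', y) = Suc i)"
    proof
      assume ii: "L (x, y) = i \<and> L (x', y) = Suc i"
      have xy: "(x, y) \<in> boxes \<mu>" using boxes_down_closed[OF partition that(2)] that(1) by simp
      have "x' = Suc x"
      proof (rule ccontr)
        assume "x' \<noteq> Suc x"
        then have "L (x, y) < L (Suc x, y)" "L (Suc x, y) < L (x', y)"
          using that boxes_down_closed[OF partition that(2), of "Suc x" y] by (auto intro!: column_less)
        then show False using ii by simp
      qed
      then show False using a a_eq[OF xy that(2)] ii by (simp add: content_def)
    qed
  qed
  have "increasing_filling \<mu> (swap_entries \<mu> i L)"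
    unfolding increasing_filling_def
  proof (intro conjI allI impI)
    fix x y y' assume "y < y'" "(x, y') \<in> boxes \<mu>"
    moreover from this have "(x, y) \<in> boxes \<mu>" using boxes_down_closed[OF partition, of x y' x y] by simp
    ultimately show "swap_entries \<mu> i L (x, y) < swap_entries \<mu> i L (x, y')"
      using row by (simp add: swap_entries_def)
  next
    fix x x' y assume "x < x'" "(x', y) \<in> boxes \<mu>"
    moreover from this have "(x, y) \<in> boxes \<mu>" using boxes_down_closed[OF partition, of x' y x y] by simp
    ultimately show "swap_entries \<mu> i L (x, y) < swap_entries \<mu> i L (x', y)"
      using column by (simp add: swap_entries_def)
  qed
  moreover have "transpose i (Suc i) (L b) \<in> {1..n}" if "b \<in> boxes \<mu>" for b
    using i standard that by (auto simp: transpose_def n_standard_tableaux_def PiE_iff)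
  moreover have "inj_on (swap_entries \<mu> i L) (boxes \<mu>)"
    using injective_filling_swap[OF filling] by (simp add: injective_filling_def)
  ultimately show ?thesis by (auto simp: n_standard_tableaux_def swap_entries_def)
qed

text \<open>
  Axial distance 1 makes the boxes of \<open>i\<close> and \<open>i + 1\<close> comparable, and the smaller entry has the box above
  and to the left; after the exchange the larger entry would be there.
\<close>

lemma swap_not_standard:
  assumes "inverse_axial_distance \<mu> L i (Suc i) = 1"
  shows "swap_entries \<mu> i L \<notin> n_standard_tableaux n \<mu>"
proof
  assume "swap_entries \<mu> i L \<in> n_standard_tableaux n \<mu>"
  then interpret swap: tableau n \<mu> "swap_entries \<mu> i L" by unfold_locales (rule partition)
  have mem: "i \<in> entries \<mu> L" "Suc i \<in> entries \<mu> L"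
    using assms by (auto simp: inverse_axial_distance_def split: if_splits)
  obtain x y where p: "(x, y) \<in> boxes \<mu>" "L (x, y) = i" "box_of \<mu> L i = (x, y)"
    using entriesE[OF mem(1)] .
  obtain x' y' where q: "(x', y') \<in> boxes \<mu>" "L (x', y') = Suc i" "box_of \<mu> L (Suc i) = (x', y')"
    using entriesE[OF mem(2)] .
  have "(1 :: complex) / of_int (content (x', y') - content (x, y)) = 1"
    using assms mem p(3) q(3) by (simp add: inverse_axial_distance_def)
  then have "of_int (content (x', y') - content (x, y)) = (of_int 1 :: complex)" by (simp add: field_simps split: if_splits)
  then have d: "content (x', y') - content (x, y) = 1" by (simp only: of_int_eq_iff)
  have "x \<le> x'"
  proof (rule ccontr)
    assume "\<not> x \<le> x'"
    then have "L (x', y') \<le> L (x, y)" using d by (intro box_mono[OF p(1)]) (auto simp: content_def)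
    then show False using p q by simp
  qed
  then have "y \<le> y'" "(x, y) \<noteq> (x', y')" using d by (auto simp: content_def)
  from swap.box_strict_mono[OF q(1) \<open>x \<le> x'\<close> this] show False
    using p q by (simp add: swap_entries_def)
qed

end

section \<open>Young's seminormal operators\<close>

text \<open>
  The operators act on vectors through their coefficients \<open>f L\<close>. The coefficient of \<open>v\<^sub>L\<close> in \<open>s\<^sub>i f\<close> comes
  from \<open>v\<^sub>L\<close> and from the exchanged tableau, at which \<open>a\<close> has the opposite sign; so Young's \<open>1 + a\<close> shows
  up as \<open>1 - a\<close>. It is set to zero for \<open>a = \<plusminus>1\<close>, when the exchanged tableau is not standard. With this
  choice the product of opposite coefficients is still \<open>1 - a\<^sup>2\<close>, which is all that the relations require
  of it, and nothing leads out of the standard tableaux; the relations can then be checked by the same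
  formula for all fillings.
\<close>

definition off_diagonal :: "complex \<Rightarrow> complex" where
  "off_diagonal a = (if a\<^sup>2 = 1 then 0 else 1 - a)"

lemma off_diagonal_mult: "off_diagonal a * off_diagonal (- a) = 1 - a\<^sup>2"
  by (simp add: off_diagonal_def power2_eq_square algebra_simps)

definition formal_op :: "nat list \<Rightarrow> nat \<Rightarrow> ((nat \<times> nat \<Rightarrow> nat) \<Rightarrow> complex) \<Rightarrow> (nat \<times> nat \<Rightarrow> nat) \<Rightarrow> complex" where
  "formal_op \<mu> i f L = inverse_axial_distance \<mu> L i (Suc i) * f L +
     off_diagonal (inverse_axial_distance \<mu> L i (Suc i)) * f (swap_entries \<mu> i L)"

text \<open>
  On functions that vanish off the standard tableaux, the identity in the second case is zero; it
  makes the relations hold for all functions.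
\<close>

definition seminormal_op ::
    "nat \<Rightarrow> nat list \<Rightarrow> nat \<Rightarrow> ((nat \<times> nat \<Rightarrow> nat) \<Rightarrow> complex) \<Rightarrow> (nat \<times> nat \<Rightarrow> nat) \<Rightarrow> complex" where
  "seminormal_op n \<mu> i f L = (if L \<in> n_standard_tableaux n \<mu> then formal_op \<mu> i f L else f L)"

lemma formal_op_invol:
  assumes "injective_filling \<mu> L"
  shows "formal_op \<mu> i (formal_op \<mu> i f) L = f L"
proof -
  let ?a = "inverse_axial_distance \<mu> L i (Suc i)"
  have a': "inverse_axial_distance \<mu> (swap_entries \<mu> i L) i (Suc i) = - ?a"
    using inverse_axial_distance_swap[OF assms, of i i "Suc i"]
      inverse_axial_distance_skew[of \<mu> L "Suc i" i] by simp
  have "swap_entries \<mu> i (swap_entries \<mu> i L) = L"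
    using assms swap_swap by (simp add: injective_filling_def)
  then have "formal_op \<mu> i (formal_op \<mu> i f) L =
    (?a * ?a + off_diagonal ?a * off_diagonal (- ?a)) * f L"
    by (simp add: formal_op_def a' algebra_simps)
  then show ?thesis by (simp add: off_diagonal_mult power2_eq_square)
qed

lemma formal_op_comm:
  assumes "injective_filling \<mu> L" "Suc i < j"
  shows "formal_op \<mu> i (formal_op \<mu> j f) L = formal_op \<mu> j (formal_op \<mu> i f) L"
proof -
  have "inverse_axial_distance \<mu> (swap_entries \<mu> i L) j (Suc j) = inverse_axial_distance \<mu> L j (Suc j)"
    "inverse_axial_distance \<mu> (swap_entries \<mu> j L) i (Suc i) = inverse_axial_distance \<mu> L i (Suc i)"
    using assms by (simp_all add: inverse_axial_distance_swap transpose_def)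
  then show ?thesis by (simp add: formal_op_def swap_comm[OF assms(2)] algebra_simps)
qed

text \<open>
  The two sides of the braid relation are combinations of the values \<open>F0, \<dots>, F121\<close> at the six
  fillings obtained by permuting three consecutive entries. The coefficients of \<open>F12\<close>, \<open>F21\<close> and
  \<open>F121\<close> agree at once, and the others differ by multiples of \<open>a b - e (a + b)\<close>.
\<close>

lemma braid_identity:
  fixes a b e :: complex
  assumes "a * b = e * (a + b)" "ca * ca' = 1 - a * a" "cb * cb' = 1 - b * b"
  shows "a * (b * (a * F0 + ca * F1) + cb * (e * F2 + ce * F12))
      + ca * (e * (- a * F1 + ca' * F0) + ce * (b * F21 + cb * F121))
    = b * (a * (b * F0 + cb * F2) + ca * (e * F1 + ce * F21))
      + cb * (e * (- b * F2 + cb' * F0) + ce * (a * F12 + ca * F121))" (is "?l = ?r")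
proof -
  let ?z = "a * b - e * (a + b)"
  have "?l - ?r = F0 * (a * b * a + e * (ca * ca') - b * a * b - e * (cb * cb'))
      + ca * F1 * ?z - cb * F2 * ?z"
    by (simp add: algebra_simps)
  also have "\<dots> = F0 * ((a - b) * ?z) + ca * F1 * ?z - cb * F2 * ?z"
    unfolding assms(2,3) by (simp add: algebra_simps)
  also have "\<dots> = 0" using assms(1) by simp
  finally show ?thesis by simp
qed

lemma (in tableau) formal_op_braid:
  "formal_op \<mu> i (formal_op \<mu> (Suc i) (formal_op \<mu> i f)) L =
   formal_op \<mu> (Suc i) (formal_op \<mu> i (formal_op \<mu> (Suc i) f)) L"
proof -
  let ?s1 = "swap_entries \<mu> i" and ?s2 = "swap_entries \<mu> (Suc i)"
  let ?d = "inverse_axial_distance \<mu>"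
  define a b e where "a = ?d L i (Suc i)" and "b = ?d L (Suc i) (Suc (Suc i))"
    and "e = ?d L i (Suc (Suc i))"
  have skew: "?d L (Suc i) i = - a" "?d L (Suc (Suc i)) (Suc i) = - b" "?d L (Suc (Suc i)) i = - e"
    unfolding a_def b_def e_def by (rule inverse_axial_distance_skew)+
  note fill = filling injective_filling_swap
  have d: "?d (?s1 L) i (Suc i) = - a" "?d (?s1 L) (Suc i) (Suc (Suc i)) = e"
    "?d (?s2 L) i (Suc i) = e" "?d (?s2 L) (Suc i) (Suc (Suc i)) = - b"
    "?d (?s2 (?s1 L)) i (Suc i) = b" "?d (?s1 (?s2 L)) (Suc i) (Suc (Suc i)) = a"
    by (simp_all add: fill inverse_axial_distance_swap skew a_def b_def e_def transpose_def)
  have ss: "?s1 (?s1 L) = L" "?s2 (?s2 L) = L"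
    using filling swap_swap by (simp_all add: injective_filling_def)
  have "formal_op \<mu> i (formal_op \<mu> (Suc i) (formal_op \<mu> i f)) L =
      a * (b * (a * f L + off_diagonal a * f (?s1 L)) +
        off_diagonal b * (e * f (?s2 L) + off_diagonal e * f (?s1 (?s2 L))))
      + off_diagonal a * (e * (- a * f (?s1 L) + off_diagonal (- a) * f L) +
        off_diagonal e * (b * f (?s2 (?s1 L)) + off_diagonal b * f (?s1 (?s2 (?s1 L)))))"
    unfolding formal_op_def a_def[symmetric] b_def[symmetric] d ss by (rule refl)
  also have "\<dots> = b * (a * (b * f L + off_diagonal b * f (?s2 L)) +
        off_diagonal a * (e * f (?s1 L) + off_diagonal e * f (?s2 (?s1 L))))
      + off_diagonal b * (e * (- b * f (?s2 L) + off_diagonal (- b) * f L) +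
        off_diagonal e * (a * f (?s1 (?s2 L)) + off_diagonal a * f (?s1 (?s2 (?s1 L)))))"
    using inverse_axial_distance_additive[of i] unfolding a_def[symmetric] b_def[symmetric] e_def[symmetric]
    by (intro braid_identity) (simp_all add: off_diagonal_mult power2_eq_square)
  also have "\<dots> = formal_op \<mu> (Suc i) (formal_op \<mu> i (formal_op \<mu> (Suc i) f)) L"
    unfolding formal_op_def a_def[symmetric] b_def[symmetric] d ss swap_braid by (rule refl)
  finally show ?thesis .
qed

lemma seminormal_op_standard: "L \<in> n_standard_tableaux n \<mu> \<Longrightarrow> seminormal_op n \<mu> i f L = formal_op \<mu> i f L"
  by (simp add: seminormal_op_def)

text \<open>
  The value at a standard tableau only depends on values at standard tableaux: an exchange that
  leaves them has coefficient zero.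
\<close>

lemma formal_op_cong:
  assumes "is_partition \<mu>" "L \<in> n_standard_tableaux n \<mu>" "1 \<le> i" "Suc i \<le> n"
    and "\<And>K. K \<in> n_standard_tableaux n \<mu> \<Longrightarrow> f K = g K"
  shows "formal_op \<mu> i f L = formal_op \<mu> i g L"
proof -
  interpret tableau n \<mu> L using assms by unfold_locales
  show ?thesis
    using assms(2,5) swap_standard[OF assms(3,4)] by (auto simp: formal_op_def off_diagonal_def)
qed

lemma seminormal_coxeter:
  assumes "is_partition \<mu>"
  shows "coxeter_operators n (\<lambda>i. seminormal_op n \<mu> (Suc i))"
proof
  let ?S = "\<lambda>i. seminormal_op n \<mu> (Suc i)" and ?F = "\<lambda>i. formal_op \<mu> (Suc i)"
  have two: "?S i (?S j f) L = ?F i (?F j f) L"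
    if "L \<in> n_standard_tableaux n \<mu>" "Suc i < n" for i j f L
    using formal_op_cong[OF assms that(1), of "Suc i" "?S j f" "?F j f"] that
    by (simp add: seminormal_op_standard)
  have off: "?S i f L = f L" if "L \<notin> n_standard_tableaux n \<mu>" for i f L
    using that by (simp add: seminormal_op_def)
  have tab: "tableau n \<mu> L" if "L \<in> n_standard_tableaux n \<mu>" for L
    using assms that by unfold_locales
  fix i f
  show "?S i (?S i f) = f" if "Suc i < n"
  proof
    fix L show "?S i (?S i f) L = f L"
      using two[OF _ that] off formal_op_invol[OF tableau.filling[OF tab]] by (cases "L \<in> n_standard_tableaux n \<mu>") auto
  qed
  show "?S i (?S (Suc i) (?S i f)) = ?S (Suc i) (?S i (?S (Suc i) f))" if "Suc (Suc i) < n"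
  proof
    fix L show "?S i (?S (Suc i) (?S i f)) L = ?S (Suc i) (?S i (?S (Suc i) f)) L"
    proof (cases "L \<in> n_standard_tableaux n \<mu>")
      case True
      have "?S i (?S (Suc i) (?S i f)) L = ?F i (?F (Suc i) (?F i f)) L"
        using True that by (simp add: seminormal_op_standard[OF True]
            formal_op_cong[OF assms True, of "Suc i" "?S (Suc i) (?S i f)" "?F (Suc i) (?F i f)"] two)
      also have "\<dots> = ?F (Suc i) (?F i (?F (Suc i) f)) L" by (rule tableau.formal_op_braid[OF tab[OF True]])
      also have "\<dots> = ?S (Suc i) (?S i (?S (Suc i) f)) L"
        using True that by (simp add: seminormal_op_standard[OF True]
            formal_op_cong[OF assms True, of "Suc (Suc i)" "?S i (?S (Suc i) f)" "?F i (?F (Suc i) f)"] two)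
      finally show ?thesis .
    qed (simp add: off)
  qed
  fix j show "?S i (?S j f) = ?S j (?S i f)" if "Suc j < n" "Suc i < j"
  proof
    fix L show "?S i (?S j f) L = ?S j (?S i f) L"
      using that two[of L i j f] two[of L j i f] off
        formal_op_comm[OF tableau.filling[OF tab], of L "Suc i" "Suc j" f]
      by (cases "L \<in> n_standard_tableaux n \<mu>") auto
  qed
qed

lemma seminormal_op_in_coord_space:
  "f \<in> coord_space (n_standard_tableaux n \<mu>) \<Longrightarrow>
    seminormal_op n \<mu> i f \<in> coord_space (n_standard_tableaux n \<mu>)"
  by (simp add: coord_space_def seminormal_op_def)

lemma seminormal_op_add: "seminormal_op n \<mu> i (f + g) = seminormal_op n \<mu> i f + seminormal_op n \<mu> i g"
  by (simp add: seminormal_op_def formal_op_def fun_eq_iff algebra_simps)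

lemma seminormal_op_scale: "seminormal_op n \<mu> i (cscale c f) = cscale c (seminormal_op n \<mu> i f)"
  by (simp add: seminormal_op_def formal_op_def fun_eq_iff algebra_simps)

lemma linear_seminormal_op: "linear_map_on V (seminormal_op n \<mu> i)"
  by (simp add: linear_map_on_def seminormal_op_add seminormal_op_scale)

lemma swap_unchanged:
  assumes "L \<in> extensional (boxes \<mu>)" "i \<notin> entries \<mu> L" "Suc i \<notin> entries \<mu> L"
  shows "swap_entries \<mu> i L = L"
proof (rule extensionalityI[of _ "boxes \<mu>"])
  show "swap_entries \<mu> i L \<in> extensional (boxes \<mu>)" by (simp add: swap_entries_def)
  show "L \<in> extensional (boxes \<mu>)" by (rule assms)
  fix b assume b: "b \<in> boxes \<mu>"
  then have "L b \<noteq> i" "L b \<noteq> Suc i" using assms(2,3) unfolding entries_def by (metis imageI)+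
  then show "swap_entries \<mu> i L b = L b" using b by (simp add: swap_entries_def)
qed

text \<open>
  On basis vectors the operator is given by Young's formulas: the sign of \<open>a\<close> changes between \<open>L\<close>, where
  these evaluate it, and the exchanged tableau, where the operator does.
\<close>

lemma seminormal_op_unit_fun:
  assumes "is_partition \<mu>" "L \<in> n_standard_tableaux n \<mu>" "1 \<le> i" "Suc i \<le> n"
  shows "seminormal_op n \<mu> i (unit_fun L) = s_on_basis n \<mu> i L"
proof
  fix K
  let ?T = "n_standard_tableaux n \<mu>" and ?s = "swap_entries \<mu> i"
  interpret tableau n \<mu> L using assms by unfold_locales
  define a where "a = inverse_axial_distance \<mu> L i (Suc i)"
  have ext: "L \<in> extensional (boxes \<mu>)" using filling by (simp add: injective_filling_def)
  have std: "?s L \<in> ?T" if "a\<^sup>2 \<noteq> 1" using swap_standard[OF assms(3,4)] that by (simp add: a_def)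
  have formula: "s_on_basis n \<mu> i L =
      cscale a (unit_fun L) + cscale (1 + a) (if ?s L \<in> ?T then unit_fun (?s L) else 0)"
  proof -
    consider "i \<in> entries \<mu> L \<and> Suc i \<in> entries \<mu> L"
      | "\<not> (i \<in> entries \<mu> L \<and> Suc i \<in> entries \<mu> L)" "i \<in> entries \<mu> L \<or> Suc i \<in> entries \<mu> L"
      | "i \<notin> entries \<mu> L" "Suc i \<notin> entries \<mu> L" by blast
    then show ?thesis
    proof cases
      case 1
      then show ?thesis by (simp add: s_on_basis_def a_def inverse_axial_distance_def Let_def)
    next
      case 2
      then have "a = 0" by (auto simp: a_def inverse_axial_distance_def)
      then show ?thesis using 2 std by (auto simp: s_on_basis_def fun_eq_iff)
    next
      case 3
      then have "a = 0" by (simp add: a_def inverse_axial_distance_def)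
      then show ?thesis using 3 std swap_unchanged[OF ext 3] by (simp add: s_on_basis_def)
    qed
  qed
  show "seminormal_op n \<mu> i (unit_fun L) K = s_on_basis n \<mu> i L K"
  proof (cases "K \<in> ?T")
    case False
    then have "K \<noteq> L" "\<not> (?s L \<in> ?T \<and> K = ?s L)" using assms(2) by auto
    then show ?thesis using False
      by (auto simp: formula seminormal_op_def unit_fun_def)
  next
    case True
    then have K: "K \<in> extensional (boxes \<mu>)" by (auto simp: n_standard_tableaux_def PiE_def)
    have swap_iff: "?s K = L \<longleftrightarrow> K = ?s L" using swap_swap[OF K] swap_swap[OF ext] by metis
    have b: "inverse_axial_distance \<mu> (?s L) i (Suc i) = - a"
      using inverse_axial_distance_swap[OF filling, of i i "Suc i"]
        inverse_axial_distance_skew[of \<mu> L "Suc i" i] by (simp add: a_def)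
    have "seminormal_op n \<mu> i (unit_fun L) K =
      inverse_axial_distance \<mu> K i (Suc i) * unit_fun L K +
      off_diagonal (inverse_axial_distance \<mu> K i (Suc i)) * unit_fun L (?s K)"
      using True by (simp add: seminormal_op_def formal_op_def)
    also have "inverse_axial_distance \<mu> K i (Suc i) * unit_fun L K = a * unit_fun L K"
      by (simp add: unit_fun_def a_def)
    also have "off_diagonal (inverse_axial_distance \<mu> K i (Suc i)) * unit_fun L (?s K) =
        (1 + a) * (if ?s L \<in> ?T then unit_fun (?s L) else 0) K"
    proof (cases "K = ?s L")
      case K: True
      then have "a \<noteq> 1" using swap_not_standard[of i] True by (auto simp: a_def)
      then show ?thesis
        using True K swap_iff b by (auto simp: unit_fun_def off_diagonal_def power2_eq_1_iff)
    next
      case False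
      then show ?thesis using swap_iff by (simp add: unit_fun_def)
    qed
    finally show ?thesis by (simp add: formula)
  qed
qed

text \<open>The action of the diagonal idempotent with support \<open>D\<close>; row \<open>d\<close> of a matrix is the entry \<open>d + 1\<close>.\<close>

definition entry_restriction ::
    "nat list \<Rightarrow> nat set \<Rightarrow> ((nat \<times> nat \<Rightarrow> nat) \<Rightarrow> complex) \<Rightarrow> (nat \<times> nat \<Rightarrow> nat) \<Rightarrow> complex" where
  "entry_restriction \<mu> D f L = (if entries \<mu> L \<subseteq> Suc ` D then f L else 0)"

lemma entry_restriction_in_coord_space: "f \<in> coord_space B \<Longrightarrow> entry_restriction \<mu> D f \<in> coord_space B"
  by (simp add: coord_space_def entry_restriction_def)

lemma linear_entry_restriction: "linear_map_on V (entry_restriction \<mu> D)"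
  by (auto simp: linear_map_on_def entry_restriction_def fun_eq_iff)

lemma entry_restriction_Int:
  "entry_restriction \<mu> D (entry_restriction \<mu> E f) = entry_restriction \<mu> (D \<inter> E) f"
  by (auto simp: entry_restriction_def fun_eq_iff)

lemma Suc_image_transpose: "transpose (Suc i) (Suc (Suc i)) ` Suc ` D = Suc ` adj_transp i ` D"
  by (auto simp: adj_transp_def transpose_def image_iff) 

lemma seminormal_op_entry_restriction:
  assumes "f \<in> coord_space (n_standard_tableaux n \<mu>)"
  shows "seminormal_op n \<mu> (Suc i) (entry_restriction \<mu> D f) =
    entry_restriction \<mu> (adj_transp i ` D) (seminormal_op n \<mu> (Suc i) f)"
proof
  fix L
  let ?t = "transpose (Suc i) (Suc (Suc i))"
  have sub: "?t ` E \<subseteq> Suc ` D \<longleftrightarrow> E \<subseteq> Suc ` adj_transp i ` D" for E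
  proof -
    have "?t ` E \<subseteq> Suc ` D \<longleftrightarrow> ?t ` ?t ` E \<subseteq> ?t ` Suc ` D"
      by (rule inj_image_subset_iff[symmetric]) (metis injI transpose_involutory)
    moreover have "?t ` ?t ` E = E" by (simp add: image_image)
    ultimately show ?thesis by (simp only: Suc_image_transpose)
  qed
  have same: "?t ` entries \<mu> L = entries \<mu> L"
    if "inverse_axial_distance \<mu> L (Suc i) (Suc (Suc i)) \<noteq> 0"
  proof -
    have "Suc i \<in> entries \<mu> L" "Suc (Suc i) \<in> entries \<mu> L"
      using that by (auto simp: inverse_axial_distance_def split: if_splits)
    then show ?thesis by simp
  qed
  show "seminormal_op n \<mu> (Suc i) (entry_restriction \<mu> D f) L =
    entry_restriction \<mu> (adj_transp i ` D) (seminormal_op n \<mu> (Suc i) f) L"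
  proof (cases "L \<in> n_standard_tableaux n \<mu>")
    case True
    have "inverse_axial_distance \<mu> L (Suc i) (Suc (Suc i)) * entry_restriction \<mu> D f L =
      (if entries \<mu> L \<subseteq> Suc ` adj_transp i ` D
       then inverse_axial_distance \<mu> L (Suc i) (Suc (Suc i)) * f L else 0)"
      using same sub[of "entries \<mu> L"] by (cases "inverse_axial_distance \<mu> L (Suc i) (Suc (Suc i)) = 0") (auto simp: entry_restriction_def)
    moreover have "entry_restriction \<mu> D f (swap_entries \<mu> (Suc i) L) =
      (if entries \<mu> L \<subseteq> Suc ` adj_transp i ` D then f (swap_entries \<mu> (Suc i) L) else 0)"
      using sub[of "entries \<mu> L"] by (simp add: entry_restriction_def entries_swap)
    ultimately show ?thesis
      using True by (simp add: seminormal_op_def formal_op_def) (simp add: entry_restriction_def seminormal_op_def formal_op_def)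
  next
    case False
    then have "f L = 0" using assms by (simp add: coord_space_def)
    then show ?thesis using False by (simp add: seminormal_op_def entry_restriction_def)
  qed
qed

lemma seminormal_op_absent:
  assumes f: "f \<in> coord_space (n_standard_tableaux n \<mu>)" "entry_restriction \<mu> D f = f"
    and "i \<notin> D" "Suc i \<notin> D"
  shows "seminormal_op n \<mu> (Suc i) f = f"
proof
  fix L
  have zero: "f K = 0" if "\<not> entries \<mu> K \<subseteq> Suc ` D" for K
    using fun_cong[OF f(2), of K] that by (simp add: entry_restriction_def)
  show "seminormal_op n \<mu> (Suc i) f L = f L"
  proof (cases "L \<in> n_standard_tableaux n \<mu> \<and> (Suc i \<in> entries \<mu> L \<or> Suc (Suc i) \<in> entries \<mu> L)")
    case True
    then have "\<not> entries \<mu> L \<subseteq> Suc ` D" "\<not> entries \<mu> (swap_entries \<mu> (Suc i) L) \<subseteq> Suc ` D"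
      using assms(3,4) by (auto simp: entries_swap)
    then show ?thesis using zero by (simp add: seminormal_op_def formal_op_def)
  next
    case False
    then show ?thesis
      using swap_unchanged[of L \<mu> "Suc i"]
      by (auto simp: seminormal_op_def formal_op_def off_diagonal_def inverse_axial_distance_def
          n_standard_tableaux_def PiE_def)
  qed
qed

lemma entries_subset: "L \<in> n_standard_tableaux n \<mu> \<Longrightarrow> entries \<mu> L \<subseteq> {1..n}"
  by (auto simp: entries_def n_standard_tableaux_def PiE_iff)

lemma entry_restriction_P1:
  assumes "L \<in> n_standard_tableaux n \<mu>"
  shows "entry_restriction \<mu> ({..<n} - {0}) (unit_fun L) = P1_on_basis \<mu> L"
proof
  fix K
  have "Suc ` ({..<n} - {0}) = {1..n} - {1}" by (simp add: image_set_diff image_Suc_lessThan)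
  then have "entries \<mu> L \<subseteq> Suc ` ({..<n} - {0}) \<longleftrightarrow> 1 \<notin> entries \<mu> L"
    using entries_subset[OF assms] by auto
  then show "entry_restriction \<mu> ({..<n} - {0}) (unit_fun L) K = P1_on_basis \<mu> L K"
    by (auto simp: entry_restriction_def P1_on_basis_def unit_fun_def)
qed

section \<open>Existence of the seminormal representation\<close>

text \<open>
  A rook matrix is a permutation \<open>\<sigma>\<close> restricted to a set \<open>D\<close> of columns, and it acts by first
  killing the tableaux with an entry outside \<open>D\<close> and then applying \<open>\<sigma>\<close>. This does not depend on the
  choice of \<open>\<sigma>\<close>, because a permutation that fixes \<open>D\<close> pointwise is a product of transpositions of
  points outside \<open>D\<close>, and these act trivially on tableaux with entries in \<open>D\<close>.
\<close>

theorem seminormal_rep_exists: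
  assumes "is_partition \<mu>"
  shows "\<exists>V. is_seminormal_rep n \<mu> V"
proof -
  let ?T = "n_standard_tableaux n \<mu>" and ?N = "{..<n}"
  let ?e = "entry_restriction \<mu>"
  interpret coxeter_operators n "\<lambda>i. seminormal_op n \<mu> (Suc i)" by (rule seminormal_coxeter[OF assms])
  obtain \<rho> where \<rho>_id: "\<rho> id = id"
    and \<rho>_adj: "\<And>i \<sigma>. Suc i < n \<Longrightarrow> \<sigma> permutes ?N \<Longrightarrow> \<rho> (adj_transp i \<circ> \<sigma>) = seminormal_op n \<mu> (Suc i) \<circ> \<rho> \<sigma>"
    and \<rho>_comp: "\<And>\<sigma> \<tau>. \<sigma> permutes ?N \<Longrightarrow> \<tau> permutes ?N \<Longrightarrow> \<rho> (\<sigma> \<circ> \<tau>) = \<rho> \<sigma> \<circ> \<rho> \<tau>"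
    by (rule presentation, rule that)
  have \<rho>_gen: "\<rho> (adj_transp i) = seminormal_op n \<mu> (Suc i)" if "Suc i < n" for i
    using \<rho>_adj[OF that permutes_id] \<rho>_id by simp
  define R where "R = (\<lambda>\<sigma>. (\<forall>f\<in>coord_space ?T. \<rho> \<sigma> f \<in> coord_space ?T) \<and> (\<forall>f g. \<rho> \<sigma> (f + g) = \<rho> \<sigma> f + \<rho> \<sigma> g) \<and>
     (\<forall>c f. \<rho> \<sigma> (cscale c f) = cscale c (\<rho> \<sigma> f)) \<and>
     (\<forall>D. \<forall>f\<in>coord_space ?T. \<rho> \<sigma> (?e D f) = ?e (\<sigma> ` D) (\<rho> \<sigma> f)))"
  have R: "R \<sigma>" if "\<sigma> permutes ?N" for \<sigma>
    using that
  proof (induction rule: permutes_adjacent_induct)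
    case id
    show ?case unfolding R_def \<rho>_id by simp
  next
    case (adj i \<sigma>)
    have comp: "\<rho> (adj_transp i \<circ> \<sigma>) f = seminormal_op n \<mu> (Suc i) (\<rho> \<sigma> f)" for f
      by (simp only: \<rho>_adj[OF adj(1,2)] comp_apply)
    have "R \<sigma>" by (rule adj)
    then have r: "\<And>f. f \<in> coord_space ?T \<Longrightarrow> \<rho> \<sigma> f \<in> coord_space ?T" "\<And>f g. \<rho> \<sigma> (f + g) = \<rho> \<sigma> f + \<rho> \<sigma> g"
      "\<And>c f. \<rho> \<sigma> (cscale c f) = cscale c (\<rho> \<sigma> f)"
      "\<And>D f. f \<in> coord_space ?T \<Longrightarrow> \<rho> \<sigma> (?e D f) = ?e (\<sigma> ` D) (\<rho> \<sigma> f)"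
      unfolding R_def by blast+
    have "R (adj_transp i \<circ> \<sigma>)"
      unfolding R_def comp image_comp[symmetric]
      by (intro conjI ballI allI) (simp_all only: r seminormal_op_in_coord_space
        seminormal_op_add seminormal_op_scale seminormal_op_entry_restriction)
    then show ?case .
  qed
  have \<rho>_space: "\<rho> \<sigma> f \<in> coord_space ?T" and \<rho>_e: "\<rho> \<sigma> (?e D f) = ?e (\<sigma> ` D) (\<rho> \<sigma> f)"
    if "\<sigma> permutes ?N" "f \<in> coord_space ?T" for \<sigma> D f
    using R[OF that(1)] that(2) by (simp_all add: R_def)
  \<comment> \<open>Conjugation by \<open>s\<^sub>j\<close> shortens the transposition and moves \<open>D\<close> along with \<open>f\<close>.\<close>
  have transp: "\<rho> (transpose i j) f = f"
    if "i < j" "j < n" "i \<notin> D" "j \<notin> D" "f \<in> coord_space ?T" "?e D f = f" for i j D f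
    using that
  proof (induction j arbitrary: D f)
    case (Suc j)
    have j: "Suc j < n" by fact
    show ?case
    proof (cases "i = j")
      case True
      then have "\<rho> (transpose i (Suc j)) f = seminormal_op n \<mu> (Suc j) f"
        using \<rho>_gen[OF j] by (simp add: adj_transp_def)
      then show ?thesis using Suc.prems True by (simp add: seminormal_op_absent)
    next
      case False
      then have ij: "i < j" using Suc.prems by simp
      define f' where "f' = seminormal_op n \<mu> (Suc j) f"
      have f': "f' \<in> coord_space ?T" "?e (adj_transp j ` D) f' = f'"
        using Suc.prems(5,6) seminormal_op_entry_restriction[of f n \<mu> j D]
        by (simp_all add: f'_def seminormal_op_in_coord_space)
      have "i \<notin> adj_transp j ` D" "j \<notin> adj_transp j ` D"
        using Suc.prems(3,4) ij by (auto simp: adj_transp_def in_transpose_image)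
      then have IH: "\<rho> (transpose i j) f' = f'" using Suc.IH[OF ij _ _ _ f'] j by simp
      have "transpose i (Suc j) = adj_transp j \<circ> (transpose i j \<circ> adj_transp j)"
        using ij by (auto simp: adj_transp_def transpose_def fun_eq_iff)
      moreover have "transpose i j permutes ?N" using ij j by (intro permutes_swap_id) auto
      ultimately have "\<rho> (transpose i (Suc j)) f = seminormal_op n \<mu> (Suc j) (\<rho> (transpose i j) f')"
        using adj_transp_permutes[OF j] j
        by (simp add: \<rho>_comp \<rho>_gen permutes_compose f'_def)
      also have "\<dots> = f" unfolding IH unfolding f'_def by (rule invol[OF j])
      finally show ?thesis .
    qed
  qed simp
  have stab: "\<rho> \<tau> f = f"
    if "\<tau> permutes ?N" "\<And>x. x \<in> D \<Longrightarrow> \<tau> x = x" "f \<in> coord_space ?T" "?e D f = f" for \<tau> D f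
  proof -
    have "\<tau> permutes (?N - D)"
      by (rule permutes_superset[OF that(1)]) (use that(2) in auto)
    moreover have "finite (?N - D)" by simp
    ultimately have "\<tau> permutes ?N \<and> \<rho> \<tau> f = f"
    proof (induction rule: permutes_induct)
      case id
      have "id permutes ?N \<and> \<rho> id f = f" unfolding \<rho>_id by (metis permutes_id id_apply)
      then show ?case .
    next
      case (swap a b p)
      have ab: "transpose a b permutes ?N" using swap by (intro permutes_swap_id) auto
      have "\<rho> (transpose a b) f = f"
        using transp[of a b D f] transp[of b a D f] swap(1-3) that(3,4)
        by (cases "a < b") (auto simp: transpose_commute[of a b])
      moreover have p: "p permutes ?N" "\<rho> p f = f" using swap by blast+
      ultimately have "\<rho> (transpose a b \<circ> p) f = f" using \<rho>_comp[OF ab p(1)] by simp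
      then show ?case using permutes_compose[OF p(1) ab] by blast
    qed
    then show ?thesis by blast
  qed
  define act where "act = (\<lambda>A f. case (SOME (\<sigma>, D). \<sigma> permutes ?N \<and> D \<subseteq> ?N \<and> A = rook_mat n \<sigma> D)
     of (\<sigma>, D) \<Rightarrow> \<rho> \<sigma> (?e D f))"
  have act: "act (rook_mat n \<sigma> D) f = \<rho> \<sigma> (?e D f)"
    if "\<sigma> permutes ?N" "D \<subseteq> ?N" "f \<in> coord_space ?T" for \<sigma> D f
  proof -
    let ?P = "\<lambda>(\<sigma>', D'). \<sigma>' permutes ?N \<and> D' \<subseteq> ?N \<and> rook_mat n \<sigma> D = rook_mat n \<sigma>' D'"
    have "?P (\<sigma>, D)" using that by simp
    then have "?P (SOME p. ?P p)" by (rule someI)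
    moreover obtain \<sigma>' D' where eq: "(SOME p. ?P p) = (\<sigma>', D')" by (cases "SOME p. ?P p")
    ultimately have \<sigma>': "\<sigma>' permutes ?N" "D' \<subseteq> ?N" "rook_mat n \<sigma> D = rook_mat n \<sigma>' D'" by simp_all
    note same = rook_mat_eqD[OF \<sigma>'(3) that(1) \<sigma>'(1) that(2) \<sigma>'(2)]
    define \<tau> where "\<tau> = inv_into UNIV \<sigma>' \<circ> \<sigma>"
    have \<tau>: "\<tau> permutes ?N" unfolding \<tau>_def by (intro permutes_compose permutes_inv \<sigma>'(1) that(1))
    have "\<sigma> = \<sigma>' \<circ> \<tau>" using permutes_inverses(1)[OF \<sigma>'(1)] by (simp add: \<tau>_def fun_eq_iff)
    then have "\<rho> \<sigma> (?e D f) = \<rho> \<sigma>' (\<rho> \<tau> (?e D f))" using \<rho>_comp[OF \<sigma>'(1) \<tau>] by simp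
    also have "\<rho> \<tau> (?e D f) = ?e D f"
    proof (rule stab[OF \<tau>])
      show "\<tau> x = x" if "x \<in> D" for x
        using same(2)[OF that] permutes_inverses(2)[OF \<sigma>'(1)] by (simp add: \<tau>_def)
    qed (use that in \<open>simp_all add: entry_restriction_in_coord_space entry_restriction_Int\<close>)
    finally show ?thesis using same(1) eq by (simp add: act_def)
  qed
  define V where "V = \<lparr>rep_space = coord_space ?T, rep_act = act\<rparr>"
  have space: "rep_space V = coord_space ?T" and actV: "rep_act V = act" by (simp_all add: V_def)
  have "representation (rook_monoid n) V"
    unfolding representation_def space actV
  proof (intro conjI ballI)
    show "fvs.subspace (coord_space ?T)" by (rule subspace_coord_space)
  next
    fix A assume "A \<in> carrier (rook_monoid n)"
    then obtain \<sigma> D where A: "\<sigma> permutes ?N" "D \<subseteq> ?N" "A = rook_mat n \<sigma> D"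
      by (rule rook_monoid_elementE)
    note actA = act[OF A(1,2), folded A(3)]
    show "act A f \<in> coord_space ?T" if "f \<in> coord_space ?T" for f
      using that by (simp add: actA \<rho>_space A(1) entry_restriction_in_coord_space)
    have e_add: "?e D (f + g) = ?e D f + ?e D g" and e_scale: "?e D (cscale c f) = cscale c (?e D f)" for f g c
      using linear_entry_restriction[of UNIV \<mu> D] by (simp_all add: linear_map_on_def)
    have "act A (f + g) = act A f + act A g" if "f \<in> coord_space ?T" "g \<in> coord_space ?T" for f g
      using R[OF A(1)] unfolding actA[OF that(1)] actA[OF that(2)]
        actA[OF fvs.subspace_add[OF subspace_coord_space that]] e_add R_def by blast
    moreover have "act A (cscale c f) = cscale c (act A f)" if "f \<in> coord_space ?T" for c f
      using R[OF A(1)] unfolding actA[OF that]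
        actA[OF fvs.subspace_scale[OF subspace_coord_space that]] e_scale R_def by blast
    ultimately show "linear_map_on (coord_space ?T) (act A)" unfolding linear_map_on_def by blast
    fix B assume "B \<in> carrier (rook_monoid n)"
    then obtain \<tau> E where B: "\<tau> permutes ?N" "E \<subseteq> ?N" "B = rook_mat n \<tau> E"
      by (rule rook_monoid_elementE)
    fix f assume f: "f \<in> coord_space ?T"
    have img: "\<tau> ` {b \<in> E. \<tau> b \<in> D} = D \<inter> \<tau> ` E" by auto
    have "act (A \<otimes>\<^bsub>rook_monoid n\<^esub> B) f = act (rook_mat n (\<sigma> \<circ> \<tau>) {b \<in> E. \<tau> b \<in> D}) f"
      by (simp add: A(3) B(3) rook_mat_mult[OF B(1)])
    also have "\<dots> = \<rho> (\<sigma> \<circ> \<tau>) (?e {b \<in> E. \<tau> b \<in> D} f)"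
      using B(2) by (intro act permutes_compose A(1) B(1) f) auto
    also have "\<dots> = \<rho> \<sigma> (?e (D \<inter> \<tau> ` E) (\<rho> \<tau> f))"
      using \<rho>_comp[OF A(1) B(1)] \<rho>_e[OF B(1) f] img by simp
    also have "\<dots> = \<rho> \<sigma> (?e D (\<rho> \<tau> (?e E f)))"
      using \<rho>_e[OF B(1) f] by (simp add: entry_restriction_Int)
    also have "\<dots> = act A (act B f)"
      using act[OF B(1,2) f] actA[OF \<rho>_space[OF B(1) entry_restriction_in_coord_space[OF f]]]
      by (simp add: B(3))
    finally show "act (A \<otimes>\<^bsub>rook_monoid n\<^esub> B) f = act A (act B f)" .
  next
    fix f assume f: "f \<in> coord_space ?T"
    have "?e ?N f = f"
    proof
      fix L
      have "entries \<mu> L \<subseteq> Suc ` ?N" if "L \<in> ?T"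
        using entries_subset[OF that] by (simp add: image_Suc_lessThan)
      then show "?e ?N f L = f L" using f by (auto simp: entry_restriction_def coord_space_def)
    qed
    then show "act \<one>\<^bsub>rook_monoid n\<^esub> f = f"
      using act[OF permutes_id _ f, of ?N] by (simp add: rook_monoid_one \<rho>_id)
  qed
  moreover have e_all: "?e ?N f = f" if f: "f \<in> coord_space ?T" for f
    using calculation f act[OF permutes_id subset_refl f] \<rho>_id
    unfolding representation_def space actV rook_monoid_one by simp
  moreover have "act (rook_s n i) (unit_fun L) = s_on_basis n \<mu> i L" if i: "i \<in> {1..<n}" and L: "L \<in> ?T" for i L
  proof -
    obtain j where j: "i = Suc j" using i by (cases i) auto
    have u: "unit_fun L \<in> coord_space ?T" by (rule unit_fun_in_coord_space[OF L])
    have "act (rook_s n i) (unit_fun L) = seminormal_op n \<mu> i (unit_fun L)"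
      using i j act[OF adj_transp_permutes subset_refl u, of j] e_all[OF u]
      by (simp add: rook_s_eq \<rho>_gen)
    then show ?thesis using seminormal_op_unit_fun[OF assms L, of i] i by simp
  qed
  moreover have "act (rook_P1 n) (unit_fun L) = P1_on_basis \<mu> L" if L: "L \<in> ?T" for L
  proof -
    have u: "unit_fun L \<in> coord_space ?T" by (rule unit_fun_in_coord_space[OF L])
    have "act (rook_P1 n) (unit_fun L) = ?e (?N - {0}) (unit_fun L)"
      using act[OF permutes_id _ u, of "?N - {0}"] by (auto simp: rook_P1_eq \<rho>_id)
    also have "\<dots> = P1_on_basis \<mu> L" by (rule entry_restriction_P1[OF L])
    finally show ?thesis .
  qed
  ultimately have "is_seminormal_rep n \<mu> V" unfolding is_seminormal_rep_def space actV by blast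
  then show ?thesis by blast
qed

section \<open>Standard Young tableaux: exchanges and contents\<close>

lemma card_entries: "L \<in> n_standard_tableaux n \<mu> \<Longrightarrow> card (entries \<mu> L) = sum_list \<mu>"
  by (simp add: entries_def n_standard_tableaux_def card_image card_boxes)

lemma standard_young_tableaux_eq:
  assumes "sum_list \<mu> \<le> n"
  shows "standard_young_tableaux \<mu> = {L \<in> n_standard_tableaux n \<mu>. entries \<mu> L = {1..sum_list \<mu>}}"
  using assms
  by (fastforce simp: standard_young_tableaux_def n_standard_tableaux_def entries_def bij_betw_def PiE_iff)

lemma standard_young_tableaux_iff:
  assumes "sum_list \<mu> \<le> n" "L \<in> n_standard_tableaux n \<mu>"
  shows "L \<in> standard_young_tableaux \<mu> \<longleftrightarrow> entries \<mu> L \<subseteq> {1..sum_list \<mu>}"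
  using assms card_entries[OF assms(2)] card_subset_eq[of "{1..sum_list \<mu>}" "entries \<mu> L"]
  by (auto simp: standard_young_tableaux_eq[OF assms(1)])

lemma standard_young_tableau: 
  "is_partition \<mu> \<Longrightarrow> L \<in> standard_young_tableaux \<mu> \<Longrightarrow> tableau (sum_list \<mu>) \<mu> L"
  by (simp add: tableau_def standard_young_tableaux_eq[OF order_refl])

text \<open>
  The box of the entry \<open>p\<close> is determined by its diagonal and the smaller entries: if \<open>p\<close> sat further
  down the diagonal in one tableau than in the other, the box of \<open>p\<close> in the latter would contain
  a smaller entry in the former, whose box both tableaux share.
\<close>

lemma contents_determine_tableau:
  assumes "is_partition \<mu>" and L: "L \<in> standard_young_tableaux \<mu>" and K: "K \<in> standard_young_tableaux \<mu>"
    and eq: "\<And>p. p \<in> {1..sum_list \<mu>} \<Longrightarrow> content (box_of \<mu> L p) = content (box_of \<mu> K p)"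
  shows "L = K"
proof -
  interpret L: tableau "sum_list \<mu>" \<mu> L by (rule standard_young_tableau[OF assms(1) L])
  interpret K: tableau "sum_list \<mu>" \<mu> K by (rule standard_young_tableau[OF assms(1) K])
  have ent: "entries \<mu> L = {1..sum_list \<mu>}" "entries \<mu> K = {1..sum_list \<mu>}"
    using L K by (simp_all add: standard_young_tableaux_eq[OF order_refl])
  have boxes: "box_of \<mu> L p = box_of \<mu> K p" if "p \<in> {1..sum_list \<mu>}" for p
    using that
  proof (induction p rule: less_induct)
    case (less p)
    obtain x y where l: "(x, y) \<in> boxes \<mu>" "L (x, y) = p" "box_of \<mu> L p = (x, y)"
      using L.entriesE[of p] less.prems ent by blast
    obtain x' y' where k: "(x', y') \<in> boxes \<mu>" "K (x', y') = p" "box_of \<mu> K p = (x', y')"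
      using K.entriesE[of p] less.prems ent by blast
    have diag: "int y - int x = int y' - int x'"
      using eq[OF less.prems] l(3) k(3) by (simp add: content_def)
    have "\<not> x < x'"
    proof
      assume "x < x'"
      then have "K (x, y) < p" using K.box_strict_mono[OF k(1), of x y] diag k(2) by auto
      moreover have "K (x, y) \<in> entries \<mu> K" using l(1) by (simp add: entries_def)
      ultimately have "box_of \<mu> L (K (x, y)) = box_of \<mu> K (K (x, y))" "K (x, y) \<in> entries \<mu> L"
        using less.IH ent by auto
      then have "L (x, y) = K (x, y)"
        using box_of_eq[OF K.filling l(1)] box_of_in_boxes(2)[OF L.filling] by metis
      then show False using \<open>K (x, y) < p\<close> l(2) by simp
    qed
    moreover have "\<not> x' < x"
    proof
      assume "x' < x"
      then have "L (x', y') < p" using L.box_strict_mono[OF l(1), of x' y'] diag l(2) by auto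
      moreover have "L (x', y') \<in> entries \<mu> L" using k(1) by (simp add: entries_def)
      ultimately have "box_of \<mu> L (L (x', y')) = box_of \<mu> K (L (x', y'))" "L (x', y') \<in> entries \<mu> K"
        using less.IH ent by auto
      then have "K (x', y') = L (x', y')"
        using box_of_eq[OF L.filling k(1)] box_of_in_boxes(2)[OF K.filling] by metis
      then show False using \<open>L (x', y') < p\<close> k(2) by simp
    qed
    ultimately show ?case using diag l(3) k(3) by simp
  qed
  show ?thesis
  proof (rule extensionalityI[of _ "boxes \<mu>"])
    show "L \<in> extensional (boxes \<mu>)" "K \<in> extensional (boxes \<mu>)"
      using L.filling K.filling by (simp_all add: injective_filling_def)
    fix b assume b: "b \<in> boxes \<mu>"
    then have "L b \<in> {1..sum_list \<mu>}" using ent by (auto simp: entries_def)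
    then have "box_of \<mu> K (L b) = b" "L b \<in> entries \<mu> K" using boxes box_of_eq[OF L.filling b] ent by auto
    then show "L b = K b" using box_of_in_boxes(2)[OF K.filling] by metis
  qed
qed

lemma content_entry_1:
  assumes "is_partition \<mu>" "L \<in> standard_young_tableaux \<mu>" "1 \<le> sum_list \<mu>"
  shows "content (box_of \<mu> L 1) = 0"
proof -
  interpret tableau "sum_list \<mu>" \<mu> L by (rule standard_young_tableau[OF assms(1,2)])
  have "1 \<in> entries \<mu> L" using assms(2,3) by (simp add: standard_young_tableaux_eq[OF order_refl])
  then obtain x y where b: "(x, y) \<in> boxes \<mu>" "L (x, y) = 1" "box_of \<mu> L 1 = (x, y)" by (rule entriesE)
  have "(x, y) = (0, 0)"
  proof (rule ccontr)
    assume "(x, y) \<noteq> (0, 0)"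
    then have "L (0, 0) < 1" using box_strict_mono[OF b(1), of 0 0] b(2) by auto
    moreover have "L (0, 0) \<in> entries \<mu> L"
      using boxes_down_closed[OF partition b(1), of 0 0] by (simp add: entries_def)
    ultimately show False using entry_bounds by fastforce
  qed
  then show ?thesis using b(3) by (simp add: content_def)
qed

text \<open>
  Row by row, each row from left to right: all columns are smaller than the factor of the row.
\<close>

definition reading_order :: "nat list \<Rightarrow> nat \<times> nat \<Rightarrow> nat" where
  "reading_order \<mu> b = fst b * Suc (sum_list \<mu>) + snd b"

definition reading_tableau :: "nat list \<Rightarrow> nat \<times> nat \<Rightarrow> nat" where
  "reading_tableau \<mu> =
     restrict (\<lambda>b. card {b' \<in> boxes \<mu>. reading_order \<mu> b' \<le> reading_order \<mu> b}) (boxes \<mu>)"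

lemma column_bound: "(x, y) \<in> boxes \<mu> \<Longrightarrow> y < sum_list \<mu>"
  using elem_le_sum_list[of x \<mu>] by (auto simp: boxes_def)

lemma reading_order_less_iff:
  assumes "(x, y) \<in> boxes \<mu>" "(x', y') \<in> boxes \<mu>"
  shows "reading_order \<mu> (x, y) < reading_order \<mu> (x', y') \<longleftrightarrow> x < x' \<or> x = x' \<and> y < y'"
proof -
  let ?M = "Suc (sum_list \<mu>)"
  have less: "a * ?M + c < a' * ?M + c'" if "a < a'" "c < ?M" for a a' c c'
  proof -
    have "a * ?M + c < Suc a * ?M" using that(2) by simp
    also have "\<dots> \<le> a' * ?M" using that(1) by (intro mult_le_mono1) simp
    finally show ?thesis by simp
  qed
  have "y < ?M" "y' < ?M" using column_bound[OF assms(1)] column_bound[OF assms(2)] by auto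
  then show ?thesis
    using less[of x x' y y'] less[of x' x y' y] unfolding reading_order_def fst_conv snd_conv
    by (cases x x' rule: linorder_cases) auto
qed

lemma inj_reading_order: "inj_on (reading_order \<mu>) (boxes \<mu>)"
proof (rule inj_onI)
  fix b b' assume b: "b \<in> boxes \<mu>" "b' \<in> boxes \<mu>" "reading_order \<mu> b = reading_order \<mu> b'"
  then show "b = b'"
    using reading_order_less_iff[of "fst b" "snd b" \<mu> "fst b'" "snd b'"]
      reading_order_less_iff[of "fst b'" "snd b'" \<mu> "fst b" "snd b"] by (auto simp: prod_eq_iff)
qed

lemma rank_bij_betw:
  fixes h :: "'a \<Rightarrow> nat"
  assumes "finite B" "inj_on h B"
  shows "bij_betw (\<lambda>b. card {b' \<in> B. h b' \<le> h b}) B {1..card B}"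
    and "\<And>b b'. b \<in> B \<Longrightarrow> b' \<in> B \<Longrightarrow> h b < h b' \<Longrightarrow>
      card {c \<in> B. h c \<le> h b} < card {c \<in> B. h c \<le> h b'}"
proof -
  let ?r = "\<lambda>b. card {b' \<in> B. h b' \<le> h b}"
  show mono: "?r b < ?r b'" if "b \<in> B" "b' \<in> B" "h b < h b'" for b b'
  proof (rule psubset_card_mono)
    have "b' \<in> {c \<in> B. h c \<le> h b'}" "b' \<notin> {c \<in> B. h c \<le> h b}" using that by auto
    moreover have "{c \<in> B. h c \<le> h b} \<subseteq> {c \<in> B. h c \<le> h b'}" using that(3) by auto
    ultimately show "{c \<in> B. h c \<le> h b} \<subset> {c \<in> B. h c \<le> h b'}" by blast
  qed (use assms(1) in simp)
  have inj: "inj_on ?r B"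
  proof (rule inj_onI)
    fix b b' assume b: "b \<in> B" "b' \<in> B" "?r b = ?r b'"
    then have "h b = h b'" using mono[of b b'] mono[of b' b] by (metis less_irrefl linorder_neqE_nat)
    then show "b = b'" using assms(2) b by (auto dest: inj_onD)
  qed
  have "?r b \<in> {1..card B}" if "b \<in> B" for b
  proof -
    have "{b} \<subseteq> {b' \<in> B. h b' \<le> h b}" using that by auto
    then have "1 \<le> ?r b" using assms(1) card_mono[of "{b' \<in> B. h b' \<le> h b}" "{b}"] by simp
    moreover have "?r b \<le> card B" using assms(1) by (intro card_mono) auto
    ultimately show ?thesis by simp
  qed
  then have "?r ` B \<subseteq> {1..card B}" by blast
  moreover have "card (?r ` B) = card {1..card B}" by (simp add: card_image[OF inj])
  ultimately have "?r ` B = {1..card B}" by (intro card_subset_eq) simp_all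
  then show "bij_betw ?r B {1..card B}" using inj by (simp add: bij_betw_def)
qed

lemma reading_tableau_standard:
  assumes "is_partition \<mu>"
  shows "reading_tableau \<mu> \<in> standard_young_tableaux \<mu>"
proof -
  let ?rank = "\<lambda>b. card {b' \<in> boxes \<mu>. reading_order \<mu> b' \<le> reading_order \<mu> b}"
  note rank = rank_bij_betw[OF finite_boxes inj_reading_order]
  have bij: "bij_betw (reading_tableau \<mu>) (boxes \<mu>) {1..sum_list \<mu>}"
    using rank(1)[of \<mu>] unfolding reading_tableau_def card_boxes
    by (rule bij_betw_cong[THEN iffD1, rotated]) simp
  moreover have "increasing_filling \<mu> (reading_tableau \<mu>)"
    unfolding increasing_filling_def
  proof (intro conjI allI impI)
    fix x y y' assume *: "y < y'" "(x, y') \<in> boxes \<mu>"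
    then have b: "(x, y) \<in> boxes \<mu>" using boxes_down_closed[OF assms, of x y' x y] by simp
    show "reading_tableau \<mu> (x, y) < reading_tableau \<mu> (x, y')"
      using rank(2)[OF b *(2)] reading_order_less_iff[OF b *(2)] *(1) b *(2)
      by (simp add: reading_tableau_def)
  next
    fix x x' y assume *: "x < x'" "(x', y) \<in> boxes \<mu>"
    then have b: "(x, y) \<in> boxes \<mu>" using boxes_down_closed[OF assms, of x' y x y] by simp
    show "reading_tableau \<mu> (x, y) < reading_tableau \<mu> (x', y)"
      using rank(2)[OF b *(2)] reading_order_less_iff[OF b *(2)] *(1) b *(2)
      by (simp add: reading_tableau_def)
  qed
  ultimately show ?thesis
    by (auto simp: standard_young_tableaux_def bij_betw_def PiE_iff reading_tableau_def)
qed

text \<open>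
  A standard Young tableau whose entries do not increase in reading order has an entry \<open>i\<close> that is
  read after \<open>i + 1\<close>; then \<open>i\<close> lies strictly below and to the left of \<open>i + 1\<close>, so exchanging the two
  gives a standard tableau closer to the reading tableau.
\<close>

lemma standard_young_tableau_descent:
  assumes \<mu>: "is_partition \<mu>" and L: "L \<in> standard_young_tableaux \<mu>" and ne: "L \<noteq> reading_tableau \<mu>"
  obtains i b c where "1 \<le> i" "Suc i \<le> sum_list \<mu>" "b \<in> boxes \<mu>" "c \<in> boxes \<mu>" "L b = i" "L c = Suc i"
    "reading_order \<mu> c < reading_order \<mu> b" "swap_entries \<mu> i L \<in> standard_young_tableaux \<mu>"
proof -
  let ?r = "sum_list \<mu>" and ?o = "reading_order \<mu>"
  interpret tableau ?r \<mu> L by (rule standard_young_tableau[OF \<mu> L])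
  have ent: "entries \<mu> L = {1..?r}" using L by (simp add: standard_young_tableaux_eq[OF order_refl])
  have "\<exists>i b c. 1 \<le> i \<and> Suc i \<le> ?r \<and> b \<in> boxes \<mu> \<and> c \<in> boxes \<mu> \<and> L b = i \<and> L c = Suc i \<and> ?o c < ?o b"
  proof (rule ccontr)
    assume none: "\<not> ?thesis"
    define w where "w = (\<lambda>p. ?o (box_of \<mu> L p))"
    have w_step: "w p < w (Suc p)" if "1 \<le> p" "Suc p \<le> ?r" for p
    proof -
      have p: "box_of \<mu> L p \<in> boxes \<mu>" "L (box_of \<mu> L p) = p"
        and q: "box_of \<mu> L (Suc p) \<in> boxes \<mu>" "L (box_of \<mu> L (Suc p)) = Suc p"
        using box_of_in_boxes[OF filling] that ent by auto
      then have "w p \<le> w (Suc p)" using none that unfolding w_def by (meson not_le)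
      moreover have "w p \<noteq> w (Suc p)"
      proof
        assume "w p = w (Suc p)"
        then have "box_of \<mu> L p = box_of \<mu> L (Suc p)"
          using p(1) q(1) inj_reading_order unfolding w_def inj_on_def by blast
        then show False using p(2) q(2) by simp
      qed
      ultimately show ?thesis by simp
    qed
    have w_mono: "w p < w q" if "1 \<le> p" "p < q" "q \<le> ?r" for p q
      using that(2,3)
    proof (induction q)
      case (Suc q)
      then show ?case using w_step[of q] that(1) by (cases "p = q") auto
    qed simp
    have le_iff: "?o b \<le> ?o c \<longleftrightarrow> L b \<le> L c" if "b \<in> boxes \<mu>" "c \<in> boxes \<mu>" for b c
    proof -
      have "L b \<in> {1..?r}" "L c \<in> {1..?r}" using that ent by (auto simp: entries_def)
      then have "L b < L c \<Longrightarrow> w (L b) < w (L c)" "L c < L b \<Longrightarrow> w (L c) < w (L b)"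
        using w_mono by auto
      moreover have "w (L b) = ?o b" "w (L c) = ?o c"
        by (simp_all add: w_def box_of_eq[OF filling] that)
      ultimately show ?thesis by (cases "L b" "L c" rule: linorder_cases) auto
    qed
    have "L b = reading_tableau \<mu> b" if b: "b \<in> boxes \<mu>" for b
    proof -
      have "{c \<in> boxes \<mu>. ?o c \<le> ?o b} = {c \<in> boxes \<mu>. L c \<le> L b}"
        by (rule Collect_cong, rule conj_cong, rule refl, rule le_iff[OF _ b])
      moreover have "L ` {c \<in> boxes \<mu>. L c \<le> L b} = {1..L b}"
      proof -
        have "L b \<in> entries \<mu> L" using b by (simp add: entries_def)
        then have "L b \<le> ?r" by (simp add: ent)
        moreover have "L ` {c \<in> boxes \<mu>. L c \<le> L b} = {p \<in> entries \<mu> L. p \<le> L b}"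
          unfolding entries_def by blast
        ultimately show ?thesis unfolding ent by auto
      qed
      moreover have "inj_on L {c \<in> boxes \<mu>. L c \<le> L b}"
        using filling by (auto simp: injective_filling_def intro: inj_on_subset)
      ultimately have "card {c \<in> boxes \<mu>. ?o c \<le> ?o b} = card {1..L b}" by (metis card_image)
      then show ?thesis using b by (simp add: reading_tableau_def)
    qed
    then have "L = reading_tableau \<mu>"
      using filling by (intro extensionalityI[of _ "boxes \<mu>"]) (auto simp: injective_filling_def reading_tableau_def)
    then show False using ne by contradiction
  qed
  then obtain i b c where i: "1 \<le> i" "Suc i \<le> ?r" and bc: "b \<in> boxes \<mu>" "c \<in> boxes \<mu>" "L b = i" "L c = Suc i"
    and o: "?o c < ?o b" by blast
  obtain x y where b: "b = (x, y)" by (cases b)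
  obtain x' y' where c: "c = (x', y')" by (cases c)
  have le: "x' < x \<or> x' = x \<and> y' < y" using o reading_order_less_iff bc by (simp add: b c)
  have "\<not> y' \<le> y"
  proof
    assume "y' \<le> y"
    then have "L c \<le> L b" using box_mono[of x y x' y'] bc le by (auto simp: b c)
    then show False using bc by simp
  qed
  then have "content c - content b \<ge> 2" using le by (simp add: b c content_def)
  moreover have "box_of \<mu> L i = b" "box_of \<mu> L (Suc i) = c"
    using box_of_eq[OF filling bc(1)] box_of_eq[OF filling bc(2)] bc(3,4) by simp_all
  ultimately obtain d :: int where d: "d \<ge> 2" "inverse_axial_distance \<mu> L i (Suc i) = 1 / of_int d"
    using i ent by (auto simp: inverse_axial_distance_def simp flip: of_int_diff)
  have "(inverse_axial_distance \<mu> L i (Suc i))\<^sup>2 \<noteq> 1"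
  proof
    assume "(inverse_axial_distance \<mu> L i (Suc i))\<^sup>2 = 1"
    then have "(of_int d)\<^sup>2 = (1 :: complex)" using d by (simp add: power_one_over divide_simps split: if_splits)
    then have "(of_int (d\<^sup>2) :: complex) = of_int 1" by simp
    then have "d\<^sup>2 = 1" by (simp only: of_int_eq_iff)
    then show False using d(1) by (simp add: power2_eq_1_iff)
  qed
  from swap_standard[OF i this] have "swap_entries \<mu> i L \<in> n_standard_tableaux ?r \<mu>" .
  moreover have "entries \<mu> (swap_entries \<mu> i L) = {1..?r}" using i by (simp add: entries_swap ent)
  ultimately have "swap_entries \<mu> i L \<in> standard_young_tableaux \<mu>"
    by (simp add: standard_young_tableaux_eq[OF order_refl])
  with i bc o that show thesis by blast
qed

text \<open>
  Each exchange of a descent carries the larger entry to the box read later, which lowers the sum of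
  the complements \<open>r - L b\<close> weighted by the reading order.
\<close>

lemma standard_young_tableaux_connected:
  assumes \<mu>: "is_partition \<mu>" and L: "L \<in> standard_young_tableaux \<mu>"
    and swap: "\<And>i L. 1 \<le> i \<Longrightarrow> Suc i \<le> sum_list \<mu> \<Longrightarrow> L \<in> standard_young_tableaux \<mu> \<Longrightarrow>
      swap_entries \<mu> i L \<in> standard_young_tableaux \<mu> \<Longrightarrow> P L \<longleftrightarrow> P (swap_entries \<mu> i L)"
  shows "P L \<longleftrightarrow> P (reading_tableau \<mu>)"
  using L
proof (induction "\<Sum>b\<in>boxes \<mu>. (sum_list \<mu> - L b) * reading_order \<mu> b" arbitrary: L rule: less_induct)
  case less
  let ?o = "reading_order \<mu>" and ?r = "sum_list \<mu>"
  show ?case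
  proof (cases "L = reading_tableau \<mu>")
    case False
    then obtain i b c where i: "1 \<le> i" "Suc i \<le> ?r" and bc: "b \<in> boxes \<mu>" "c \<in> boxes \<mu>" "L b = i" "L c = Suc i"
      and o: "?o c < ?o b" and L': "swap_entries \<mu> i L \<in> standard_young_tableaux \<mu>"
      using standard_young_tableau_descent[OF \<mu> less.prems] by metis
    let ?L' = "swap_entries \<mu> i L"
    have inj: "inj_on L (boxes \<mu>)" using less.prems by (simp add: standard_young_tableaux_def bij_betw_def)
    have split: "(\<Sum>d\<in>boxes \<mu>. (?r - K d) * ?o d) =
      (\<Sum>d\<in>boxes \<mu> - {b, c}. (?r - K d) * ?o d) + ((?r - K b) * ?o b + (?r - K c) * ?o c)" for K
    proof -
      have "(\<Sum>d\<in>{b, c}. (?r - K d) * ?o d) = (?r - K b) * ?o b + (?r - K c) * ?o c"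
        using o by (cases "b = c") auto
      moreover have sub: "{b, c} \<subseteq> boxes \<mu>" using bc by simp
      ultimately show ?thesis by (simp only: sum.subset_diff[OF sub finite_boxes])
    qed
    have "(\<Sum>d\<in>boxes \<mu> - {b, c}. (?r - ?L' d) * ?o d) = (\<Sum>d\<in>boxes \<mu> - {b, c}. (?r - L d) * ?o d)"
    proof (rule sum.cong[OF refl])
      fix d assume d: "d \<in> boxes \<mu> - {b, c}"
      then have "L d \<noteq> L b" "L d \<noteq> L c"
        using inj_onD[OF inj, of d b] inj_onD[OF inj, of d c] bc(1,2) by auto
      then have "L d \<noteq> i" "L d \<noteq> Suc i" using bc(3,4) by simp_all
      then show "(?r - ?L' d) * ?o d = (?r - L d) * ?o d" using d by (simp add: swap_entries_def)
    qed
    moreover have "(?r - ?L' b) * ?o b + (?r - ?L' c) * ?o c < (?r - L b) * ?o b + (?r - L c) * ?o c"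
    proof -
      obtain m where m: "?r = Suc (i + m)" using i by (metis Suc_le_D add_Suc add_Suc_right le_Suc_ex)
      show ?thesis using bc o by (simp add: swap_entries_def m Suc_diff_le)
    qed
    ultimately have "(\<Sum>d\<in>boxes \<mu>. (?r - ?L' d) * ?o d) < (\<Sum>d\<in>boxes \<mu>. (?r - L d) * ?o d)"
      unfolding split[of ?L'] split[of L] by simp
    from less.hyps[OF this L'] show ?thesis using swap[OF i less.prems L'] by simp
  qed simp
qed

text \<open>
  Exchanges also fill the gaps between the entries of an \<open>n\<close>-standard tableau: replacing an entry
  \<open>i + 1\<close> by an absent \<open>i\<close> lowers the sum of the entries.
\<close>

lemma n_standard_tableaux_connected:
  assumes \<mu>: "is_partition \<mu>" and n: "sum_list \<mu> \<le> n" and L: "L \<in> n_standard_tableaux n \<mu>"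
    and swap: "\<And>i L. 1 \<le> i \<Longrightarrow> Suc i \<le> n \<Longrightarrow> L \<in> n_standard_tableaux n \<mu> \<Longrightarrow>
      swap_entries \<mu> i L \<in> n_standard_tableaux n \<mu> \<Longrightarrow> P L \<longleftrightarrow> P (swap_entries \<mu> i L)"
  shows "P L \<longleftrightarrow> P (reading_tableau \<mu>)"
  using L
proof (induction "\<Sum>b\<in>boxes \<mu>. L b" arbitrary: L rule: less_induct)
  case less
  let ?r = "sum_list \<mu>"
  interpret tableau n \<mu> L using \<mu> less.prems by (simp add: tableau_def)
  show ?case
  proof (cases "entries \<mu> L \<subseteq> {1..?r}")
    case True
    then have "L \<in> standard_young_tableaux \<mu>" using standard_young_tableaux_iff[OF n less.prems] by simp
    from \<mu> this show ?thesis
      by (rule standard_young_tableaux_connected)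
        (use swap n in \<open>auto simp: standard_young_tableaux_eq[OF n]\<close>)
  next
    case False
    then obtain q where q: "q \<in> entries \<mu> L" "?r < q" using entry_bounds by force
    have "\<not> {1..?r} \<subseteq> entries \<mu> L"
    proof
      assume "{1..?r} \<subseteq> entries \<mu> L"
      then have "{1..?r} = entries \<mu> L"
        using card_entries[OF less.prems] finite_subset[OF entries_subset[OF less.prems]]
        by (intro card_subset_eq) auto
      then have "q \<in> {1..?r}" using q(1) by simp
      then show False using q(2) by simp
    qed
    then obtain p where "p \<in> {1..?r}" "p \<notin> entries \<mu> L" by blast
    then have p: "1 \<le> p" "p \<le> ?r" "p \<notin> entries \<mu> L" by simp_all
    define m where "m = (LEAST m. p < m \<and> m \<in> entries \<mu> L)"
    have m: "p < m" "m \<in> entries \<mu> L"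
      using LeastI[of "\<lambda>m. p < m \<and> m \<in> entries \<mu> L" q] p q unfolding m_def by auto
    obtain i where i: "m = Suc i" using m(1) by (cases m) auto
    have "i \<notin> entries \<mu> L"
    proof (cases "i = p")
      case False
      then show ?thesis using m(1) i not_less_Least[of i "\<lambda>m. p < m \<and> m \<in> entries \<mu> L"]
        unfolding m_def[symmetric] by auto
    qed (use p in simp)
    have i1: "1 \<le> i" "Suc i \<le> n" using p m i entry_bounds[OF m(2)] by auto
    let ?L' = "swap_entries \<mu> i L"
    have L': "?L' \<in> n_standard_tableaux n \<mu>"
      using \<open>i \<notin> entries \<mu> L\<close> by (intro swap_standard[OF i1]) (simp add: inverse_axial_distance_def)
    obtain c where c: "c \<in> boxes \<mu>" "L c = Suc i" using m(2) i by (auto simp: entries_def)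
    have "(\<Sum>b\<in>boxes \<mu>. ?L' b) < (\<Sum>b\<in>boxes \<mu>. L b)"
    proof (rule sum_strict_mono_ex1[OF finite_boxes])
      show "\<forall>b\<in>boxes \<mu>. ?L' b \<le> L b"
      proof
        fix b assume b: "b \<in> boxes \<mu>"
        then have "L b \<noteq> i" using \<open>i \<notin> entries \<mu> L\<close> unfolding entries_def by (metis imageI)
        then show "?L' b \<le> L b" using b by (auto simp: swap_entries_def transpose_def)
      qed
      show "\<exists>b\<in>boxes \<mu>. ?L' b < L b" using c by (intro bexI[of _ c]) (simp_all add: swap_entries_def)
    qed
    from less.hyps[OF this L'] show ?thesis using swap[OF i1 less.prems L'] by simp
  qed
qed

section \<open>Irreducibility of the seminormal representation\<close>

lemma linear_map_on_eqI:
  assumes "finite B" "linear_map_on (coord_space B) \<phi>" "linear_map_on (coord_space B) \<psi>"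
    and "\<And>b. b \<in> B \<Longrightarrow> \<phi> (unit_fun b) = \<psi> (unit_fun b)" and "f \<in> coord_space B"
  shows "\<phi> f = \<psi> f"
  unfolding linear_map_on_expansion[OF assms(1,2,5)] linear_map_on_expansion[OF assms(1,3,5)]
  using assms(4) by (intro sum.cong) simp_all

lemma unit_fun_nonzero: "unit_fun b \<noteq> 0"
proof
  assume "unit_fun b = 0"
  from fun_cong[OF this, of b] show False by (simp add: unit_fun_def)
qed

text \<open>
  The representation is given by the formulas for the generators only; the action of the elements
  used below is derived from them.
\<close>

locale seminormal_module =
  fixes n :: nat and \<mu> :: "nat list" and V :: "(complex mat, nat \<times> nat \<Rightarrow> nat) rep"
  assumes partition: "is_partition \<mu>" and size: "sum_list \<mu> \<le> n"
    and seminormal: "is_seminormal_rep n \<mu> V"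
begin

abbreviation "T \<equiv> n_standard_tableaux n \<mu>"
abbreviation "S \<equiv> standard_young_tableaux \<mu>"
abbreviation "R \<equiv> rook_mat n"
abbreviation "act \<equiv> rep_act V"

lemma rep: "representation (rook_monoid n) V" and space: "rep_space V = coord_space T"
  using seminormal by (simp_all add: is_seminormal_rep_def)

lemma S_eq: "S = {L \<in> T. entries \<mu> L = {1..sum_list \<mu>}}"
  by (rule standard_young_tableaux_eq[OF size])

lemma act_linear: "\<sigma> permutes {..<n} \<Longrightarrow> linear_map_on (coord_space T) (act (R \<sigma> D))"
  using representationD(2)[OF rep] by (simp add: rook_mat_in_carrier space)

lemma act_space: "\<sigma> permutes {..<n} \<Longrightarrow> f \<in> coord_space T \<Longrightarrow> act (R \<sigma> D) f \<in> coord_space T"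
  using representationD(3)[OF rep] by (simp add: rook_mat_in_carrier space)

lemma act_mult:
  assumes "\<sigma> permutes {..<n}" "\<tau> permutes {..<n}" "f \<in> coord_space T"
  shows "act (R \<sigma> D) (act (R \<tau> E) f) = act (R (\<sigma> \<circ> \<tau>) {b \<in> E. \<tau> b \<in> D}) f"
  using representationD(5)[OF rep, of "R \<sigma> D" "R \<tau> E" f] assms
  by (simp add: rook_mat_in_carrier rook_mat_mult space)

lemma act_perm_mult:
  assumes "\<sigma> permutes {..<n}" "\<tau> permutes {..<n}" "f \<in> coord_space T"
  shows "act (R \<sigma> {..<n}) (act (R \<tau> {..<n}) f) = act (R (\<sigma> \<circ> \<tau>) {..<n}) f"
proof -
  have "\<tau> b < n" if "b < n" for b using that permutes_in_image[OF assms(2), of b] by simp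
  then have "{b \<in> {..<n}. \<tau> b \<in> {..<n}} = {..<n}" by auto
  then show ?thesis using act_mult[OF assms, of "{..<n}" "{..<n}"] by simp
qed

lemma act_one: "f \<in> coord_space T \<Longrightarrow> act (R id {..<n}) f = f"
  using representationD(4)[OF rep] by (simp add: rook_monoid_one space)

lemma act_adj:
  assumes "Suc i < n" "f \<in> coord_space T"
  shows "act (R (adj_transp i) {..<n}) f = seminormal_op n \<mu> (Suc i) f"
proof (rule linear_map_on_eqI[OF finite_n_standard_tableaux act_linear linear_seminormal_op _ assms(2)])
  show "adj_transp i permutes {..<n}" by (rule adj_transp_permutes[OF assms(1)])
  fix L assume L: "L \<in> T"
  have "Suc i \<in> {1..<n}" using assms(1) by simp
  then have "act (rook_s n (Suc i)) (unit_fun L) = s_on_basis n \<mu> (Suc i) L"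
    using seminormal L unfolding is_seminormal_rep_def by blast
  also have "\<dots> = seminormal_op n \<mu> (Suc i) (unit_fun L)"
    using assms(1) by (intro seminormal_op_unit_fun[OF partition L, symmetric]) auto
  finally show "act (R (adj_transp i) {..<n}) (unit_fun L) = seminormal_op n \<mu> (Suc i) (unit_fun L)"
    by (simp add: rook_s_eq[OF assms(1)])
qed

text \<open>
  The idempotents that remove one column are conjugate to \<open>P\<^sub>1\<close> under the adjacent transpositions, and
  conjugation permutes the sets of admitted entries accordingly.
\<close>

lemma act_remove:
  assumes "j < n" "f \<in> coord_space T"
  shows "act (R id ({..<n} - {j})) f = entry_restriction \<mu> ({..<n} - {j}) f"
  using assms
proof (induction j arbitrary: f)
  case 0
  have P1: "act (rook_P1 n) (unit_fun L) = P1_on_basis \<mu> L" if "L \<in> T" for L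
    using seminormal that unfolding is_seminormal_rep_def by blast
  show ?case
  proof (rule linear_map_on_eqI[OF finite_n_standard_tableaux act_linear linear_entry_restriction _ 0(2)])
    show "id permutes {..<n}" by (rule permutes_id)
    fix L assume "L \<in> T"
    then show "act (R id ({..<n} - {0})) (unit_fun L) = entry_restriction \<mu> ({..<n} - {0}) (unit_fun L)"
      using P1 by (simp add: rook_P1_eq[symmetric] entry_restriction_P1)
  qed
next
  case (Suc j)
  let ?a = "adj_transp j" and ?N = "{..<n}"
  have j: "Suc j < n" "j < n" using Suc.prems by auto
  have a: "?a permutes ?N" by (rule adj_transp_permutes[OF j(1)])
  let ?g = "seminormal_op n \<mu> (Suc j)"
  have g: "?g f \<in> coord_space T" by (rule seminormal_op_in_coord_space[OF Suc.prems(2)])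
  have aa: "?a \<circ> (id \<circ> ?a) = id" by (simp add: fun_eq_iff)
  have "act (R ?a ?N) (act (R id (?N - {j})) (act (R ?a ?N) f)) =
      act (R (?a \<circ> (id \<circ> ?a)) {b \<in> {b \<in> ?N. ?a b \<in> ?N - {j}}. (id \<circ> ?a) b \<in> ?N}) f"
    unfolding act_mult[OF permutes_id a Suc.prems(2)]
    by (rule act_mult[OF a permutes_compose[OF a permutes_id] Suc.prems(2)])
  also have "R (?a \<circ> (id \<circ> ?a)) {b \<in> {b \<in> ?N. ?a b \<in> ?N - {j}}. (id \<circ> ?a) b \<in> ?N} = R id (?N - {Suc j})"
    unfolding aa using j
    by (intro rook_mat_cong) (auto simp: adj_transp_def transpose_def split: if_splits)
  also have "act (R ?a ?N) (act (R id (?N - {j})) (act (R ?a ?N) f)) =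
      ?g (entry_restriction \<mu> (?N - {j}) (?g f))"
    by (simp only: Suc.IH[OF j(2) g] act_adj[OF j(1) Suc.prems(2)]
        act_adj[OF j(1) entry_restriction_in_coord_space[OF g]])
  also have "\<dots> = entry_restriction \<mu> (?a ` (?N - {j})) (?g (?g f))"
    by (rule seminormal_op_entry_restriction[OF g])
  also have "?a ` (?N - {j}) = ?N - {Suc j}"
  proof -
    have "?a ` (?N - {j}) = ?a ` ?N - {?a j}" using permutes_inj[OF a] by (simp add: image_set_diff)
    also have "\<dots> = ?N - {Suc j}" using permutes_image[OF a] by (simp add: adj_transp_def)
    finally show ?thesis .
  qed
  also have "?g (?g f) = f"
    using coxeter_operators.invol[OF seminormal_coxeter[OF partition] j(1)] .
  finally show ?case by (rule sym)
qed

lemma act_idempotent: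
  assumes "D \<subseteq> {..<n}" "f \<in> coord_space T"
  shows "act (R id D) f = entry_restriction \<mu> D f"
proof -
  let ?N = "{..<n}"
  have "finite (?N - D)" by simp
  then have "?N - D \<subseteq> ?N \<longrightarrow> act (R id (?N - (?N - D))) f = entry_restriction \<mu> (?N - (?N - D)) f"
  proof (induction rule: finite_induct)
    case empty
    have "entry_restriction \<mu> ?N f = f"
    proof
      fix L
      have "entries \<mu> L \<subseteq> Suc ` ?N" if "L \<in> T"
        using entries_subset[OF that] by (simp add: image_Suc_lessThan)
      then show "entry_restriction \<mu> ?N f L = f L"
        using assms(2) by (auto simp: entry_restriction_def coord_space_def)
    qed
    then have "act (R id (?N - {})) f = entry_restriction \<mu> (?N - {}) f"
      using act_one[OF assms(2)] by (simp only: Diff_empty)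
    then show ?case by blast
  next
    case (insert j E)
    show ?case
    proof
      assume sub: "insert j E \<subseteq> ?N"
      have "act (R id (?N - insert j E)) f = act (R id (?N - {j})) (act (R id (?N - E)) f)"
        unfolding act_mult[OF permutes_id permutes_id assms(2)]
        by (rule arg_cong[of _ _ "\<lambda>A. act A f"], rule rook_mat_cong) auto
      also have "act (R id (?N - E)) f = entry_restriction \<mu> (?N - E) f" using insert.IH sub by blast
      also have "act (R id (?N - {j})) (entry_restriction \<mu> (?N - E) f) =
          entry_restriction \<mu> (?N - {j}) (entry_restriction \<mu> (?N - E) f)"
        using sub by (intro act_remove entry_restriction_in_coord_space assms(2)) auto
      also have "\<dots> = entry_restriction \<mu> (?N - insert j E) f"
        unfolding entry_restriction_Int by (rule arg_cong[of _ _ "\<lambda>D. entry_restriction \<mu> D f"]) auto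
      finally show "act (R id (?N - insert j E)) f = entry_restriction \<mu> (?N - insert j E) f" .
    qed
  qed
  moreover have "?N - (?N - D) = D" using assms(1) by auto
  ultimately show ?thesis by simp
qed

text \<open>
  This expresses support on the standard Young tableaux through the action of an idempotent, so that
  operators commuting with the idempotent preserve it.
\<close>

lemma coord_space_S:
  "coord_space S = {f \<in> coord_space T. entry_restriction \<mu> {..<sum_list \<mu>} f = f}"
proof (intro equalityI subsetI)
  fix f assume f: "f \<in> coord_space S"
  have "entry_restriction \<mu> {..<sum_list \<mu>} f L = f L" for L
    using f by (cases "L \<in> S") (auto simp: entry_restriction_def coord_space_def S_eq image_Suc_lessThan)
  then show "f \<in> {f \<in> coord_space T. entry_restriction \<mu> {..<sum_list \<mu>} f = f}"
    using f by (auto simp: coord_space_def S_eq)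
next
  fix f assume f: "f \<in> {f \<in> coord_space T. entry_restriction \<mu> {..<sum_list \<mu>} f = f}"
  have "f L = 0" if "L \<notin> S" for L
  proof (cases "L \<in> T")
    case True
    then have "\<not> entries \<mu> L \<subseteq> Suc ` {..<sum_list \<mu>}"
      using that standard_young_tableaux_iff[OF size True] by (simp add: image_Suc_lessThan)
    then have "entry_restriction \<mu> {..<sum_list \<mu>} f L = 0" by (simp add: entry_restriction_def)
    then show ?thesis using f by simp
  qed (use f in \<open>simp add: coord_space_def\<close>)
  then show "f \<in> coord_space S" by (simp add: coord_space_def)
qed

lemma seminormal_op_S:
  assumes "Suc i < sum_list \<mu>" "f \<in> coord_space S"
  shows "seminormal_op n \<mu> (Suc i) f \<in> coord_space S"
  using assms seminormal_op_entry_restriction[of f n \<mu> i "{..<sum_list \<mu>}"]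
    permutes_image[OF adj_transp_permutes[OF assms(1)]]
  by (simp add: coord_space_S seminormal_op_in_coord_space)

definition jucys_murphy :: "nat \<Rightarrow> ((nat \<times> nat \<Rightarrow> nat) \<Rightarrow> complex) \<Rightarrow> (nat \<times> nat \<Rightarrow> nat) \<Rightarrow> complex" where
  "jucys_murphy j f = (\<Sum>i<j. act (R (transpose i j) {..<n}) f)"

text \<open>
  Conjugation by the exchange of \<open>j\<close> and \<open>j + 1\<close> turns \<open>(i j)\<close> into \<open>(i j+1)\<close>; the remaining summand is the
  exchange itself.
\<close>

lemma jucys_murphy_Suc:
  assumes "Suc j < n" "f \<in> coord_space T"
  shows "jucys_murphy (Suc j) f = seminormal_op n \<mu> (Suc j) (jucys_murphy j (seminormal_op n \<mu> (Suc j) f))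
    + seminormal_op n \<mu> (Suc j) f"
proof -
  let ?g = "seminormal_op n \<mu> (Suc j)" and ?N = "{..<n}"
  have a: "adj_transp j permutes ?N" by (rule adj_transp_permutes[OF assms(1)])
  have g: "?g f \<in> coord_space T" by (rule seminormal_op_in_coord_space[OF assms(2)])
  have "act (R (transpose i (Suc j)) ?N) f = ?g (act (R (transpose i j) ?N) (?g f))" if "i < j" for i
  proof -
    have t: "transpose i j permutes ?N" using that assms(1) by (intro permutes_swap_id) auto
    have "transpose i (Suc j) = adj_transp j \<circ> (transpose i j \<circ> adj_transp j)"
      using that by (auto simp: adj_transp_def transpose_def fun_eq_iff)
    then show ?thesis
      by (simp only: act_perm_mult[OF a permutes_compose[OF a t] assms(2), symmetric]
          act_perm_mult[OF t a assms(2), symmetric] act_adj[OF assms] act_adj[OF assms(1) act_space[OF t g]])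
  qed
  then have "(\<Sum>i<j. act (R (transpose i (Suc j)) ?N) f) = (\<Sum>i<j. ?g (act (R (transpose i j) ?N) (?g f)))"
    by (intro sum.cong) auto
  also have "\<dots> = ?g (jucys_murphy j (?g f))"
    unfolding jucys_murphy_def using assms(1) g
    by (intro linear_map_on_sum[OF linear_seminormal_op[of "coord_space T"] subspace_coord_space, symmetric]
        act_space permutes_swap_id) auto
  finally show ?thesis
    using act_adj[OF assms] by (simp add: jucys_murphy_def adj_transp_def)
qed

text \<open>
  By the recursion, the operator of the next entry acts on the span of a tableau and its exchange
  through the contents \<open>x\<close>, \<open>y\<close> of the two entries and \<open>a = 1 / (y - x)\<close>. The off-diagonal term has the
  factor \<open>1 - a (y - x) = 0\<close>, and \<open>a\<^sup>2 x + (1 - a\<^sup>2) y + a = y\<close> remains on the diagonal.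
\<close>

lemma jucys_murphy_content:
  assumes "j < sum_list \<mu>" "f \<in> coord_space S"
  shows "jucys_murphy j f = (\<lambda>L. of_int (content (box_of \<mu> L (Suc j))) * f L)"
  using assms
proof (induction j arbitrary: f)
  case 0
  show ?case
  proof
    fix L show "jucys_murphy 0 f L = of_int (content (box_of \<mu> L (Suc 0))) * f L"
      using 0 content_entry_1[OF partition, of L]
      by (cases "L \<in> S") (auto simp: jucys_murphy_def coord_space_def)
  qed
next
  case (Suc j)
  let ?ct = "\<lambda>L p. of_int (content (box_of \<mu> L p)) :: complex"
  let ?g = "seminormal_op n \<mu> (Suc j)" and ?s = "swap_entries \<mu> (Suc j)"
  have j: "Suc j < n" using Suc.prems size by simp
  have f: "f \<in> coord_space T" and gS: "?g f \<in> coord_space S"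
    using Suc.prems(2) seminormal_op_S[OF Suc.prems] by (simp_all add: coord_space_S)
  have JM: "jucys_murphy (Suc j) f = ?g (\<lambda>L. ?ct L (Suc j) * ?g f L) + ?g f"
    unfolding jucys_murphy_Suc[OF j f] using Suc.IH[OF _ gS] Suc.prems by simp
  show ?case
  proof
    fix L show "jucys_murphy (Suc j) f L = ?ct L (Suc (Suc j)) * f L"
    proof (cases "L \<in> S")
      case True
      then have L: "L \<in> T" and ent: "entries \<mu> L = {1..sum_list \<mu>}" by (simp_all add: S_eq)
      interpret tableau n \<mu> L using partition L by unfold_locales
      define x y a where "x = ?ct L (Suc j)" and "y = ?ct L (Suc (Suc j))" and "a = 1 / (y - x)"
      have mem: "Suc j \<in> entries \<mu> L" "Suc (Suc j) \<in> entries \<mu> L" using Suc.prems ent by auto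
      have a: "inverse_axial_distance \<mu> L (Suc j) (Suc (Suc j)) = a"
        using mem by (simp add: inverse_axial_distance_def a_def x_def y_def)
      have "content (box_of \<mu> L (Suc j)) \<noteq> content (box_of \<mu> L (Suc (Suc j)))"
        using equal_content_far_apart[OF mem] by auto
      then have "x \<noteq> y" by (simp add: x_def y_def)
      then have ayx: "a * (y - x) = 1" by (simp add: a_def)
      have swap: "?s (?s L) = L" using filling swap_swap by (simp add: injective_filling_def)
      have b: "inverse_axial_distance \<mu> (?s L) (Suc j) (Suc (Suc j)) = - a"
        using inverse_axial_distance_swap[OF filling, of "Suc j" "Suc j" "Suc (Suc j)"]
          inverse_axial_distance_skew[of \<mu> L "Suc (Suc j)" "Suc j"] a by simp
      have y': "?ct (?s L) (Suc j) = y"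
        using box_of_swap[OF filling, of "Suc j" "Suc j"] mem by (simp add: y_def)
      have "?g (\<lambda>L. ?ct L (Suc j) * ?g f L) L = formal_op \<mu> (Suc j) (\<lambda>L. ?ct L (Suc j) * ?g f L) L"
        by (rule seminormal_op_standard[OF L])
      also have "\<dots> = formal_op \<mu> (Suc j) (\<lambda>L. ?ct L (Suc j) * formal_op \<mu> (Suc j) f L) L"
        using j by (intro formal_op_cong[OF partition L]) (auto simp: seminormal_op_standard)
      also have "\<dots> = a * (x * (a * f L + off_diagonal a * f (?s L)))
          + off_diagonal a * (y * (- a * f (?s L) + off_diagonal (- a) * f L))"
        unfolding formal_op_def a b swap y' x_def[symmetric] ..
      finally have "jucys_murphy (Suc j) f L = a * (x * (a * f L + off_diagonal a * f (?s L)))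
          + off_diagonal a * (y * (- a * f (?s L) + off_diagonal (- a) * f L))
          + (a * f L + off_diagonal a * f (?s L))"
        unfolding JM plus_fun_apply by (simp only: seminormal_op_standard[OF L] formal_op_def[of \<mu> _ f] a)
      also have "\<dots> = (a * (a * x) + off_diagonal a * off_diagonal (- a) * y + a) * f L
          + off_diagonal a * (1 - a * (y - x)) * f (?s L)"
        by (simp add: algebra_simps)
      also have "\<dots> = (a * (a * x) + (1 - a * a) * y + a) * f L"
        unfolding off_diagonal_mult ayx by (simp add: power2_eq_square)
      also have "a * (a * x) + (1 - a * a) * y + a = y + a * (1 - a * (y - x))"
        by (simp add: algebra_simps)
      also have "\<dots> = y" unfolding ayx by simp
      finally show ?thesis by (simp add: y_def)
    next
      case False
      then have "f L = 0" "?g f L = 0" using Suc.prems(2) gS by (auto simp: coord_space_def)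
      moreover have "(\<lambda>L. ?ct L (Suc j) * ?g f L) \<in> coord_space S" using gS by (auto simp: coord_space_def)
      then have "?g (\<lambda>L. ?ct L (Suc j) * ?g f L) \<in> coord_space S" by (rule seminormal_op_S[OF Suc.prems(1)])
      then have "?g (\<lambda>L. ?ct L (Suc j) * ?g f L) L = 0" using False by (simp add: coord_space_def)
      ultimately show ?thesis unfolding JM plus_fun_apply by simp
    qed
  qed
qed

lemma contents_separate:
  assumes "L \<in> S" "K \<in> S" "L \<noteq> K"
  obtains j where "j < sum_list \<mu>" "content (box_of \<mu> L (Suc j)) \<noteq> content (box_of \<mu> K (Suc j))"
proof -
  have "\<exists>p\<in>{1..sum_list \<mu>}. content (box_of \<mu> L p) \<noteq> content (box_of \<mu> K p)"
    using contents_determine_tableau[OF partition assms(1,2)] assms(3) by blast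
  then obtain p where "p \<in> {1..sum_list \<mu>}" "content (box_of \<mu> L p) \<noteq> content (box_of \<mu> K p)" ..
  then show thesis using that[of "p - 1"] by auto
qed

lemma invariant_act:
  assumes "invariant_subspace (rook_monoid n) V U" "\<sigma> permutes {..<n}" "f \<in> U"
  shows "act (R \<sigma> D) f \<in> U"
  using assms rook_mat_in_carrier unfolding invariant_subspace_def by blast

lemma invariant_jucys_murphy:
  assumes U: "invariant_subspace (rook_monoid n) V U" and "f \<in> U" "j < n"
  shows "jucys_murphy j f \<in> U"
  unfolding jucys_murphy_def
proof (rule fvs.subspace_sum)
  show "fvs.subspace U" using U by (simp add: invariant_subspace_def)
  show "act (R (transpose i j) {..<n}) f \<in> U" if "i \<in> {..<j}" for i
    using that assms by (intro invariant_act[OF U] permutes_swap_id) auto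
qed

text \<open>
  The Jucys-Murphy elements separate the basis vectors, so a vector of least support in an
  invariant subspace is a multiple of a basis vector.
\<close>

lemma invariant_contains_unit:
  assumes U: "invariant_subspace (rook_monoid n) V U" and f: "f \<in> U" "f \<in> coord_space S" "f \<noteq> 0"
  shows "\<exists>L\<in>S. unit_fun L \<in> U"
  using f
proof (induction "card {L. f L \<noteq> 0}" arbitrary: f rule: less_induct)
  case less
  have sub: "fvs.subspace U" using U by (simp add: invariant_subspace_def)
  obtain L where L: "f L \<noteq> 0" using less.prems(3) by (auto simp: fun_eq_iff)
  have supp: "{L. f L \<noteq> 0} \<subseteq> S" using less.prems(2) by (auto simp: coord_space_def)
  have fin: "finite {L. f L \<noteq> 0}"
    using supp by (rule finite_subset) (auto simp: S_eq finite_n_standard_tableaux)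
  have LS: "L \<in> S" using L supp by blast
  show ?case
  proof (cases "\<exists>K. K \<noteq> L \<and> f K \<noteq> 0")
    case False
    then have "unit_fun L K = cscale (1 / f L) f K" for K
      using L by (cases "K = L") (auto simp: unit_fun_def)
    then have "unit_fun L = cscale (1 / f L) f" by (rule ext)
    then have "unit_fun L \<in> U" using fvs.subspace_scale[OF sub less.prems(1)] by metis
    then show ?thesis using LS by blast
  next
    case True
    then obtain K where K: "K \<noteq> L" "f K \<noteq> 0" by blast
    then have "K \<in> S" using supp by blast
    then obtain j where j: "j < sum_list \<mu>" "content (box_of \<mu> L (Suc j)) \<noteq> content (box_of \<mu> K (Suc j))"
      using contents_separate[OF LS] K(1) by metis
    define g where "g = jucys_murphy j f - cscale (of_int (content (box_of \<mu> L (Suc j)))) f"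
    have g_eq: "g M = of_int (content (box_of \<mu> M (Suc j)) - content (box_of \<mu> L (Suc j))) * f M" for M
      unfolding g_def jucys_murphy_content[OF j(1) less.prems(2)] by (simp add: algebra_simps)
    have "g \<in> U"
      unfolding g_def using j(1) size less.prems(1)
      by (intro fvs.subspace_diff[OF sub] fvs.subspace_scale[OF sub] invariant_jucys_murphy[OF U]) auto
    moreover have "g \<in> coord_space S" using less.prems(2) by (simp add: coord_space_def g_eq)
    moreover have "g K \<noteq> 0" using j(2) K(2) by (simp add: g_eq)
    then have "g \<noteq> 0" by auto
    moreover have "{M. g M \<noteq> 0} \<subset> {M. f M \<noteq> 0}"
    proof
      show "{M. g M \<noteq> 0} \<subseteq> {M. f M \<noteq> 0}" by (auto simp: g_eq)
      have "L \<in> {M. f M \<noteq> 0}" "L \<notin> {M. g M \<noteq> 0}" using L by (simp_all add: g_eq)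
      then show "{M. g M \<noteq> 0} \<noteq> {M. f M \<noteq> 0}" by blast
    qed
    then have "card {M. g M \<noteq> 0} < card {M. f M \<noteq> 0}" by (rule psubset_card_mono[OF fin])
    ultimately show ?thesis using less.hyps by blast
  qed
qed

text \<open>
  The image of \<open>v\<^sub>L\<close> under the exchange involves the exchanged tableau with the coefficient \<open>1 + a\<close>,
  and \<open>a \<noteq> -1\<close> as both tableaux are standard.
\<close>

lemma invariant_unit_swap:
  assumes U: "invariant_subspace (rook_monoid n) V U" and i: "1 \<le> i" "Suc i \<le> n"
    and L: "L \<in> T" "swap_entries \<mu> i L \<in> T" and "unit_fun L \<in> U"
  shows "unit_fun (swap_entries \<mu> i L) \<in> U"
proof -
  interpret tableau n \<mu> L using partition L(1) by unfold_locales
  interpret swap: tableau n \<mu> "swap_entries \<mu> i L" using partition L(2) by unfold_locales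
  have sub: "fvs.subspace U" using U by (simp add: invariant_subspace_def)
  obtain j where j: "i = Suc j" using i by (cases i) auto
  define a where "a = inverse_axial_distance \<mu> L i (Suc i)"
  have ss: "swap_entries \<mu> i (swap_entries \<mu> i L) = L"
    using filling swap_swap by (simp add: injective_filling_def)
  have "inverse_axial_distance \<mu> (swap_entries \<mu> i L) i (Suc i) = - a"
    using inverse_axial_distance_swap[OF filling, of i i "Suc i"]
      inverse_axial_distance_skew[of \<mu> L "Suc i" i] by (simp add: a_def)
  then have "- a \<noteq> 1" using swap.swap_not_standard[of i] L(1) ss by auto
  then have a1: "1 + a \<noteq> 0" by (auto simp: add_eq_0_iff)
  let ?h = "seminormal_op n \<mu> i (unit_fun L)"
  have "act (R (adj_transp j) {..<n}) (unit_fun L) \<in> U"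
    using i j by (intro invariant_act[OF U] adj_transp_permutes assms(6)) auto
  then have hU: "?h \<in> U"
    using act_adj[of j "unit_fun L"] i j unit_fun_in_coord_space[OF L(1)] by simp
  have h_eq: "?h K = a * unit_fun L K + (1 + a) * unit_fun (swap_entries \<mu> i L) K" for K
  proof (cases "i \<in> entries \<mu> L \<and> Suc i \<in> entries \<mu> L")
    case True
    then show ?thesis
      unfolding seminormal_op_unit_fun[OF partition L(1) i] s_on_basis_def
      using L(2) by (simp add: a_def inverse_axial_distance_def Let_def)
  next
    case False
    then have "a = 0" by (auto simp: a_def inverse_axial_distance_def)
    moreover have "swap_entries \<mu> i L = L" if "i \<notin> entries \<mu> L" "Suc i \<notin> entries \<mu> L"
      using swap_unchanged[OF _ that] filling by (simp add: injective_filling_def)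
    ultimately show ?thesis
      unfolding seminormal_op_unit_fun[OF partition L(1) i] s_on_basis_def using False by auto
  qed
  have "unit_fun (swap_entries \<mu> i L) K = (cscale (1 / (1 + a)) (?h - cscale a (unit_fun L))) K" for K
    using a1 by (simp add: h_eq)
  then have "unit_fun (swap_entries \<mu> i L) = cscale (1 / (1 + a)) (?h - cscale a (unit_fun L))" by (rule ext)
  also have "\<dots> \<in> U" by (intro fvs.subspace_scale[OF sub] fvs.subspace_diff[OF sub] hU assms(6))
  finally show ?thesis .
qed

lemma invariant_unit_iff:
  assumes U: "invariant_subspace (rook_monoid n) V U" and L: "L \<in> T"
  shows "unit_fun L \<in> U \<longleftrightarrow> unit_fun (reading_tableau \<mu>) \<in> U"
proof (rule n_standard_tableaux_connected[OF partition size L])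
  fix i L assume i: "1 \<le> i" "Suc i \<le> n" and L: "L \<in> T" "swap_entries \<mu> i L \<in> T"
  have "swap_entries \<mu> i (swap_entries \<mu> i L) = L"
    using L(1) swap_swap by (auto simp: n_standard_tableaux_def PiE_def)
  then show "unit_fun L \<in> U \<longleftrightarrow> unit_fun (swap_entries \<mu> i L) \<in> U"
    using invariant_unit_swap[OF U i L] invariant_unit_swap[OF U i L(2)] L(1) by auto
qed

text \<open>
  Cutting down by the idempotent of the entries of a tableau in the support, and renaming these
  entries to \<open>1, \<dots>, r\<close>, leads from any nonzero vector to one supported on standard Young tableaux.
\<close>

lemma invariant_meets_coord_space_S:
  assumes U: "invariant_subspace (rook_monoid n) V U" and f: "f \<in> U" "f \<noteq> 0"
  shows "\<exists>g\<in>U. g \<in> coord_space S \<and> g \<noteq> 0"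
proof -
  let ?r = "sum_list \<mu>" and ?N = "{..<n}"
  have fT: "f \<in> coord_space T" using U f(1) unfolding invariant_subspace_def space by blast
  obtain L where L: "f L \<noteq> 0" using f(2) by (auto simp: fun_eq_iff)
  then have LT: "L \<in> T" using fT by (auto simp: coord_space_def)
  define D where "D = {d. Suc d \<in> entries \<mu> L}"
  have "Suc ` D = entries \<mu> L"
    using entries_subset[OF LT] by (fastforce simp: D_def image_iff dest: Suc_le_D)
  then have D: "Suc ` D = entries \<mu> L" "card D = ?r"
    using card_entries[OF LT] card_image[of Suc D] by auto
  have DN: "D \<subseteq> ?N" using entries_subset[OF LT] by (auto simp: D_def)
  have "card D = card {..<?r}" using D(2) by simp
  then obtain h where h: "bij_betw h D {..<?r}"
    using finite_same_card_bij[OF finite_subset[OF DN finite_lessThan] finite_lessThan] by blast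
  then obtain \<sigma> where \<sigma>: "\<sigma> permutes ?N" "\<And>b. b \<in> D \<Longrightarrow> \<sigma> b = h b"
    using extend_to_permutation[of ?N h D] DN size by (auto simp: bij_betw_def)
  define f' where "f' = act (R id D) f"
  have f': "f' \<in> U" "f' = entry_restriction \<mu> D f"
    unfolding f'_def by (rule invariant_act[OF U permutes_id f(1)], rule act_idempotent[OF DN fT])
  have f'T: "f' \<in> coord_space T" using f'(2) fT by (simp add: entry_restriction_in_coord_space)
  have "f' L \<noteq> 0" using L D(1) by (simp add: f'(2) entry_restriction_def)
  define g where "g = act (R \<sigma> ?N) f'"
  have gT: "g \<in> coord_space T" unfolding g_def by (rule act_space[OF \<sigma>(1) f'T])
  have "act (R (inv_into UNIV \<sigma>) ?N) g = f'"
    unfolding g_def act_perm_mult[OF permutes_inv[OF \<sigma>(1)] \<sigma>(1) f'T] permutes_inv_o(2)[OF \<sigma>(1)]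
    by (rule act_one[OF f'T])
  moreover have "act (R (inv_into UNIV \<sigma>) ?N) 0 = 0"
    by (rule linear_map_on_0[OF act_linear[OF permutes_inv[OF \<sigma>(1)]] subspace_coord_space])
  ultimately have "g \<noteq> 0" using \<open>f' L \<noteq> 0\<close> by auto
  have \<sigma>D: "\<sigma> ` D = {..<?r}" using h \<sigma>(2) by (simp add: bij_betw_def cong: image_cong)
  have "entry_restriction \<mu> {..<?r} g = act (R id {..<?r}) g"
    using act_idempotent[OF _ gT] size by simp
  also have "\<dots> = act (R (id \<circ> (\<sigma> \<circ> id)) {b \<in> {b \<in> D. id b \<in> ?N}. (\<sigma> \<circ> id) b \<in> {..<?r}}) f"
    unfolding g_def f'_def act_mult[OF \<sigma>(1) permutes_id fT]
    by (rule act_mult[OF permutes_id permutes_compose[OF permutes_id \<sigma>(1)] fT])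
  also have "{b \<in> {b \<in> D. id b \<in> ?N}. (\<sigma> \<circ> id) b \<in> {..<?r}} = {b \<in> D. id b \<in> ?N}"
    using \<sigma>D by auto
  also have "act (R (id \<circ> (\<sigma> \<circ> id)) {b \<in> D. id b \<in> ?N}) f = g"
    unfolding g_def f'_def act_mult[OF \<sigma>(1) permutes_id fT] by simp
  finally have "g \<in> coord_space S" using gT by (simp add: coord_space_S)
  moreover have "g \<in> U" unfolding g_def by (rule invariant_act[OF U \<sigma>(1) f'(1)])
  ultimately show ?thesis using \<open>g \<noteq> 0\<close> by blast
qed

lemma reading_tableau_S: "reading_tableau \<mu> \<in> S"
  by (rule reading_tableau_standard[OF partition])

lemma reading_tableau_T: "reading_tableau \<mu> \<in> T"
  using reading_tableau_S by (simp add: S_eq)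

text \<open>
  A nonzero invariant subspace contains one basis vector, and exchanges lead from it to all others.
\<close>

theorem irreducible: "irreducible_rep (rook_monoid n) V"
  unfolding irreducible_rep_def
proof (intro conjI allI impI)
  show "representation (rook_monoid n) V" by (rule rep)
  have "unit_fun (reading_tableau \<mu>) \<in> rep_space V"
    unfolding space by (rule unit_fun_in_coord_space[OF reading_tableau_T])
  then show "rep_space V \<noteq> {0}" by (metis singletonD unit_fun_nonzero)
  fix U assume U: "invariant_subspace (rook_monoid n) V U"
  have sub: "fvs.subspace U" and US: "U \<subseteq> coord_space T" using U by (simp_all add: invariant_subspace_def space)
  show "U = {0} \<or> U = rep_space V"
  proof (cases "U = {0}")
    case False
    then obtain f where "f \<in> U" "f \<noteq> 0" using fvs.subspace_0[OF sub] by blast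
    then obtain g where "g \<in> U" "g \<in> coord_space S" "g \<noteq> 0" using invariant_meets_coord_space_S[OF U] by blast
    then obtain L where L: "L \<in> S" "unit_fun L \<in> U" using invariant_contains_unit[OF U] by blast
    then have "unit_fun K \<in> U" if "K \<in> T" for K
      using invariant_unit_iff[OF U, of L] invariant_unit_iff[OF U that] by (simp add: S_eq)
    then have "unit_fun ` T \<subseteq> U" by blast
    then have "fvs.span (unit_fun ` T) \<subseteq> U" by (rule fvs.span_minimal[OF _ sub])
    then have "coord_space T \<subseteq> U" using coord_space_in_span[OF finite_n_standard_tableaux] by blast
    then show ?thesis using US by (simp add: space)
  qed simp
qed

text \<open>
  An endomorphism commutes with the idempotent of the first \<open>r\<close> columns and with the Jucys-Murphy
  elements, whose common eigenspaces on the standard Young tableaux are lines.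
\<close>

lemma endomorphism_scalar:
  assumes "\<phi> \<in> intertwiners (rook_monoid n) V V" "K \<in> S"
  shows "\<exists>c. \<phi> (unit_fun K) = cscale c (unit_fun K)"
proof -
  note D = intertwinersD[OF assms(1), unfolded space]
  let ?v = "unit_fun K :: _ \<Rightarrow> complex"
  have vS: "?v \<in> coord_space S" by (rule unit_fun_in_coord_space[OF assms(2)])
  then have vT: "?v \<in> coord_space T" by (simp add: coord_space_S)
  have \<phi>T: "\<phi> ?v \<in> coord_space T" by (rule D(2)[OF vT])
  have "entry_restriction \<mu> {..<sum_list \<mu>} (\<phi> ?v) = act (R id {..<sum_list \<mu>}) (\<phi> ?v)"
    using act_idempotent[OF _ \<phi>T] size by simp
  also have "\<dots> = \<phi> (act (R id {..<sum_list \<mu>}) ?v)"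
    by (rule D(3)[OF rook_mat_in_carrier[OF permutes_id] vT, symmetric])
  also have "act (R id {..<sum_list \<mu>}) ?v = ?v"
    using act_idempotent[OF _ vT] vS size by (simp add: coord_space_S)
  finally have \<phi>S: "\<phi> ?v \<in> coord_space S" using \<phi>T by (simp add: coord_space_S)
  have "\<phi> ?v L = 0" if ne: "L \<noteq> K" for L
  proof (cases "L \<in> S")
    case True
    then obtain j where j: "j < sum_list \<mu>" "content (box_of \<mu> L (Suc j)) \<noteq> content (box_of \<mu> K (Suc j))"
      using contents_separate[OF True assms(2) ne] by metis
    let ?c = "of_int (content (box_of \<mu> K (Suc j))) :: complex"
    have t: "transpose i j permutes {..<n}" if "i < j" for i
      using that j(1) size by (intro permutes_swap_id) auto
    have "jucys_murphy j (\<phi> ?v) = (\<Sum>i<j. \<phi> (act (R (transpose i j) {..<n}) ?v))"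
      unfolding jucys_murphy_def using t
      by (intro sum.cong refl D(3)[symmetric] rook_mat_in_carrier vT) auto
    also have "\<dots> = \<phi> (jucys_murphy j ?v)"
      unfolding jucys_murphy_def using t
      by (intro linear_map_on_sum[OF D(1) subspace_coord_space, symmetric] act_space vT) auto
    also have "jucys_murphy j ?v = cscale ?c ?v"
      unfolding jucys_murphy_content[OF j(1) vS] by (rule ext) (simp add: unit_fun_def)
    also have "\<phi> (cscale ?c ?v) = cscale ?c (\<phi> ?v)" by (rule linear_map_on_scale[OF D(1) vT])
    finally have "(\<lambda>L. of_int (content (box_of \<mu> L (Suc j))) * \<phi> ?v L) = cscale ?c (\<phi> ?v)"
      unfolding jucys_murphy_content[OF j(1) \<phi>S] .
    from fun_cong[OF this, of L] show ?thesis using j(2) by simp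
  qed (use \<phi>S in \<open>simp add: coord_space_def\<close>)
  then have "\<phi> ?v L = cscale (\<phi> ?v K) ?v L" for L by (cases "L = K") (simp_all add: unit_fun_def)
  then have "\<phi> ?v = cscale (\<phi> ?v K) ?v" by (rule ext)
  then show ?thesis by blast
qed

end

section \<open>Surjections and the Stirling numbers\<close>

definition surjections :: "nat \<Rightarrow> nat set \<Rightarrow> (nat \<Rightarrow> nat) set" where
  "surjections k B = {p \<in> {..<k} \<rightarrow>\<^sub>E B. p ` {..<k} = B}"

lemma finite_surjections: "finite B \<Longrightarrow> finite (surjections k B)"
  by (rule finite_subset[of _ "{..<k} \<rightarrow>\<^sub>E B"]) (auto simp: surjections_def intro: finite_PiE)

lemma surjections_Suc_bij:
  "bij_betw (\<lambda>(c, p). p(k := c)) (SIGMA c:B. surjections k B \<union> surjections k (B - {c})) (surjections (Suc k) B)"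
proof (rule bij_betw_byWitness[where f' = "\<lambda>q. (q k, q(k := undefined))"])
  show "\<forall>x\<in>SIGMA c:B. surjections k B \<union> surjections k (B - {c}).
      (\<lambda>q. (q k, q(k := undefined))) ((\<lambda>(c, p). p(k := c)) x) = x"
    by (auto simp: surjections_def PiE_def extensional_def fun_eq_iff)
  show "\<forall>q\<in>surjections (Suc k) B. (\<lambda>(c, p). p(k := c)) (q k, q(k := undefined)) = q" by simp
  show "(\<lambda>(c, p). p(k := c)) ` (SIGMA c:B. surjections k B \<union> surjections k (B - {c})) \<subseteq> surjections (Suc k) B"
    by (fastforce simp: surjections_def PiE_iff extensional_def lessThan_Suc)
  show "(\<lambda>q. (q k, q(k := undefined))) ` surjections (Suc k) B \<subseteq>
      (SIGMA c:B. surjections k B \<union> surjections k (B - {c}))"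
  proof (rule image_subsetI)
    fix q assume q: "q \<in> surjections (Suc k) B"
    let ?p = "q(k := undefined)"
    have img: "?p ` {..<k} = q ` {..<k}" by (intro image_cong) auto
    have B: "insert (q k) (q ` {..<k}) = B" using q by (simp add: surjections_def lessThan_Suc)
    have ext: "?p \<in> extensional {..<k}" using q by (auto simp: surjections_def PiE_iff extensional_def)
    have "?p \<in> surjections k (q ` {..<k})"
      using img ext by (auto simp: surjections_def PiE_iff)
    moreover have "q ` {..<k} = B \<or> q ` {..<k} = B - {q k}"
      unfolding B[symmetric] by (cases "q k \<in> q ` {..<k}") (auto simp: insert_absorb)
    ultimately have "?p \<in> surjections k B \<union> surjections k (B - {q k})" by (metis UnCI)
    moreover have "q k \<in> B" using B by blast
    ultimately show "(q k, ?p) \<in> (SIGMA c:B. surjections k B \<union> surjections k (B - {c}))"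
      by (rule SigmaI[rotated])
  qed
qed

text \<open>
  A surjection of \<open>{..k}\<close> is given by the image \<open>c\<close> of \<open>k\<close> and a map of \<open>{..<k}\<close> that is onto \<open>B\<close> or misses
  just \<open>c\<close>; multiplied by factorials, this is the recursion of the Stirling numbers.
\<close>

lemma card_surjections: "finite B \<Longrightarrow> card (surjections k B) = fact (card B) * Stirling k (card B)"
proof (induction k arbitrary: B)
  case 0
  show ?case
  proof (cases "B = {}")
    case True
    have "surjections 0 {} = {\<lambda>_. undefined}" by (auto simp: surjections_def)
    then show ?thesis using True by simp
  next
    case False
    then obtain m where "card B = Suc m" using 0 by (metis card_0_eq not0_implies_Suc)
    moreover have "surjections 0 B = {}" using False by (auto simp: surjections_def)
    ultimately show ?thesis by simp
  qed
next
  case (Suc k)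
  have "card (surjections (Suc k) B) = card (SIGMA c:B. surjections k B \<union> surjections k (B - {c}))"
    by (rule bij_betw_same_card[OF surjections_Suc_bij, symmetric])
  also have "\<dots> = (\<Sum>c\<in>B. card (surjections k B \<union> surjections k (B - {c})))"
    using Suc.prems by (intro card_SigmaI) (auto intro: finite_surjections)
  also have "\<dots> = (\<Sum>c\<in>B. fact (card B) * Stirling k (card B) + fact (card B - 1) * Stirling k (card B - 1))"
  proof (rule sum.cong[OF refl])
    fix c assume c: "c \<in> B"
    have "surjections k B \<inter> surjections k (B - {c}) = {}" using c by (auto simp: surjections_def)
    then have "card (surjections k B \<union> surjections k (B - {c})) =
        card (surjections k B) + card (surjections k (B - {c}))"
      using Suc.prems by (intro card_Un_disjoint finite_surjections) auto
    then show "card (surjections k B \<union> surjections k (B - {c})) =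
        fact (card B) * Stirling k (card B) + fact (card B - 1) * Stirling k (card B - 1)"
      using Suc.IH[of B] Suc.IH[of "B - {c}"] Suc.prems c by simp
  qed
  also have "\<dots> = fact (card B) * Stirling (Suc k) (card B)"
    by (cases "card B") (simp_all add: algebra_simps)
  finally show ?case .
qed

text \<open>
  Relabelling the values is a free action of the symmetric group on surjections, since a permutation
  is determined by its effect on the values of a surjection. So every orbit has \<open>r!\<close> elements, and the
  number of orbits is that of surjections divided by \<open>r!\<close>.
\<close>

lemma orbit_transversal:
  obtains P where "finite P" "P \<subseteq> surjections k {..<r}" "card P = Stirling k r"
    "\<And>p. p \<in> surjections k {..<r} \<Longrightarrow> \<exists>q\<in>P. \<exists>\<sigma>. \<sigma> permutes {..<r} \<and> (\<forall>m<k. \<sigma> (p m) = q m)"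
    "\<And>p q \<sigma>. p \<in> P \<Longrightarrow> q \<in> P \<Longrightarrow> \<sigma> permutes {..<r} \<Longrightarrow> (\<forall>m<k. \<sigma> (p m) = q m) \<Longrightarrow> p = q"
proof -
  let ?X = "surjections k {..<r}" and ?G = "{\<sigma>. \<sigma> permutes {..<r}}"
  define relabel :: "(nat \<Rightarrow> nat) \<Rightarrow> (nat \<Rightarrow> nat) \<Rightarrow> nat \<Rightarrow> nat"
    where "relabel = (\<lambda>\<sigma> p. restrict (\<sigma> \<circ> p) {..<k})"
  define orbit where "orbit = (\<lambda>p. (\<lambda>\<sigma>. relabel \<sigma> p) ` ?G)"
  have ext_X: "p \<in> extensional {..<k}" if "p \<in> ?X" for p using that by (simp add: surjections_def PiE_iff)
  have relabel_X: "relabel \<sigma> p \<in> ?X" if "\<sigma> permutes {..<r}" "p \<in> ?X" for \<sigma> p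
  proof -
    have "relabel \<sigma> p ` {..<k} = \<sigma> ` p ` {..<k}" by (auto simp: relabel_def)
    also have "\<dots> = {..<r}" using that permutes_image[OF that(1)] by (simp add: surjections_def)
    finally show ?thesis by (auto simp: surjections_def PiE_iff relabel_def)
  qed
  have relabel_id: "relabel id p = p" if "p \<in> ?X" for p
    using ext_X[OF that] by (intro extensionalityI[of _ "{..<k}"]) (auto simp: relabel_def)
  have relabel_comp: "relabel \<sigma> (relabel \<tau> p) = relabel (\<sigma> \<circ> \<tau>) p" for \<sigma> \<tau> p
    by (auto simp: relabel_def fun_eq_iff)
  have self: "p \<in> orbit p" if "p \<in> ?X" for p
    using relabel_id[OF that] permutes_id unfolding orbit_def by (metis imageI mem_Collect_eq)
  have orbit_sub: "orbit q \<subseteq> orbit p" if q: "q \<in> orbit p" for p q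
  proof -
    obtain \<tau> where \<tau>: "\<tau> permutes {..<r}" "q = relabel \<tau> p" using q by (auto simp: orbit_def)
    show ?thesis unfolding orbit_def \<tau>(2) relabel_comp
      using permutes_compose[OF \<tau>(1)] by blast
  qed
  have orbit_sym: "p \<in> orbit q" if p: "p \<in> ?X" and q: "q \<in> orbit p" for p q
  proof -
    obtain \<tau> where \<tau>: "\<tau> permutes {..<r}" "q = relabel \<tau> p" using q by (auto simp: orbit_def)
    have "relabel (inv_into UNIV \<tau>) q = p"
      unfolding \<tau>(2) relabel_comp permutes_inv_o(2)[OF \<tau>(1)] by (rule relabel_id[OF p])
    then show ?thesis unfolding orbit_def using permutes_inv[OF \<tau>(1)] by blast
  qed
  have orbit_X: "orbit p \<subseteq> ?X" if "p \<in> ?X" for p using relabel_X that by (auto simp: orbit_def)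
  have orbit_eq: "orbit q = orbit p" if "p \<in> ?X" "q \<in> orbit p" for p q
    using orbit_sub[OF that(2)] orbit_sub[OF orbit_sym[OF that]] by blast
  have card_orbit: "card (orbit p) = fact r" if p: "p \<in> ?X" for p
  proof -
    have "inj_on (\<lambda>\<sigma>. relabel \<sigma> p) ?G"
    proof (rule inj_onI, rule ext)
      fix \<sigma> \<tau> x assume \<sigma>\<tau>: "\<sigma> \<in> ?G" "\<tau> \<in> ?G" "relabel \<sigma> p = relabel \<tau> p"
      show "\<sigma> x = \<tau> x"
      proof (cases "x < r")
        case True
        then obtain m where m: "m < k" "x = p m" using p by (auto simp: surjections_def)
        show ?thesis using fun_cong[OF \<sigma>\<tau>(3), of m] m by (simp add: relabel_def)
      next
        case False
        then show ?thesis using \<sigma>\<tau>(1,2) by (auto simp: permutes_def)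
      qed
    qed
    then have "card (orbit p) = card ?G" unfolding orbit_def by (rule card_image)
    then show ?thesis using card_permutations[of "{..<r}" r] by simp
  qed
  define C where "C = orbit ` ?X"
  have UC: "\<Union>C = ?X" using self orbit_X by (auto simp: C_def)
  have finX: "finite ?X" by (rule finite_surjections) simp
  have disj: "c \<inter> d = {}" if cd: "c \<in> C" "d \<in> C" "c \<noteq> d" for c d
  proof (rule ccontr)
    assume "c \<inter> d \<noteq> {}"
    then obtain x where x: "x \<in> c" "x \<in> d" by blast
    obtain p q where "c = orbit p" "p \<in> ?X" "d = orbit q" "q \<in> ?X" using cd(1,2) by (auto simp: C_def)
    then show False using x orbit_eq cd(3) by metis
  qed
  have "fact r * card C = card (\<Union>C)"
    using finX card_orbit disj unfolding UC
    by (intro card_partition[of C, unfolded UC]) (auto simp: C_def)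
  then have "fact r * card C = fact r * Stirling k r"
    unfolding UC using card_surjections[of "{..<r}" k] by simp
  then have cardC: "card C = Stirling k r" by simp
  define rp where "rp = (\<lambda>c. SOME p. p \<in> c \<and> p \<in> ?X)"
  have rp: "rp c \<in> c \<and> rp c \<in> ?X" if "c \<in> C" for c
  proof -
    have "\<exists>p. p \<in> c \<and> p \<in> ?X" using that self by (auto simp: C_def)
    then show ?thesis unfolding rp_def by (rule someI_ex)
  qed
  show thesis
  proof (rule that[of "rp ` C"])
    show "finite (rp ` C)" using finX by (simp add: C_def)
    show "rp ` C \<subseteq> ?X" using rp by blast
    have "inj_on rp C"
    proof (rule inj_onI, rule ccontr)
      fix c d assume "c \<in> C" "d \<in> C" "rp c = rp d" "c \<noteq> d"
      then show False using disj[of c d] rp[of c] rp[of d] by auto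
    qed
    then show "card (rp ` C) = Stirling k r" by (simp add: card_image cardC)
  next
    fix p assume p: "p \<in> ?X"
    then have orb: "orbit p \<in> C" by (simp add: C_def)
    from rp[OF this] obtain \<sigma> where \<sigma>: "\<sigma> permutes {..<r}" "rp (orbit p) = relabel \<sigma> p"
      by (auto simp: orbit_def)
    then have "\<forall>m<k. \<sigma> (p m) = rp (orbit p) m" by (simp add: relabel_def)
    then show "\<exists>q\<in>rp ` C. \<exists>\<sigma>. \<sigma> permutes {..<r} \<and> (\<forall>m<k. \<sigma> (p m) = q m)"
      using \<sigma>(1) imageI[OF orb, of rp] by blast
  next
    fix p q \<sigma> assume pq: "p \<in> rp ` C" "q \<in> rp ` C" "\<sigma> permutes {..<r}" "\<forall>m<k. \<sigma> (p m) = q m"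
    obtain c d where cd: "c \<in> C" "p = rp c" "d \<in> C" "q = rp d" using pq(1,2) by blast
    have X: "p \<in> ?X" "q \<in> ?X" "p \<in> c" "q \<in> d" using rp[OF cd(1)] rp[OF cd(3)] cd by auto
    have "relabel \<sigma> p = q"
      using pq(4) ext_X[OF X(2)] by (intro extensionalityI[of _ "{..<k}"]) (auto simp: relabel_def)
    then have "q \<in> orbit p" using pq(3) by (auto simp: orbit_def)
    moreover obtain s where "c = orbit s" "s \<in> ?X" using cd(1) unfolding C_def by (rule imageE)
    then have "c = orbit p" using orbit_eq[of s p] X(3) by simp
    ultimately have "c = d" using disj[OF cd(1,3)] X(4) by blast
    then show "p = q" using cd by simp
  qed
qed

section \<open>The tensor power as a representation of the rook monoid\<close>

lemma finite_tensor_index: "finite (tensor_index n k)"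
  by (simp add: tensor_index_def finite_PiE)

lemma relabel_tensor_index:
  assumes "\<sigma> permutes {..<n}" "q \<in> tensor_index n k"
  shows "restrict (\<sigma> \<circ> q) {..<k} \<in> tensor_index n k"
proof -
  have "\<sigma> (q m) < n" if "m < k" for m
    using that assms(2) permutes_in_image[OF assms(1), of "q m"] by (auto simp: tensor_index_def PiE_iff)
  then show ?thesis by (auto simp: tensor_index_def)
qed

lemma tensor_act_rook_mat:
  assumes \<sigma>: "\<sigma> permutes {..<n}" and q: "q \<in> tensor_index n k"
    and p: "p \<in> tensor_index n k" "\<And>m. m < k \<Longrightarrow> \<sigma> (p m) = q m"
  shows "tensor_act n k (rook_mat n \<sigma> D) t q = (if \<forall>m<k. p m \<in> D then t p else 0)"
proof -
  let ?B = "tensor_index n k"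
  have lt: "p' m < n" if "p' \<in> ?B" "m < k" for p' m using that by (auto simp: tensor_index_def PiE_iff)
  have "(\<Prod>m<k. rook_mat n \<sigma> D $$ (q m, p' m)) = (if p' = p then (if \<forall>m<k. p m \<in> D then 1 else 0) else 0)"
    if p': "p' \<in> ?B" for p'
  proof -
    have "(\<Prod>m<k. rook_mat n \<sigma> D $$ (q m, p' m)) = (\<Prod>m<k. if p' m = p m \<and> p m \<in> D then 1 else 0)"
    proof (rule prod.cong[OF refl])
      fix m assume "m \<in> {..<k}"
      then have m: "m < k" by simp
      have "q m = \<sigma> (p' m) \<longleftrightarrow> p' m = p m"
        using p(2)[OF m] injD[OF permutes_inj[OF \<sigma>], of "p m" "p' m"] by auto
      then show "rook_mat n \<sigma> D $$ (q m, p' m) = (if p' m = p m \<and> p m \<in> D then 1 else 0)"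
        using lt[OF q m] lt[OF p' m] by (auto simp: rook_mat_index)
    qed
    also have "\<dots> = (if \<forall>m<k. p' m = p m \<and> p m \<in> D then 1 else 0)" by (auto simp: prod_zero_iff)
    also have "\<dots> = (if p' = p then (if \<forall>m<k. p m \<in> D then 1 else 0) else 0)"
    proof -
      have "p' = p" if "\<forall>m<k. p' m = p m"
        using that p' p(1) by (intro extensionalityI[of _ "{..<k}"]) (auto simp: tensor_index_def PiE_iff)
      then show ?thesis by auto
    qed
    finally show ?thesis .
  qed
  then have "tensor_act n k (rook_mat n \<sigma> D) t q =
      (\<Sum>p'\<in>?B. (if p' = p then (if \<forall>m<k. p m \<in> D then 1 else 0) else 0) * t p')"
    using q by (simp add: tensor_act_def)
  also have "\<dots> = (\<Sum>p'\<in>?B. if p' = p then (if \<forall>m<k. p m \<in> D then t p else 0) else 0)"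
    by (intro sum.cong) auto
  also have "\<dots> = (if \<forall>m<k. p m \<in> D then t p else 0)"
    using p(1) by (simp add: sum.delta[OF finite_tensor_index])
  finally show ?thesis .
qed

lemma tensor_act_outside: "q \<notin> tensor_index n k \<Longrightarrow> tensor_act n k A t q = 0"
  by (simp add: tensor_act_def)

lemma preimage_index:
  assumes "\<sigma> permutes {..<n}" "q \<in> tensor_index n k"
  obtains p where "p \<in> tensor_index n k" "\<And>m. m < k \<Longrightarrow> \<sigma> (p m) = q m"
  using that[OF relabel_tensor_index[OF permutes_inv[OF assms(1)] assms(2)]]
  by (simp add: permutes_inverses(1)[OF assms(1)])

lemma tensor_act_linear: "linear_map_on V (tensor_act n k A)"
  by (auto simp: linear_map_on_def tensor_act_def fun_eq_iff algebra_simps sum.distrib sum_distrib_left)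

lemma tensor_representation: "representation (rook_monoid n) (tensor_rep n k)"
  unfolding representation_def tensor_rep_def rep.simps
proof (intro conjI ballI)
  let ?B = "tensor_index n k"
  show "fvs.subspace (coord_space ?B)" by (rule subspace_coord_space)
  fix A assume "A \<in> carrier (rook_monoid n)"
  then obtain \<sigma> D where A: "\<sigma> permutes {..<n}" "D \<subseteq> {..<n}" "A = rook_mat n \<sigma> D"
    by (rule rook_monoid_elementE)
  show "linear_map_on (coord_space ?B) (tensor_act n k A)" by (rule tensor_act_linear)
  show "tensor_act n k A t \<in> coord_space ?B" for t by (simp add: coord_space_def tensor_act_outside)
  fix B assume "B \<in> carrier (rook_monoid n)"
  then obtain \<tau> E where B: "\<tau> permutes {..<n}" "E \<subseteq> {..<n}" "B = rook_mat n \<tau> E"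
    by (rule rook_monoid_elementE)
  fix t
  show "tensor_act n k (A \<otimes>\<^bsub>rook_monoid n\<^esub> B) t = tensor_act n k A (tensor_act n k B t)"
  proof
    fix q
    show "tensor_act n k (A \<otimes>\<^bsub>rook_monoid n\<^esub> B) t q = tensor_act n k A (tensor_act n k B t) q"
    proof (cases "q \<in> ?B")
      case q: True
      obtain p where p: "p \<in> ?B" "\<And>m. m < k \<Longrightarrow> \<sigma> (p m) = q m" using preimage_index[OF A(1) q] by metis
      obtain s where s: "s \<in> ?B" "\<And>m. m < k \<Longrightarrow> \<tau> (s m) = p m" using preimage_index[OF B(1) p(1)] by metis
      have "tensor_act n k (A \<otimes>\<^bsub>rook_monoid n\<^esub> B) t q =
          (if \<forall>m<k. s m \<in> {b \<in> E. \<tau> b \<in> D} then t s else 0)"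
        unfolding A(3) B(3) rook_monoid_mult rook_mat_mult[OF B(1)]
        using p(2) s by (intro tensor_act_rook_mat[OF permutes_compose[OF B(1) A(1)] q s(1)]) simp
      also have "\<dots> = (if \<forall>m<k. p m \<in> D then (if \<forall>m<k. s m \<in> E then t s else 0) else 0)"
        using s(2) by auto
      also have "\<dots> = tensor_act n k A (tensor_act n k B t) q"
        unfolding A(3) B(3) by (simp only: tensor_act_rook_mat[OF A(1) q p] tensor_act_rook_mat[OF B(1) p(1) s])
      finally show ?thesis .
    qed (simp add: tensor_act_outside)
  qed
next
  let ?B = "tensor_index n k"
  fix t assume t: "t \<in> coord_space ?B"
  show "tensor_act n k \<one>\<^bsub>rook_monoid n\<^esub> t = t"
  proof
    fix q
    show "tensor_act n k \<one>\<^bsub>rook_monoid n\<^esub> t q = t q"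
    proof (cases "q \<in> ?B")
      case q: True
      have "tensor_act n k (rook_mat n id {..<n}) t q = (if \<forall>m<k. q m \<in> {..<n} then t q else 0)"
        by (rule tensor_act_rook_mat[OF permutes_id q q]) simp
      then show ?thesis using q by (auto simp: rook_monoid_one tensor_index_def PiE_iff)
    qed (use t in \<open>simp add: tensor_act_outside coord_space_def\<close>)
  qed
qed

text \<open>
  The matrices are real, so the adjoint of a rook matrix on the tensor power is its transpose, which
  is again a rook matrix.
\<close>

lemma tensor_completely_reducible: "\<exists>\<U>. irreducible_decomposition (rook_monoid n) (tensor_rep n k) \<U>"
proof (rule complete_reducibility[OF tensor_representation _ finite_tensor_index])
  let ?B = "tensor_index n k"
  show "rep_space (tensor_rep n k) = coord_space ?B" by (simp add: tensor_rep_def)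
  fix A assume A: "A \<in> carrier (rook_monoid n)"
  then have dim: "A \<in> carrier_mat n n" by (simp add: rook_monoid_def)
  have At: "transpose_mat A \<in> carrier (rook_monoid n)"
  proof -
    obtain \<sigma> D where \<sigma>: "\<sigma> permutes {..<n}" "A = rook_mat n \<sigma> D" using A by (rule rook_monoid_elementE)
    have "transpose_mat A = rook_mat n (inv_into UNIV \<sigma>) (\<sigma> ` D)"
      unfolding \<sigma>(2) using permutes_inverses[OF \<sigma>(1)]
      by (intro eq_matI) (auto simp: rook_mat_index)
    then show ?thesis using rook_mat_in_carrier[OF permutes_inv[OF \<sigma>(1)]] by simp
  qed
  have lt: "p m < n" if "p \<in> ?B" "m < k" for p m using that by (auto simp: tensor_index_def PiE_iff)
  have entry: "cnj (transpose_mat A $$ (p m, q m)) = A $$ (q m, p m)"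
    if "p \<in> ?B" "q \<in> ?B" "m < k" for p q m
  proof -
    have "p m < n" "q m < n" using lt that by auto
    moreover have "A $$ (q m, p m) = 0 \<or> A $$ (q m, p m) = 1"
      using A calculation by (auto simp: rook_monoid_def)
    ultimately show ?thesis using dim by auto
  qed
  have "hermitian_form ?B u (tensor_act n k A w) = hermitian_form ?B (tensor_act n k (transpose_mat A) u) w" for u w
  proof -
    have "hermitian_form ?B u (tensor_act n k A w) =
        (\<Sum>q\<in>?B. \<Sum>p\<in>?B. cnj (u q) * (\<Prod>m<k. A $$ (q m, p m)) * w p)"
      by (simp add: hermitian_form_def tensor_act_def sum_distrib_left mult.assoc)
    also have "\<dots> = (\<Sum>p\<in>?B. \<Sum>q\<in>?B. cnj (u q) * (\<Prod>m<k. A $$ (q m, p m)) * w p)"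
      by (rule sum.swap)
    also have "\<dots> = (\<Sum>p\<in>?B. \<Sum>q\<in>?B. cnj ((\<Prod>m<k. transpose_mat A $$ (p m, q m)) * u q) * w p)"
      by (intro sum.cong refl) (simp add: entry)
    also have "\<dots> = hermitian_form ?B (tensor_act n k (transpose_mat A) u) w"
      by (simp add: hermitian_form_def tensor_act_def sum_distrib_right)
    finally show ?thesis .
  qed
  then show "\<exists>h\<in>carrier (rook_monoid n). \<forall>u\<in>coord_space ?B. \<forall>w\<in>coord_space ?B.
      hermitian_form ?B u (rep_act (tensor_rep n k) A w) = hermitian_form ?B (rep_act (tensor_rep n k) h u) w"
    using At by (intro bexI[of _ "transpose_mat A"]) (simp_all add: tensor_rep_def)
qed

section \<open>Intertwiners from the seminormal representation to the tensor power\<close>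

context seminormal_module
begin

abbreviation "r \<equiv> sum_list \<mu>"
abbreviation "v0 \<equiv> unit_fun (reading_tableau \<mu>) :: (nat \<times> nat \<Rightarrow> nat) \<Rightarrow> complex"

lemma v0_space: "v0 \<in> coord_space T"
  by (rule unit_fun_in_coord_space[OF reading_tableau_T])

lemma act_factor:
  assumes "\<sigma> permutes {..<n}" "D \<subseteq> {..<n}" "f \<in> coord_space T"
  shows "act (R \<sigma> D) f = act (R \<sigma> {..<n}) (entry_restriction \<mu> D f)"
proof -
  have "act (R \<sigma> {..<n}) (act (R id D) f) = act (R (\<sigma> \<circ> id) {b \<in> D. id b \<in> {..<n}}) f"
    by (rule act_mult[OF assms(1) permutes_id assms(3)])
  also have "{b \<in> D. id b \<in> {..<n}} = D" using assms(2) by auto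
  finally show ?thesis by (simp only: act_idempotent[OF assms(2,3)] comp_id)
qed

text \<open>Every tableau has \<open>r\<close> entries, so rook matrices of rank less than \<open>r\<close> act as zero.\<close>

lemma act_small_rank:
  assumes "\<sigma> permutes {..<n}" "D \<subseteq> {..<n}" "card D < r" "f \<in> coord_space T"
  shows "act (R \<sigma> D) f = 0"
proof -
  have "entry_restriction \<mu> D f L = 0" for L
  proof (cases "L \<in> T")
    case True
    have "\<not> entries \<mu> L \<subseteq> Suc ` D"
    proof
      assume "entries \<mu> L \<subseteq> Suc ` D"
      moreover have "finite D" using assms(2) finite_subset by blast
      ultimately have "r \<le> card D"
        using card_mono[of "Suc ` D" "entries \<mu> L"] card_entries[OF True] card_image_le[of D Suc] by simp
      then show False using assms(3) by simp
    qed
    then show ?thesis by (simp add: entry_restriction_def)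
  qed (use assms(4) in \<open>simp add: entry_restriction_def coord_space_def\<close>)
  then have "entry_restriction \<mu> D f = 0" by (simp add: fun_eq_iff)
  then show ?thesis
    using act_factor[OF assms(1,2,4)] linear_map_on_0[OF act_linear[OF assms(1)] subspace_coord_space] by simp
qed

text \<open>
  The coefficients of standard Young tableaux survive the idempotent of the first \<open>r\<close> rows, and
  composing with it removes the columns that \<open>\<sigma>\<close> sends elsewhere.
\<close>

lemma act_coefficient:
  assumes "\<sigma> permutes {..<n}" "f \<in> coord_space T" "L \<in> S"
  shows "act (R \<sigma> D) f L = act (R \<sigma> {b \<in> D. \<sigma> b < r}) f L"
proof -
  have g: "act (R \<sigma> D) f \<in> coord_space T" by (rule act_space[OF assms(1,2)])
  have "entries \<mu> L \<subseteq> Suc ` {..<r}" using assms(3) by (simp add: S_eq image_Suc_lessThan)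
  then have "act (R \<sigma> D) f L = entry_restriction \<mu> {..<r} (act (R \<sigma> D) f) L"
    by (simp add: entry_restriction_def)
  also have "\<dots> = act (R id {..<r}) (act (R \<sigma> D) f) L" using act_idempotent[OF _ g] size by simp
  also have "\<dots> = act (R (id \<circ> \<sigma>) {b \<in> D. \<sigma> b \<in> {..<r}}) f L"
    by (simp only: act_mult[OF permutes_id assms(1,2)])
  finally show ?thesis by (simp only: id_comp lessThan_iff)
qed

definition matching :: "nat \<Rightarrow> (nat \<Rightarrow> nat) \<Rightarrow> (nat \<Rightarrow> nat) \<Rightarrow> (nat \<Rightarrow> nat) \<Rightarrow> bool" where
  "matching k \<sigma> q p \<longleftrightarrow> \<sigma> permutes {..<n} \<and> (\<forall>m<k. \<sigma> (q m) = p m)"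

text \<open>
  A surjection \<open>p\<close> onto \<open>{..<r}\<close> and a standard Young tableau \<open>L\<close> define a map into the tensor power:
  the coefficient of \<open>q\<close> in the image of \<open>v\<close> is the coefficient of \<open>L\<close> in \<open>\<sigma> v\<close>, for any permutation
  \<open>\<sigma>\<close> that carries \<open>q\<close> to \<open>p\<close>.
\<close>

definition coefficient_map ::
    "nat \<Rightarrow> (nat \<Rightarrow> nat) \<Rightarrow> (nat \<times> nat \<Rightarrow> nat) \<Rightarrow> ((nat \<times> nat \<Rightarrow> nat) \<Rightarrow> complex) \<Rightarrow> (nat \<Rightarrow> nat) \<Rightarrow> complex" where
  "coefficient_map k p L v q = (if q \<in> tensor_index n k \<and> (\<exists>\<sigma>. matching k \<sigma> q p)
     then act (R (SOME \<sigma>. matching k \<sigma> q p) {..<n}) v L else 0)"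

text \<open>
  As \<open>p\<close> is onto, the rows below \<open>r\<close> come exactly from the values of \<open>q\<close>; so the coefficient of a
  standard Young tableau in \<open>\<sigma> v\<close> depends on \<open>q\<close> and \<open>p\<close> only, not on \<open>\<sigma>\<close>.
\<close>

lemma matching_preimage:
  assumes "p \<in> surjections k {..<r}" "q \<in> tensor_index n k" "matching k \<sigma> q p"
  shows "{b \<in> {..<n}. \<sigma> b < r} = q ` {..<k}"
proof (intro equalityI subsetI)
  fix b assume "b \<in> {b \<in> {..<n}. \<sigma> b < r}"
  then have "\<sigma> b \<in> p ` {..<k}" using assms(1) by (simp add: surjections_def)
  then obtain m where m: "m < k" "\<sigma> b = \<sigma> (q m)" using assms(3) by (auto simp: matching_def)
  have "inj \<sigma>" using assms(3) permutes_inj by (auto simp: matching_def)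
  then have "b = q m" using m(2) by (rule injD)
  then show "b \<in> q ` {..<k}" using m(1) by simp
next
  fix b assume "b \<in> q ` {..<k}"
  then obtain m where m: "m < k" "b = q m" by blast
  have "p m < r" using assms(1) m(1) by (auto simp: surjections_def PiE_iff)
  moreover have "q m < n" using assms(2) m(1) by (auto simp: tensor_index_def PiE_iff)
  ultimately show "b \<in> {b \<in> {..<n}. \<sigma> b < r}" using assms(3) m by (simp add: matching_def)
qed

lemma coefficient_map_eq:
  assumes p: "p \<in> surjections k {..<r}" and L: "L \<in> S" and q: "q \<in> tensor_index n k"
    and \<sigma>: "matching k \<sigma> q p" and v: "v \<in> coord_space T"
  shows "coefficient_map k p L v q = act (R \<sigma> {..<n}) v L"
proof -
  define \<tau> where "\<tau> = (SOME \<sigma>. matching k \<sigma> q p)"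
  have \<tau>: "matching k \<tau> q p" unfolding \<tau>_def by (rule someI[of _ \<sigma>]) (rule \<sigma>)
  have perm: "\<sigma> permutes {..<n}" "\<tau> permutes {..<n}" using \<sigma> \<tau> by (simp_all add: matching_def)
  have "R \<sigma> (q ` {..<k}) = R \<tau> (q ` {..<k})"
    using \<sigma> \<tau> by (intro rook_mat_cong) (auto simp: matching_def)
  then have "act (R \<tau> {..<n}) v L = act (R \<sigma> {..<n}) v L"
    unfolding act_coefficient[OF perm(1) v L, of "{..<n}"] act_coefficient[OF perm(2) v L, of "{..<n}"]
      matching_preimage[OF p q \<sigma>] matching_preimage[OF p q \<tau>] by simp
  then show ?thesis using q \<sigma> unfolding coefficient_map_def \<tau>_def by auto
qed

lemma coefficient_map_0:
  "\<lbrakk>\<And>\<sigma>. \<not> matching k \<sigma> q p\<rbrakk> \<Longrightarrow> coefficient_map k p L v q = 0"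
  by (simp add: coefficient_map_def)

text \<open>
  Let \<open>A\<close> be the restriction of \<open>\<tau>\<close> to \<open>D\<close>, and let \<open>\<tau>\<close> carry \<open>s\<close> to \<open>q\<close>. If \<open>\<sigma>\<close> carries \<open>q\<close> to \<open>p\<close>, then \<open>\<sigma> \<tau>\<close>
  carries \<open>s\<close> to \<open>p\<close>, and both sides are the coefficient in \<open>\<sigma> \<tau> v\<close> unless some value of \<open>s\<close> is outside
  \<open>D\<close>. In that case the tensor power gives zero, and so does \<open>V\<close>, because the relevant part of \<open>\<sigma> A\<close> has
  rank less than \<open>r\<close>.
\<close>

lemma coefficient_map_intertwiner:
  assumes p: "p \<in> surjections k {..<r}" and L: "L \<in> S"
  shows "coefficient_map k p L \<in> intertwiners (rook_monoid n) V (tensor_rep n k)"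
proof (rule intertwinersI)
  let ?B = "tensor_index n k" and ?N = "{..<n}"
  have B: "rep_space (tensor_rep n k) = coord_space ?B" "rep_act (tensor_rep n k) = tensor_act n k"
    by (simp_all add: tensor_rep_def)
  show "coefficient_map k p L v \<in> rep_space (tensor_rep n k)" for v
    by (simp add: B coord_space_def coefficient_map_def)
  have "coefficient_map k p L (u + v) q = coefficient_map k p L u q + coefficient_map k p L v q"
    if "u \<in> coord_space T" "v \<in> coord_space T" for u v q
  proof (cases "q \<in> ?B \<and> (\<exists>\<sigma>. matching k \<sigma> q p)")
    case True
    then obtain \<sigma> where \<sigma>: "q \<in> ?B" "matching k \<sigma> q p" by blast
    then have "\<sigma> permutes ?N" by (simp add: matching_def)
    then show ?thesis
      unfolding coefficient_map_eq[OF p L \<sigma> that(1)] coefficient_map_eq[OF p L \<sigma> that(2)]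
        coefficient_map_eq[OF p L \<sigma> fvs.subspace_add[OF subspace_coord_space that]]
      using linear_map_on_add[OF act_linear that] by simp
  qed (auto simp: coefficient_map_def)
  moreover have "coefficient_map k p L (cscale c v) q = c * coefficient_map k p L v q"
    if "v \<in> coord_space T" for c v q
  proof (cases "q \<in> ?B \<and> (\<exists>\<sigma>. matching k \<sigma> q p)")
    case True
    then obtain \<sigma> where \<sigma>: "q \<in> ?B" "matching k \<sigma> q p" by blast
    then have "\<sigma> permutes ?N" by (simp add: matching_def)
    then show ?thesis
      unfolding coefficient_map_eq[OF p L \<sigma> that]
        coefficient_map_eq[OF p L \<sigma> fvs.subspace_scale[OF subspace_coord_space that]]
      using linear_map_on_scale[OF act_linear that] by simp
  qed (auto simp: coefficient_map_def)
  ultimately show "linear_map_on (rep_space V) (coefficient_map k p L)"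
    unfolding linear_map_on_def space by (simp add: fun_eq_iff)
  fix A v assume "A \<in> carrier (rook_monoid n)" and "v \<in> rep_space V"
  then obtain \<tau> D where A: "\<tau> permutes ?N" "D \<subseteq> ?N" "A = R \<tau> D" and v: "v \<in> coord_space T"
    by (auto simp: space elim: rook_monoid_elementE)
  note Av = act_space[OF A(1) v, of D, folded A(3)]
  show "coefficient_map k p L (act A v) = rep_act (tensor_rep n k) A (coefficient_map k p L v)"
  proof
    fix q
    show "coefficient_map k p L (act A v) q = rep_act (tensor_rep n k) A (coefficient_map k p L v) q"
    proof (cases "q \<in> ?B")
      case q: True
      obtain s where s: "s \<in> ?B" "\<And>m. m < k \<Longrightarrow> \<tau> (s m) = q m" using preimage_index[OF A(1) q] by metis
      have rhs: "rep_act (tensor_rep n k) A (coefficient_map k p L v) q =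
          (if \<forall>m<k. s m \<in> D then coefficient_map k p L v s else 0)"
        unfolding A(3) B by (rule tensor_act_rook_mat[OF A(1) q s])
      show ?thesis
      proof (cases "\<exists>\<sigma>. matching k \<sigma> q p")
        case True
        then obtain \<sigma> where \<sigma>: "matching k \<sigma> q p" by blast
        have perm: "\<sigma> permutes ?N" "\<sigma> \<circ> \<tau> permutes ?N"
          using \<sigma> permutes_compose[OF A(1)] by (auto simp: matching_def)
        have \<sigma>\<tau>: "matching k (\<sigma> \<circ> \<tau>) s p" using \<sigma> perm(2) s(2) by (simp add: matching_def)
        have "{b \<in> {b \<in> D. \<tau> b \<in> ?N}. (\<sigma> \<circ> \<tau>) b < r} = D \<inter> {b \<in> ?N. (\<sigma> \<circ> \<tau>) b < r}"
          using A(2) permutes_in_image[OF A(1)] by auto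
        also have "\<dots> = D \<inter> s ` {..<k}" unfolding matching_preimage[OF p s(1) \<sigma>\<tau>] ..
        finally have dom: "{b \<in> {b \<in> D. \<tau> b \<in> ?N}. (\<sigma> \<circ> \<tau>) b < r} = D \<inter> s ` {..<k}" .
        have lhs: "coefficient_map k p L (act A v) q = act (R (\<sigma> \<circ> \<tau>) (D \<inter> s ` {..<k})) v L"
        proof -
          have "coefficient_map k p L (act A v) q = act (R \<sigma> ?N) (act A v) L"
            by (rule coefficient_map_eq[OF p L q \<sigma> Av])
          also have "\<dots> = act (R (\<sigma> \<circ> \<tau>) (D \<inter> s ` {..<k})) v L"
            unfolding A(3) act_mult[OF perm(1) A(1) v]
              act_coefficient[OF perm(2) v L, of "{b \<in> D. \<tau> b \<in> ?N}"] dom by (rule refl)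
          finally show ?thesis .
        qed
        show ?thesis
        proof (cases "\<forall>m<k. s m \<in> D")
          case True
          then have "D \<inter> s ` {..<k} = s ` {..<k}" by auto
          then have "coefficient_map k p L (act A v) q = act (R (\<sigma> \<circ> \<tau>) {b \<in> ?N. (\<sigma> \<circ> \<tau>) b < r}) v L"
            unfolding lhs matching_preimage[OF p s(1) \<sigma>\<tau>] by simp
          also have "\<dots> = coefficient_map k p L v s"
            unfolding coefficient_map_eq[OF p L s(1) \<sigma>\<tau> v] by (rule act_coefficient[OF perm(2) v L, symmetric])
          finally show ?thesis using True rhs by simp
        next
          case False
          then have "D \<inter> s ` {..<k} \<subset> s ` {..<k}" by auto
          then have "card (D \<inter> s ` {..<k}) < card (s ` {..<k})" by (intro psubset_card_mono) auto
          also have "card (s ` {..<k}) = card {b \<in> ?N. (\<sigma> \<circ> \<tau>) b < r}"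
            by (simp only: matching_preimage[OF p s(1) \<sigma>\<tau>])
          also have "\<dots> = card ((\<sigma> \<circ> \<tau>) ` {b \<in> ?N. (\<sigma> \<circ> \<tau>) b < r})"
            using permutes_inj[OF perm(2)] by (intro card_image[symmetric]) (auto simp: inj_on_def inj_def)
          also have "\<dots> \<le> card {..<r}" by (intro card_mono) auto
          finally have "card (D \<inter> s ` {..<k}) < r" by simp
          then have "act (R (\<sigma> \<circ> \<tau>) (D \<inter> s ` {..<k})) v = 0"
            using A(2) by (intro act_small_rank[OF perm(2) _ _ v]) auto
          then show ?thesis using rhs[unfolded if_not_P[OF False]] lhs by simp
        qed
      next
        case False
        have "\<not> matching k \<sigma> s p" for \<sigma>
        proof
          assume \<sigma>: "matching k \<sigma> s p"
          have "matching k (\<sigma> \<circ> inv_into UNIV \<tau>) q p"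
            unfolding matching_def
          proof (intro conjI allI impI)
            show "\<sigma> \<circ> inv_into UNIV \<tau> permutes ?N"
              using \<sigma> by (intro permutes_compose permutes_inv A(1)) (simp add: matching_def)
            show "(\<sigma> \<circ> inv_into UNIV \<tau>) (q m) = p m" if "m < k" for m
              using \<sigma> s(2)[OF that] permutes_inverses(2)[OF A(1), of "s m"] that by (simp add: matching_def)
          qed
          then show False using False by blast
        qed
        then show ?thesis using False rhs coefficient_map_0[of k q p] coefficient_map_0[of k s p] by simp
      qed
    qed (simp add: B tensor_act_outside coefficient_map_def)
  qed
qed

text \<open>
  An index \<open>q\<close> belongs to at most one orbit of surjections: comparing two matchings of \<open>q\<close> gives a
  permutation that maps \<open>{..<r}\<close> to itself and carries one representative to the other.
\<close>

lemma matching_unique: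
  assumes P: "P \<subseteq> surjections k {..<r}"
    and unique: "\<And>p q \<sigma>. p \<in> P \<Longrightarrow> q \<in> P \<Longrightarrow> \<sigma> permutes {..<r} \<Longrightarrow> (\<forall>m<k. \<sigma> (p m) = q m) \<Longrightarrow> p = q"
    and "p \<in> P" "p' \<in> P" "matching k \<sigma> q p" "matching k \<sigma>' q p'"
  shows "p = p'"
proof -
  define \<tau> where "\<tau> = \<sigma>' \<circ> inv_into UNIV \<sigma>"
  have perm: "\<sigma> permutes {..<n}" "\<sigma>' permutes {..<n}" using assms(5,6) by (simp_all add: matching_def)
  have \<tau>: "\<tau> permutes {..<n}" unfolding \<tau>_def by (intro permutes_compose permutes_inv perm)
  have pp': "\<tau> (p m) = p' m" if "m < k" for m
    using assms(5,6) that permutes_inverses(2)[OF perm(1), of "q m"] by (auto simp: \<tau>_def matching_def)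
  have img: "p ` {..<k} = {..<r}" "p' ` {..<k} = {..<r}" using P assms(3,4) by (auto simp: surjections_def)
  have "\<tau> ` {..<r} = p' ` {..<k}" unfolding img(1)[symmetric] image_image using pp' by (intro image_cong) auto
  then have bij: "bij_betw \<tau> {..<r} {..<r}"
    using img(2) permutes_inj[OF \<tau>] by (auto simp: bij_betw_def intro: inj_on_subset)
  define \<tau>' where "\<tau>' = (\<lambda>x. if x < r then \<tau> x else x)"
  have "bij_betw \<tau>' {..<r} {..<r}"
    using bij by (rule bij_betw_cong[THEN iffD1, rotated]) (simp add: \<tau>'_def)
  then have "\<tau>' permutes {..<r}" by (rule bij_imp_permutes) (simp add: \<tau>'_def)
  moreover have "\<forall>m<k. \<tau>' (p m) = p' m" using pp' img(1) by (auto simp: \<tau>'_def)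
  ultimately show ?thesis by (rule unique[OF assms(3,4)])
qed

lemma S_le_index: "surjections k {..<r} \<subseteq> tensor_index n k"
proof
  fix p assume "p \<in> surjections k {..<r}"
  then have p: "p \<in> {..<k} \<rightarrow>\<^sub>E {..<r}" by (simp add: surjections_def)
  have "{..<r} \<subseteq> {..<n}" using size by simp
  from PiE_mono[OF this] p show "p \<in> tensor_index n k" unfolding tensor_index_def by blast
qed

lemma v0_restriction: "entry_restriction \<mu> {..<r} v0 = v0"
  using unit_fun_in_coord_space[OF reading_tableau_S] by (simp add: coord_space_S)

text \<open>
  The vectors all of whose translates are killed by a given linear form make up an invariant subspace.
  If it contains \<open>v0\<close>, it is everything by irreducibility, and in particular contains the basis vectors.
\<close>

lemma coefficient_form_zero:
  assumes zero: "\<And>\<sigma>. \<sigma> permutes {..<n} \<Longrightarrow> (\<Sum>L\<in>S. c L * act (R \<sigma> {..<n}) v0 L) = 0"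
    and L: "L \<in> S"
  shows "c L = 0"
proof -
  let ?N = "{..<n}"
  define form where "form = (\<lambda>f :: (nat \<times> nat \<Rightarrow> nat) \<Rightarrow> complex. \<Sum>L\<in>S. c L * f L)"
  have form_add: "form (f + g) = form f + form g" and form_scale: "form (cscale a f) = a * form f"
    and form_0: "form 0 = 0" for f g a
    by (simp_all add: form_def algebra_simps sum.distrib sum_distrib_left)
  define U where "U = {f \<in> coord_space T. \<forall>\<sigma> D. \<sigma> permutes ?N \<longrightarrow> form (act (R \<sigma> D) f) = 0}"
  have "fvs.subspace U"
    unfolding fvs.subspace_def
  proof (intro conjI ballI allI)
    have "act (R \<sigma> D) 0 = 0" if "\<sigma> permutes ?N" for \<sigma> D
      by (rule linear_map_on_0[OF act_linear[OF that] subspace_coord_space])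
    then show "0 \<in> U" using fvs.subspace_0[OF subspace_coord_space] by (simp add: U_def form_0)
    show "f + g \<in> U" if "f \<in> U" "g \<in> U" for f g
      using that fvs.subspace_add[OF subspace_coord_space, of f T g]
      by (simp add: U_def linear_map_on_add[OF act_linear] form_add)
    show "cscale a f \<in> U" if "f \<in> U" for a f
      using that fvs.subspace_scale[OF subspace_coord_space, of f T a]
      by (simp add: U_def linear_map_on_scale[OF act_linear] form_scale)
  qed
  moreover have "act A f \<in> U" if A': "A \<in> carrier (rook_monoid n)" and f: "f \<in> U" for A f
  proof -
    obtain \<tau> E where A: "\<tau> permutes ?N" "A = R \<tau> E" using A' by (rule rook_monoid_elementE)
    have fT: "f \<in> coord_space T" using f by (simp add: U_def)
    have "form (act (R \<sigma> D) (act A f)) = 0" if "\<sigma> permutes ?N" for \<sigma> D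
      unfolding A(2) act_mult[OF that A(1) fT] using f permutes_compose[OF A(1) that] by (simp add: U_def)
    then show ?thesis using act_space[OF A(1) fT] by (simp add: U_def A(2))
  qed
  ultimately have "invariant_subspace (rook_monoid n) V U"
    by (auto simp: invariant_subspace_def space U_def)
  then have cases: "U = {0} \<or> U = coord_space T"
    using irreducible by (simp add: irreducible_rep_def space)
  have "form (act (R \<sigma> D) v0) = 0" if \<sigma>: "\<sigma> permutes ?N" for \<sigma> D
  proof -
    have "act (R \<sigma> D) v0 = act (R \<sigma> D) (act (R id {..<r}) v0)"
      using act_idempotent[OF _ v0_space, of "{..<r}"] v0_restriction size by simp
    also have "\<dots> = act (R \<sigma> {b \<in> {..<r}. b \<in> D}) v0"
      unfolding act_mult[OF \<sigma> permutes_id v0_space] by simp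
    finally have eq: "act (R \<sigma> D) v0 = act (R \<sigma> {b \<in> {..<r}. b \<in> D}) v0" .
    show ?thesis
    proof (cases "{..<r} \<subseteq> D")
      case True
      then have "{b \<in> {..<r}. b \<in> D} = {..<r}" by auto
      then have "act (R \<sigma> D) v0 = act (R \<sigma> ?N) v0"
        unfolding eq using act_factor[OF \<sigma> _ v0_space, of "{..<r}"] v0_restriction size by simp
      then show ?thesis using zero[OF \<sigma>] by (simp add: form_def)
    next
      case False
      then have "{b \<in> {..<r}. b \<in> D} \<subset> {..<r}" by auto
      then have "card {b \<in> {..<r}. b \<in> D} < card {..<r}" by (intro psubset_card_mono) auto
      then have "act (R \<sigma> {b \<in> {..<r}. b \<in> D}) v0 = 0"
        using size by (intro act_small_rank[OF \<sigma> _ _ v0_space]) auto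
      then show ?thesis unfolding eq by (simp add: form_0)
    qed
  qed
  then have "v0 \<in> U" using v0_space by (simp add: U_def)
  then have U: "U = coord_space T" using cases unit_fun_nonzero[of "reading_tableau \<mu>"] by auto
  have LT: "unit_fun L \<in> coord_space T" using L by (intro unit_fun_in_coord_space) (simp add: S_eq)
  then have "form (act (R id ?N) (unit_fun L)) = 0" using U permutes_id[of ?N] unfolding U_def by blast
  then have "(\<Sum>K\<in>S. c K * unit_fun L K) = 0" using act_one[OF LT] by (simp add: form_def)
  moreover have "(\<Sum>K\<in>S. c K * unit_fun L K) = (\<Sum>K\<in>S. if K = L then c K else 0)"
    by (intro sum.cong) (auto simp: unit_fun_def)
  moreover have "finite S" using finite_n_standard_tableaux by (simp add: S_eq)
  ultimately show ?thesis using L by simp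
qed

lemma transported_value:
  assumes \<phi>: "\<phi> \<in> intertwiners (rook_monoid n) V (tensor_rep n k)" and v: "v \<in> coord_space T"
    and q: "q \<in> tensor_index n k" and p: "p \<in> tensor_index n k" and \<sigma>: "matching k \<sigma> q p"
  shows "\<phi> (act (R \<sigma> D) v) p = (if \<forall>m<k. q m \<in> D then \<phi> v q else 0)"
proof -
  have perm: "\<sigma> permutes {..<n}" and eq: "\<And>m. m < k \<Longrightarrow> \<sigma> (q m) = p m" using \<sigma> by (simp_all add: matching_def)
  have "\<phi> (act (R \<sigma> D) v) = tensor_act n k (R \<sigma> D) (\<phi> v)"
    using intertwinersD(3)[OF \<phi> rook_mat_in_carrier[OF perm]] v by (simp add: space tensor_rep_def)
  then show ?thesis using tensor_act_rook_mat[OF perm p q eq] by simp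
qed

text \<open>
  The value at \<open>q\<close> is the value of the image of \<open>\<sigma> v0\<close> at the representative \<open>p\<close>. Only the standard Young
  tableaux contribute there, since any other tableau lacks an entry corresponding to a value of \<open>p\<close>.
\<close>

lemma intertwiner_expansion:
  assumes \<phi>: "\<phi> \<in> intertwiners (rook_monoid n) V (tensor_rep n k)" and q: "q \<in> tensor_index n k"
    and p: "p \<in> surjections k {..<r}" and \<sigma>: "matching k \<sigma> q p"
  shows "\<phi> v0 q = (\<Sum>L\<in>S. \<phi> (unit_fun L) p * act (R \<sigma> {..<n}) v0 L)"
proof -
  have perm: "\<sigma> permutes {..<n}" using \<sigma> by (simp add: matching_def)
  have pB: "p \<in> tensor_index n k" using p S_le_index by blast
  have finS: "finite S" using finite_n_standard_tableaux by (simp add: S_eq)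
  define u where "u = act (R \<sigma> {..<n}) v0"
  have u: "u \<in> coord_space T" unfolding u_def by (rule act_space[OF perm v0_space])
  have "\<phi> v0 q = \<phi> u p"
    unfolding u_def transported_value[OF \<phi> v0_space q pB \<sigma>] using q by (auto simp: tensor_index_def PiE_iff)
  also have "\<dots> = (\<Sum>L\<in>T. u L * \<phi> (unit_fun L) p)"
    using linear_map_on_expansion[OF finite_n_standard_tableaux intertwinersD(1)[OF \<phi>, unfolded space] u]
    by (simp add: sum_fun_apply)
  also have "\<dots> = (\<Sum>L\<in>S. u L * \<phi> (unit_fun L) p)"
  proof (rule sum.mono_neutral_right[OF finite_n_standard_tableaux])
    show "S \<subseteq> T" by (auto simp: S_eq)
    show "\<forall>L\<in>T - S. u L * \<phi> (unit_fun L) p = 0"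
    proof
      fix L assume L: "L \<in> T - S"
      then have LT: "L \<in> T" by simp
      define D where "D = {d \<in> {..<n}. Suc d \<in> entries \<mu> L}"
      have sub: "entries \<mu> L \<subseteq> Suc ` D"
      proof
        fix x assume x: "x \<in> entries \<mu> L"
        then have "x \<in> {1..n}" using entries_subset[OF LT] by blast
        then obtain y where "x = Suc y" "y < n" by (cases x) auto
        then show "x \<in> Suc ` D" using x by (simp add: D_def)
      qed
      have uL: "unit_fun L \<in> coord_space T" by (rule unit_fun_in_coord_space[OF LT])
      have Dn: "D \<subseteq> {..<n}" by (auto simp: D_def)
      have "entry_restriction \<mu> D (unit_fun L) K = unit_fun L K" for K
        using sub by (auto simp: entry_restriction_def unit_fun_def)
      then have "entry_restriction \<mu> D (unit_fun L) = unit_fun L" by (rule ext)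
      then have "act (R id D) (unit_fun L) = unit_fun L" using act_idempotent[OF Dn uL] by simp
      moreover have "matching k id p p" by (simp add: matching_def permutes_id)
      ultimately have eq: "\<phi> (unit_fun L) p = (if \<forall>m<k. p m \<in> D then \<phi> (unit_fun L) p else 0)"
        using transported_value[OF \<phi> uL pB pB, of id D] by simp
      have neg: "\<not> (\<forall>m<k. p m \<in> D)"
      proof
        assume "\<forall>m<k. p m \<in> D"
        then have "p ` {..<k} \<subseteq> D" by auto
        then have "{..<r} \<subseteq> D" using p by (simp add: surjections_def)
        then have "Suc ` {..<r} \<subseteq> entries \<mu> L" by (auto simp: D_def)
        then have "{1..r} = entries \<mu> L"
          using card_entries[OF LT] finite_subset[OF entries_subset[OF LT]]
          by (intro card_subset_eq) (simp_all add: image_Suc_lessThan)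
        then show False using L by (simp add: S_eq)
      qed
      show "u L * \<phi> (unit_fun L) p = 0" using eq[unfolded if_not_P[OF neg]] by simp
    qed
  qed
  finally show ?thesis by (simp add: u_def mult.commute)
qed

text \<open>
  If \<open>q\<close> has fewer than \<open>r\<close> values, the idempotent of these values fixes \<open>e\<^sub>q\<close> and kills \<open>v0\<close>; if it has
  more, the idempotent of \<open>{..<r}\<close> fixes \<open>v0\<close> and kills \<open>e\<^sub>q\<close>.
\<close>

lemma intertwiner_support:
  assumes \<phi>: "\<phi> \<in> intertwiners (rook_monoid n) V (tensor_rep n k)" and q: "q \<in> tensor_index n k"
    and "card (q ` {..<k}) \<noteq> r"
  shows "\<phi> v0 q = 0"
proof -
  let ?D = "q ` {..<k}"
  have D: "?D \<subseteq> {..<n}" using q by (auto simp: tensor_index_def PiE_iff)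
  have "matching k id q q" by (simp add: matching_def permutes_id)
  note val = transported_value[OF \<phi> v0_space q q this]
  consider "card ?D < r" | "r < card ?D" using assms(3) by linarith
  then show ?thesis
  proof cases
    case 1
    have "\<phi> v0 q = \<phi> (act (R id ?D) v0) q" using val[of ?D] by simp
    also have "act (R id ?D) v0 = 0" by (rule act_small_rank[OF permutes_id D 1 v0_space])
    also have "\<phi> 0 = 0"
      by (rule linear_map_on_0[OF intertwinersD(1)[OF \<phi>, unfolded space] subspace_coord_space])
    finally show ?thesis by simp
  next
    case 2
    have "\<not> ?D \<subseteq> {..<r}" using 2 card_mono[of "{..<r}" ?D] by auto
    then have neg: "\<not> (\<forall>m<k. q m \<in> {..<r})" by auto
    have "act (R id {..<r}) v0 = v0"
      using act_idempotent[OF _ v0_space, of "{..<r}"] v0_restriction size by simp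
    then show ?thesis using val[of "{..<r}", unfolded if_not_P[OF neg]] by simp
  qed
qed

text \<open>
  The images of \<open>v0\<close> under the coefficient maps of orbit representatives and standard Young tableaux
  form a basis: maps of different orbits have disjoint supports, for one orbit independence is
  \<open>coefficient_form_zero\<close>, and \<open>intertwiner_expansion\<close> writes any intertwiner in terms of them.
\<close>

theorem dim_intertwiners:
  "fvs.dim ((\<lambda>\<phi>. \<phi> v0) ` intertwiners (rook_monoid n) V (tensor_rep n k)) = Stirling k r * num_SYT \<mu>"
proof -
  let ?B = "tensor_index n k" and ?N = "{..<n}"
  obtain P where P: "finite P" "P \<subseteq> surjections k {..<r}" "card P = Stirling k r"
    and reach: "\<And>p. p \<in> surjections k {..<r} \<Longrightarrow> \<exists>q\<in>P. \<exists>\<sigma>. \<sigma> permutes {..<r} \<and> (\<forall>m<k. \<sigma> (p m) = q m)"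
    and unique: "\<And>p q \<sigma>. p \<in> P \<Longrightarrow> q \<in> P \<Longrightarrow> \<sigma> permutes {..<r} \<Longrightarrow> (\<forall>m<k. \<sigma> (p m) = q m) \<Longrightarrow> p = q"
    by (rule orbit_transversal[of k r], rule that)
  have finS: "finite S" using finite_n_standard_tableaux by (simp add: S_eq)
  define w where "w = (\<lambda>(p, L). coefficient_map k p L v0)"
  have combination: "(\<Sum>x\<in>P \<times> S. cscale (c x) (w x)) q = (\<Sum>L\<in>S. c (p, L) * act (R \<sigma> ?N) v0 L)"
    if q: "q \<in> ?B" and p: "p \<in> P" and \<sigma>: "matching k \<sigma> q p" for c q p \<sigma>
  proof -
    have "(\<Sum>x\<in>P \<times> S. cscale (c x) (w x)) q = (\<Sum>p'\<in>P. \<Sum>L\<in>S. c (p', L) * coefficient_map k p' L v0 q)"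
      by (simp add: sum_fun_apply w_def sum.cartesian_product split_def)
    also have "\<dots> = (\<Sum>p'\<in>P. if p' = p then (\<Sum>L\<in>S. c (p, L) * act (R \<sigma> ?N) v0 L) else 0)"
    proof (rule sum.cong[OF refl])
      fix p' assume p': "p' \<in> P"
      show "(\<Sum>L\<in>S. c (p', L) * coefficient_map k p' L v0 q) =
          (if p' = p then (\<Sum>L\<in>S. c (p, L) * act (R \<sigma> ?N) v0 L) else 0)"
      proof (cases "p' = p")
        case True
        have "coefficient_map k p L v0 q = act (R \<sigma> ?N) v0 L" if "L \<in> S" for L
          using p P(2) by (intro coefficient_map_eq[OF _ that q \<sigma> v0_space]) blast
        then show ?thesis using True by (auto intro!: sum.cong)
      next
        case False
        have "\<not> matching k \<sigma>' q p'" for \<sigma>'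
        proof
          assume "matching k \<sigma>' q p'"
          have "p = p'"
            by (rule matching_unique[OF P(2) _ p p' \<sigma> \<open>matching k \<sigma>' q p'\<close>], rule unique)
          then show False using False by simp
        qed
        then show ?thesis using False coefficient_map_0[of k q p'] by simp
      qed
    qed
    finally show ?thesis using P(1) p by simp
  qed
  have "fvs.dim ((\<lambda>\<phi>. \<phi> v0) ` intertwiners (rook_monoid n) V (tensor_rep n k)) = card (P \<times> S)"
  proof (rule dim_eq_card_family[where w = w])
    show "finite (P \<times> S)" using P(1) finS by simp
  next
    fix c assume c: "(\<Sum>x\<in>P \<times> S. cscale (c x) (w x)) = 0"
    show "\<forall>x\<in>P \<times> S. c x = 0"
    proof (clarify)
      fix p L assume p: "p \<in> P" and L: "L \<in> S"
      have "(\<Sum>L\<in>S. c (p, L) * act (R \<sigma> ?N) v0 L) = 0" if \<sigma>: "\<sigma> permutes ?N" for \<sigma>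
      proof -
        have "p \<in> ?B" using p P(2) S_le_index by blast
        then obtain q where "q \<in> ?B" "\<And>m. m < k \<Longrightarrow> \<sigma> (q m) = p m" using preimage_index[OF \<sigma>] by metis
        then show ?thesis using combination[of q p \<sigma> c] c p \<sigma> by (simp add: matching_def)
      qed
      then show "c (p, L) = 0" by (rule coefficient_form_zero[OF _ L])
    qed
  next
    show "w ` (P \<times> S) \<subseteq> (\<lambda>\<phi>. \<phi> v0) ` intertwiners (rook_monoid n) V (tensor_rep n k)"
      using coefficient_map_intertwiner P(2) by (auto simp: w_def)
  next
    show "(\<lambda>\<phi>. \<phi> v0) ` intertwiners (rook_monoid n) V (tensor_rep n k) \<subseteq> fvs.span (w ` (P \<times> S))"
    proof (rule image_subsetI)
      fix \<phi> assume \<phi>: "\<phi> \<in> intertwiners (rook_monoid n) V (tensor_rep n k)"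
      define c where "c = (\<lambda>(p, L). \<phi> (unit_fun L) p)"
      have "\<phi> v0 q = (\<Sum>x\<in>P \<times> S. cscale (c x) (w x)) q" for q
      proof (cases "q \<in> ?B \<and> (\<exists>p\<in>P. \<exists>\<sigma>. matching k \<sigma> q p)")
        case True
        then obtain p \<sigma> where q: "q \<in> ?B" and p: "p \<in> P" and \<sigma>: "matching k \<sigma> q p" by blast
        have "p \<in> surjections k {..<r}" using p P(2) by blast
        from intertwiner_expansion[OF \<phi> q this \<sigma>] show ?thesis
          unfolding combination[OF q p \<sigma>] by (simp add: c_def)
      next
        case False
        have "(\<Sum>x\<in>P \<times> S. cscale (c x) (w x)) q = 0"
          using False unfolding sum_fun_apply
          by (intro sum.neutral) (auto simp: w_def coefficient_map_def)
        moreover have "\<phi> v0 q = 0"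
        proof (cases "q \<in> ?B")
          case q: True
          have "card (q ` {..<k}) \<noteq> r"
          proof
            assume "card (q ` {..<k}) = r"
            then obtain h where h: "bij_betw h (q ` {..<k}) {..<r}"
              using finite_same_card_bij[of "q ` {..<k}" "{..<r}"] by auto
            have "q ` {..<k} \<subseteq> ?N" using q by (auto simp: tensor_index_def PiE_iff)
            then obtain \<sigma> where \<sigma>: "\<sigma> permutes ?N" "\<And>b. b \<in> q ` {..<k} \<Longrightarrow> \<sigma> b = h b"
              using extend_to_permutation[of ?N h "q ` {..<k}"] h size by (auto simp: bij_betw_def)
            define p where "p = restrict (\<sigma> \<circ> q) {..<k}"
            have "p ` {..<k} = h ` q ` {..<k}" using \<sigma>(2) by (auto simp: p_def image_image)
            then have img: "p ` {..<k} = {..<r}" using h by (simp add: bij_betw_def)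
            then have "p \<in> surjections k {..<r}" by (auto simp: surjections_def PiE_iff p_def)
            then obtain p' \<tau> where p': "p' \<in> P" "\<tau> permutes {..<r}" "\<forall>m<k. \<tau> (p m) = p' m"
              using reach by blast
            have "\<tau> permutes ?N" using size by (intro permutes_subset[OF p'(2)]) auto
            then have "matching k (\<tau> \<circ> \<sigma>) q p'"
              using p'(3) permutes_compose[OF \<sigma>(1)] by (auto simp: matching_def p_def)
            then show False using False q p'(1) by blast
          qed
          then show ?thesis by (rule intertwiner_support[OF \<phi> q])
        next
          case False
          then show ?thesis
            using intertwinersD(2)[OF \<phi>, of v0] v0_space by (auto simp: space tensor_rep_def coord_space_def)
        qed
        ultimately show ?thesis by simp
      qed
      then have "\<phi> v0 = (\<Sum>x\<in>P \<times> S. cscale (c x) (w x))" by (rule ext)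
      also have "\<dots> \<in> fvs.span (w ` (P \<times> S))"
        by (intro fvs.span_sum fvs.span_scale fvs.span_base imageI)
      finally show "\<phi> v0 \<in> fvs.span (w ` (P \<times> S))" .
    qed
  qed
  then show ?thesis using P(3) by (simp add: card_cartesian_product num_SYT_def)
qed

end

theorem theorem2p20:
  fixes n k r :: nat and \<mu> :: "nat list"
  assumes "n > 0" and "k > 0"
    and "\<mu> \<in> partitions_upto n" and "sum_list \<mu> = r"
  shows "has_multiplicity (rook_monoid n) (seminormal_rep n \<mu>) (tensor_rep n k)
           (Stirling k r * num_SYT \<mu>)"
proof -
  have \<mu>: "is_partition \<mu>" "sum_list \<mu> \<le> n" using assms(3) by (simp_all add: partitions_upto_def)
  have "is_seminormal_rep n \<mu> (seminormal_rep n \<mu>)"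
    unfolding seminormal_rep_def by (rule someI_ex[OF seminormal_rep_exists[OF \<mu>(1)]])
  then interpret seminormal_module n \<mu> "seminormal_rep n \<mu>" using \<mu> by unfold_locales
  have "card {U \<in> \<U>. rep_isomorphic (rook_monoid n) (subrep (tensor_rep n k) U) (seminormal_rep n \<mu>)} =
      Stirling k r * num_SYT \<mu>"
    if "irreducible_decomposition (rook_monoid n) (tensor_rep n k) \<U>" for \<U>
    unfolding dim_intertwiners[of k, unfolded assms(4), symmetric]
  proof (rule multiplicity_eq_dim[OF tensor_representation irreducible _ unit_fun_nonzero _ that])
    show "v0 \<in> rep_space (seminormal_rep n \<mu>)" unfolding space by (rule v0_space)
    show "\<exists>c. \<phi> v0 = cscale c v0"
      if "\<phi> \<in> intertwiners (rook_monoid n) (seminormal_rep n \<mu>) (seminormal_rep n \<mu>)" for \<phi>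
      by (rule endomorphism_scalar[OF that reading_tableau_S])
  qed
  then show ?thesis
    unfolding has_multiplicity_def using tensor_completely_reducible by blast
qed

end
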